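(* Let $W$ be a matrix $A_2$ weight on $\mathbb{R}^d$ ($d\ge2$), $\Omega\subseteq\mathbb{R}^d$ open, let the coefficients $A=(A^{\alpha\beta}_{ij})$ satisfy (E1) and (E2), and let $\vec u\in H^{1,2}(\Omega,W)$ be a weak solution of $\sum_j\sum_{\alpha,\beta}\partial_\alpha(A^{\alpha\beta}_{ij}\partial_\beta u_j)=0$, $i=1,\dots,n$. Then there exists $\gamma\approx[W]_{A_2}^{-8}$ such that for all concentric balls $B_r\subset B_R$ with $\overline{B_R}\subset\Omega$, $$\int_{B_r}\|W^{1/2}(x)D\vec u(x)\|^2dx\lesssim\left(\frac rR\right)^\gamma\int_{B_R}\|W^{1/2}(x)D\vec u(x)\|^2dx.$$
   Context: A matrix weight is $W:\mathbb{R}^d\to\mathcal{M}_{n\times n}(\mathbb{C})$ with locally integrable, a.e. positive definite values; $[W]_{A_2}=\sup_Q\frac1{|Q|}\int_Q\frac1{|Q|}\int_Q\|W^{1/2}(x)W^{-1/2}(y)\|^2dy\,dx<\infty$. Coefficients $A^{\alpha\beta}_{ij}:\Omega\to\mathbb{C}$ are measurable with, for a.e. $x$ and all $\eta,\nu\in\mathcal{M}_{n\times d}(\mathbb{C})$: (E1) $\mathrm{Re}\sum A^{\alpha\beta}_{ij}(x)\eta^j_\beta\overline{\eta^i_\alpha}\gtrsim\|W^{1/2}(x)\eta\|^2$; (E2) $|\sum A^{\alpha\beta}_{ij}(x)\nu^j_\beta\overline{\eta^i_\alpha}|\lesssim\|W^{1/2}(x)\eta\|\|W^{1/2}(x)\nu\|$.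 Weak solution: $\int_\Omega\sum A^{\alpha\beta}_{ij}\partial_\beta u_j\overline{\partial_\alpha\varphi_i}=0$ for all $\vec\varphi\in C_c^\infty(\Omega;\mathbb{C}^n)$. $H^{1,2}(\Omega,W)$ is the completion of smooth functions in the norm $(\int_\Omega|W^{1/2}\vec u|^2)^{1/2}+(\int_\Omega\|W^{1/2}D\vec u\|^2)^{1/2}$. Constants depend only on $n,d$ and the constants in (E1),(E2). *)

theory Defs
  imports "HOL-Analysis.Analysis"
begin

definition hermitian :: "complex^'n^'n \<Rightarrow> bool" where
  "hermitian M \<longleftrightarrow> (\<forall>i j. M $ i $ j = cnj (M $ j $ i))"

definition qform :: "complex^'n^'n \<Rightarrow> complex^'n \<Rightarrow> complex" where
  "qform M v = (\<Sum>i\<in>UNIV. \<Sum>j\<in>UNIV. cnj (v $ i) * M $ i $ j * v $ j)"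

definition pos_def :: "complex^'n^'n \<Rightarrow> bool" where
  "pos_def M \<longleftrightarrow> hermitian M \<and> (\<forall>v. v \<noteq> 0 \<longrightarrow> Re (qform M v) > 0)"

definition pos_semidef :: "complex^'n^'n \<Rightarrow> bool" where
  "pos_semidef M \<longleftrightarrow> hermitian M \<and> (\<forall>v. Re (qform M v) \<ge> 0)"

definition msqrt :: "complex^'n^'n \<Rightarrow> complex^'n^'n" where
  "msqrt M = (THE S. pos_semidef S \<and> S ** S = M)"

definition loc_integrable_matrix :: "('a::euclidean_space \<Rightarrow> complex^'n^'n) \<Rightarrow> bool" where
  "loc_integrable_matrix W \<longleftrightarrow>
     (\<forall>i j K. compact K \<longrightarrow> set_integrable lebesgue K (\<lambda>x. W x $ i $ j))"

definition matrix_weight :: "('a::euclidean_space \<Rightarrow> complex^'n^'n) \<Rightarrow> bool" where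
  "matrix_weight W \<longleftrightarrow> loc_integrable_matrix W \<and> (AE x in lebesgue. pos_def (W x))"

definition A2_char :: "(real^'d \<Rightarrow> complex^'n^'n) \<Rightarrow> ennreal" where
  "A2_char W = (SUP p \<in> UNIV \<times> {0<..}.
      (let Q = cbox (fst p) (fst p + snd p *\<^sub>R One) :: (real^'d) set;
           vQ = ennreal (snd p ^ CARD('d)) in
       (\<integral>\<^sup>+ x \<in> Q. (\<integral>\<^sup>+ y \<in> Q.
            ennreal ((onorm (\<lambda>v. msqrt (W x) *v (matrix_inv (msqrt (W y)) *v v)))\<^sup>2)
          \<partial>lebesgue) / vQ \<partial>lebesgue) / vQ))"

definition A2_weight :: "(real^'d \<Rightarrow> complex^'n^'n) \<Rightarrow> bool" where
  "A2_weight W \<longleftrightarrow> matrix_weight W \<and> A2_char W < \<infinity>"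

definition partial :: "'d \<Rightarrow> (real^'d \<Rightarrow> 'b::real_normed_vector) \<Rightarrow> real^'d \<Rightarrow> 'b" where
  "partial \<beta> f x = vector_derivative (\<lambda>t. f (x + t *\<^sub>R axis \<beta> 1)) (at 0)"

fun partials :: "'d list \<Rightarrow> (real^'d \<Rightarrow> 'b::real_normed_vector) \<Rightarrow> real^'d \<Rightarrow> 'b" where
  "partials [] f = f"
| "partials (\<beta> # bs) f = partial \<beta> (partials bs f)"

definition smooth_on :: "(real^'d) set \<Rightarrow> (real^'d \<Rightarrow> 'b::real_normed_vector) \<Rightarrow> bool" where
  "smooth_on \<Omega> f \<longleftrightarrow> (\<forall>bs. partials bs f differentiable_on \<Omega>)"

definition Dmat :: "(real^'d \<Rightarrow> complex^'n) \<Rightarrow> real^'d \<Rightarrow> complex^'d^'n" where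
  "Dmat \<phi> x = (\<chi> j \<beta>. partial \<beta> \<phi> x $ j)"

text \<open>An element of the completion is a pair \<open>(u, G)\<close> (function and its gradient \<open>G = Du\<close>)
  which is the limit, in the norm
  \<open>(\<integral>_\<Omega> |W^{1/2}u|^2)^{1/2} + (\<integral>_\<Omega> \<parallel>W^{1/2}Du\<parallel>^2)^{1/2}\<close>,
  of smooth functions on \<open>\<Omega>\<close>. The matrix norm is the Frobenius norm.\<close>
definition H12 :: "(real^'d) set \<Rightarrow> (real^'d \<Rightarrow> complex^'n^'n)
      \<Rightarrow> (real^'d \<Rightarrow> complex^'n) \<Rightarrow> (real^'d \<Rightarrow> complex^'d^'n) \<Rightarrow> bool" where
  "H12 \<Omega> W u G \<longleftrightarrow>
     u \<in> borel_measurable lebesgue \<and> G \<in> borel_measurable lebesgue \<and>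
     (\<integral>\<^sup>+ x \<in> \<Omega>. ennreal ((norm (msqrt (W x) *v u x))\<^sup>2) \<partial>lebesgue) < \<infinity> \<and>
     (\<integral>\<^sup>+ x \<in> \<Omega>. ennreal ((norm (msqrt (W x) ** G x))\<^sup>2) \<partial>lebesgue) < \<infinity> \<and>
     (\<exists>\<phi> :: nat \<Rightarrow> real^'d \<Rightarrow> complex^'n.
        (\<forall>k. smooth_on \<Omega> (\<phi> k)) \<and>
        ((\<lambda>k. (\<integral>\<^sup>+ x \<in> \<Omega>. ennreal ((norm (msqrt (W x) *v (u x - \<phi> k x)))\<^sup>2) \<partial>lebesgue)
             + (\<integral>\<^sup>+ x \<in> \<Omega>. ennreal ((norm (msqrt (W x) ** (G x - Dmat (\<phi> k) x)))\<^sup>2) \<partial>lebesgue))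
          \<longlonglongrightarrow> 0))"

type_synonym ('d, 'n) coeffs = "'d \<Rightarrow> 'd \<Rightarrow> 'n \<Rightarrow> 'n \<Rightarrow> real^'d \<Rightarrow> complex"

definition bform :: "('d::finite, 'n::finite) coeffs \<Rightarrow> real^'d \<Rightarrow> complex^'d^'n \<Rightarrow> complex^'d^'n \<Rightarrow> complex" where
  "bform A x \<nu> \<eta> = (\<Sum>\<alpha>\<in>UNIV. \<Sum>\<beta>\<in>UNIV. \<Sum>i\<in>UNIV. \<Sum>j\<in>UNIV.
       A \<alpha> \<beta> i j x * \<nu> $ j $ \<beta> * cnj (\<eta> $ i $ \<alpha>))"

definition coeffs_measurable :: "('d::finite, 'n::finite) coeffs \<Rightarrow> bool" where
  "coeffs_measurable A \<longleftrightarrow> (\<forall>\<alpha> \<beta> i j. A \<alpha> \<beta> i j \<in> borel_measurable lebesgue)"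

definition E1 :: "real \<Rightarrow> (real^'d \<Rightarrow> complex^'n^'n) \<Rightarrow> (real^'d) set \<Rightarrow> ('d::finite, 'n::finite) coeffs \<Rightarrow> bool" where
  "E1 c W \<Omega> A \<longleftrightarrow> (AE x in lebesgue. x \<in> \<Omega> \<longrightarrow>
     (\<forall>\<eta>. Re (bform A x \<eta> \<eta>) \<ge> c * (norm (msqrt (W x) ** \<eta>))\<^sup>2))"

definition E2 :: "real \<Rightarrow> (real^'d \<Rightarrow> complex^'n^'n) \<Rightarrow> (real^'d) set \<Rightarrow> ('d::finite, 'n::finite) coeffs \<Rightarrow> bool" where
  "E2 C W \<Omega> A \<longleftrightarrow> (AE x in lebesgue. x \<in> \<Omega> \<longrightarrow>
     (\<forall>\<eta> \<nu>. norm (bform A x \<nu> \<eta>) \<le> C * norm (msqrt (W x) ** \<eta>) * norm (msqrt (W x) ** \<nu>)))"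

text \<open>Weak solution, with \<open>G\<close> the gradient of \<open>u\<close> (as element of \<open>H^{1,2}\<close>), tested against
  \<open>C_c^\<infinity>(\<Omega>;\<complex>^n)\<close>.\<close>
definition weak_solution :: "(real^'d) set \<Rightarrow> ('d::finite, 'n::finite) coeffs \<Rightarrow> (real^'d \<Rightarrow> complex^'d^'n) \<Rightarrow> bool" where
  "weak_solution \<Omega> A G \<longleftrightarrow>
     (\<forall>\<phi> :: real^'d \<Rightarrow> complex^'n.
        smooth_on UNIV \<phi> \<and> compact (closure {x. \<phi> x \<noteq> 0}) \<and> closure {x. \<phi> x \<noteq> 0} \<subseteq> \<Omega>
        \<longrightarrow> (LINT x : \<Omega> | lebesgue. bform A x (G x) (Dmat \<phi> x)) = 0)"

end

theory Submission
  imports Defs "HOL-Computational_Algebra.Polynomial"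
begin

text \<open>
  The quadratic form of \<open>W(x)\<close> controls everything. Let \<open>\<sigma>(x, y) = \<parallel>W\<^sup>1\<^sup>/\<^sup>2(x) W\<^sup>-\<^sup>1\<^sup>/\<^sup>2(y)\<parallel>\<close>; the \<open>A\<^sub>2\<close>
  condition bounds the mean of \<open>\<sigma>\<^sup>2\<close> over \<open>Q \<times> Q\<close>. On a box, integrating along segments writes
  \<open>f(x)\<close> minus its mean as an average over \<open>t \<in> (0, 1)\<close> of means of \<open>Df\<close> over boxes of size
  comparable to \<open>t\<close> around \<open>x\<close>. Cauchy--Schwarz at each fixed \<open>t\<close> and Tonelli give an
  \<open>L\<^sup>2(W)\<close> Poincare inequality with constant linear in \<open>[W]\<close>. The cubical annulus
  \<open>Q\<^sub>3\<^sub>r - Q\<^sub>r\<close> is a union of \<open>2d\<close> overlapping boxes (this needs \<open>d \<ge> 2\<close>), and the doubling property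
  of \<open>|W\<^sup>1\<^sup>/\<^sup>2 v|\<^sup>2\<close> transfers mean values between them, so the annulus satisfies a Poincare
  inequality with constant of order \<open>[W]\<^sup>3\<close>. Testing the equation with a cutoff times the
  smooth approximants of \<open>u\<close> minus a constant then bounds the energy on \<open>Q\<^sub>r\<close> by \<open>C [W]\<^sup>2\<close> times
  the energy on the annulus, and filling the hole yields geometric decay along the cubes \<open>Q\<close> of
  side \<open>3\<^sup>k r\<close>. The resulting exponent \<open>[W]\<^sup>-\<^sup>2\<close> is better than \<open>[W]\<^sup>-\<^sup>8\<close>, since \<open>[W] \<ge> 1\<close>.
\<close>

section \<open>Square roots of positive definite matrices\<close>

text \<open>Two features shape the proof. In the kernel bound the scale t enters through t^(-2d)
  from two changes of variable and through t^(2d) from the volumes of boxes of size t; these cancel,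
  so integrating over t in (0, 1) costs nothing. The price is that W is evaluated at x + t (y - x),
  which calls for Borel measurability, while a weight is only Lebesgue measurable. W is therefore
  exchanged for a Borel version, and W^(1/2) for its quadratic form, which is visibly measurable.
  The constant subtracted from u is adapted to an annulus because hole filling can absorb only an
  annular right-hand side. Opposite faces of the annulus do not meet; they communicate through a
  face in a second coordinate direction, so each constant is moved at most twice. Every move costs
  [W], on top of the [W] of a single box, which accounts for [W]^3. The test function carries the
  cutoff to the first power and the cross term stays a product, so only the square root [W]^(3/2)
  enters the energy bound, and it is rounded up to [W]^2.\<close>

lemma inner_complex_vec: "(v::complex^'n) \<bullet> w = Re (\<Sum>i\<in>UNIV. cnj (v $ i) * w $ i)"
  by (simp add: inner_vec_def inner_complex_def)

lemma Re_qform: "Re (qform M v) = v \<bullet> (M *v v)"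
  by (simp add: inner_complex_vec qform_def matrix_vector_mult_def sum_distrib_left mult.assoc)

lemma hermitian_inner:
  fixes M :: "complex^'n^'n"
  assumes "hermitian M" shows "(M *v v) \<bullet> w = v \<bullet> (M *v w)"
proof -
  have "(\<Sum>i\<in>UNIV. cnj ((M *v v) $ i) * w $ i) = (\<Sum>i\<in>UNIV. \<Sum>j\<in>UNIV. cnj (M $ i $ j) * cnj (v $ j) * w $ i)"
    by (simp add: matrix_vector_mult_def sum_distrib_right)
  also have "\<dots> = (\<Sum>j\<in>UNIV. \<Sum>i\<in>UNIV. cnj (M $ i $ j) * cnj (v $ j) * w $ i)"
    by (rule sum.swap)
  also have "\<dots> = (\<Sum>j\<in>UNIV. \<Sum>i\<in>UNIV. cnj (v $ j) * (M $ j $ i * w $ i))"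
  proof (intro sum.cong refl)
    fix i j show "cnj (M $ i $ j) * cnj (v $ j) * w $ i = cnj (v $ j) * (M $ j $ i * w $ i)"
      using assms unfolding hermitian_def by (metis complex_cnj_cnj mult.assoc mult.commute)
  qed
  also have "\<dots> = (\<Sum>i\<in>UNIV. cnj (v $ i) * (M *v w) $ i)"
    by (simp add: matrix_vector_mult_def sum_distrib_left)
  finally show ?thesis by (simp add: inner_complex_vec)
qed

lemma matrix_mult_axis: "(M *v axis i a) $ k = M $ k $ i * (a::complex)"
  by (simp add: matrix_vector_mult_def axis_def if_distrib cong: if_cong)

lemma inner_axis_complex: "(v::complex^'n) \<bullet> axis j b = Re (cnj (v $ j) * b)"
  by (simp add: inner_axis inner_complex_def)

text \<open>The inner product here is the real part of the Hermitian one. Testing with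
  \<open>axis j b\<close> for b = 1 and b = i recovers real and imaginary part of each entry, so
  symmetry over the reals is enough for a complex matrix.\<close>

lemma hermitianI_inner:
  fixes M :: "complex^'n^'n"
  assumes "\<And>v w. (M *v v) \<bullet> w = v \<bullet> (M *v w)" shows "hermitian M"
  unfolding hermitian_def
proof (intro allI)
  fix i j
  have *: "Re (cnj (M $ j $ i) * b) = Re (M $ i $ j * b)" for b
    using assms[of "axis i 1" "axis j b"]
    by (simp add: inner_axis_complex matrix_mult_axis inner_commute[of "axis i 1"])
  show "M $ i $ j = cnj (M $ j $ i)"
    using *[of 1] *[of \<i>] by (simp add: complex_eq_iff)
qed

lemma pos_def_coercive:
  fixes M :: "complex^'n^'n"
  assumes "pos_def M"
  obtains m where "m > 0" "\<And>v. v \<bullet> (M *v v) \<ge> m * (norm v)\<^sup>2"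
proof -
  let ?S = "sphere (0::complex^'n) 1"
  have ne: "?S \<noteq> {}" using vector_choose_size[of 1, where 'a="complex^'n"] by force
  have cont: "continuous_on ?S (\<lambda>v. v \<bullet> (M *v v))"
    by (intro continuous_intros linear_continuous_on matrix_vector_mul_bounded_linear)
  obtain v0 where v0: "v0 \<in> ?S" "\<And>v. v \<in> ?S \<Longrightarrow> v0 \<bullet> (M *v v0) \<le> v \<bullet> (M *v v)"
    using continuous_attains_inf[OF compact_sphere ne cont] by blast
  define m where "m = v0 \<bullet> (M *v v0)"
  have "v0 \<noteq> 0" using v0(1) by auto
  then have "m > 0" using assms unfolding m_def pos_def_def Re_qform[symmetric] by blast
  moreover have "v \<bullet> (M *v v) \<ge> m * (norm v)\<^sup>2" for v
  proof (cases "v = 0")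
    case False
    have lin: "M *v (r *\<^sub>R v) = r *\<^sub>R (M *v v)" for r
      using matrix_vector_mul_bounded_linear[of M] by (simp add: linear_simps)
    have "m \<le> (v /\<^sub>R norm v) \<bullet> (M *v (v /\<^sub>R norm v))"
      unfolding m_def by (rule v0(2)) (use False in simp)
    also have "\<dots> = (v \<bullet> (M *v v)) / (norm v)\<^sup>2"
      by (simp add: lin power2_eq_square divide_inverse)
    finally show ?thesis using False by (simp add: pos_le_divide_eq)
  qed (simp)
  ultimately show ?thesis using that by blast
qed

text \<open>For small \<open>\<epsilon>\<close> the matrix \<open>B = 1 - \<epsilon> M\<close> has operator norm below 1, so that
  \<open>Y \<mapsto> (B + Y\<^sup>2) / 2\<close> is a contraction; its fixed point satisfies \<open>(1 - Y)\<^sup>2 = \<epsilon> M\<close>.\<close>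
lemma pos_def_sqrt_exists:
  fixes M :: "complex^'n^'n"
  assumes pd: "pos_def M"
  shows "\<exists>S. pos_semidef S \<and> S ** S = M"
proof -
  have herm: "hermitian M" using pd by (simp add: pos_def_def)
  obtain m where m: "m > 0" "\<And>v. v \<bullet> (M *v v) \<ge> m * (norm v)\<^sup>2"
    using pos_def_coercive[OF pd] by blast
  obtain C where C: "C > 0" "\<And>v. norm (M *v v) \<le> C * norm v"
    using bounded_linear.pos_bounded[OF matrix_vector_mul_bounded_linear[of M]] by (auto simp: mult.commute)
  \<comment> \<open>The first entry makes the quadratic term of |v - e M v|^2 cost at most e m
    |v|^2, half of what the linear term gains; the second keeps 1 - e m positive, so that
    \<open>b\<close> is a genuine root of it.\<close>
  define e where "e = min (m / C\<^sup>2) (1/(2*m))"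
  have e: "e > 0" "e * C\<^sup>2 \<le> m" "e * m \<le> 1/2"
    using m(1) C(1) by (auto simp: e_def min_def field_simps)
  define b where "b = sqrt (1 - e * m)"
  have b: "0 \<le> b" "b < 1" "b\<^sup>2 = 1 - e * m" using e m(1) by (auto simp: b_def)
  define B where "B = Blinfun (\<lambda>v. v - e *\<^sub>R (M *v v))"
  have Bapp: "blinfun_apply B v = v - e *\<^sub>R (M *v v)" for v
    unfolding B_def
    by (subst bounded_linear_Blinfun_apply) (auto intro!: bounded_linear_intros matrix_vector_mul_bounded_linear)
  have normB: "norm B \<le> b"
  proof (rule norm_blinfun_bound[OF b(1)])
    fix v
    have "(norm (blinfun_apply B v))\<^sup>2 = (norm v)\<^sup>2 - 2 * e * (v \<bullet> (M *v v)) + e\<^sup>2 * (norm (M *v v))\<^sup>2"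
      unfolding Bapp power2_norm_eq_inner
      by (simp add: inner_diff_left inner_diff_right inner_commute algebra_simps power2_eq_square)
    also have "\<dots> \<le> (norm v)\<^sup>2 - 2 * e * (m * (norm v)\<^sup>2) + e\<^sup>2 * (C * norm v)\<^sup>2"
      by (intro add_mono diff_mono mult_left_mono power_mono m C) (use e in auto)
    also have "\<dots> = (norm v)\<^sup>2 * (1 - 2 * e * m + e * (e * C\<^sup>2))" by (simp add: algebra_simps power2_eq_square)
    also have "\<dots> \<le> (norm v)\<^sup>2 * (1 - 2 * e * m + e * m)"
      by (intro mult_left_mono add_mono order_refl e) (use e in auto)
    also have "\<dots> = (b * norm v)\<^sup>2" by (simp add: b power_mult_distrib)
    finally show "norm (blinfun_apply B v) \<le> b * norm v"
      by (rule power2_le_imp_le) (use b in auto)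
  qed
  \<comment> \<open>A bounded linear function is linear over the reals only, so self-adjointness and
    complex linearity are imposed as closed conditions; the fixed point inherits both and can be
    turned into a Hermitian matrix.\<close>
  define X where "X = cball 0 b \<inter> {f :: (complex^'n) \<Rightarrow>\<^sub>L (complex^'n).
      (\<forall>v w. blinfun_apply f v \<bullet> w = v \<bullet> blinfun_apply f w) \<and> (\<forall>c v. blinfun_apply f (c *s v) = c *s blinfun_apply f v)}"
  have contsc: "continuous_on UNIV (\<lambda>v::complex^'n. c *s v)" for c
    by (intro linear_continuous_on linear_conv_bounded_linear[THEN iffD1] linearI) (simp_all add: vec_eq_iff algebra_simps)
  have clX: "closed X"
    unfolding X_def
    apply (intro closed_Int closed_cball closed_Collect_conj closed_Collect_all closed_Collect_eq continuous_intros)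
    by (rule continuous_on_compose2[OF contsc]) (auto intro!: continuous_intros)
  have ne: "X \<noteq> {}"
  proof -
    have "0 \<in> X" using b by (auto simp: X_def)
    then show ?thesis by blast
  qed
  define \<Phi> where "\<Phi> = (\<lambda>Y. (1/2) *\<^sub>R (B + (Y o\<^sub>L Y)))"
  have maps: "\<Phi> ` X \<subseteq> X"
  proof
    fix Z assume "Z \<in> \<Phi> ` X"
    then obtain Y where Y: "Y \<in> X" and Z: "Z = \<Phi> Y" by blast
    have nY: "norm Y \<le> b" using Y by (simp add: X_def)
    have "norm Z \<le> (1/2) * (norm B + norm (Y o\<^sub>L Y))"
      unfolding Z \<Phi>_def using norm_triangle_ineq[of B "Y o\<^sub>L Y"] by simp
    also have "\<dots> \<le> (1/2) * (b + b * 1)"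
      using normB norm_blinfun_compose[of Y Y] mult_mono[OF nY, of "norm Y" 1] nY b by auto
    finally have "norm Z \<le> b" by simp
    moreover have "blinfun_apply Z v \<bullet> w = v \<bullet> blinfun_apply Z w" for v w
    proof -
      have "blinfun_apply Y (blinfun_apply Y v) \<bullet> w = v \<bullet> blinfun_apply Y (blinfun_apply Y w)"
        using Y by (simp add: X_def)
      moreover have "blinfun_apply B v \<bullet> w = v \<bullet> blinfun_apply B w"
        using hermitian_inner[OF herm, of v w] by (simp add: Bapp inner_diff_left inner_diff_right)
      ultimately show ?thesis
        by (simp add: Z \<Phi>_def blinfun.scaleR_left blinfun.add_left inner_add_left inner_add_right)
    qed
    moreover have "blinfun_apply Z (c *s v) = c *s blinfun_apply Z v" for c v
    proof -
      have "blinfun_apply Y (blinfun_apply Y (c *s v)) = c *s blinfun_apply Y (blinfun_apply Y v)"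
        using Y by (simp add: X_def)
      moreover have "blinfun_apply B (c *s v) = c *s blinfun_apply B v"
        by (simp add: Bapp vec_eq_iff vector_scalar_commute algebra_simps)
      ultimately show ?thesis
        by (simp add: Z \<Phi>_def blinfun.scaleR_left blinfun.add_left vec_eq_iff algebra_simps)
    qed
    ultimately show "Z \<in> X" by (auto simp: X_def)
  qed
  have lip: "dist (\<Phi> Y) (\<Phi> Z) \<le> b * dist Y Z" if "Y \<in> X" "Z \<in> X" for Y Z
  proof -
    have nY: "norm Y \<le> b" "norm Z \<le> b" using that by (simp_all add: X_def)
    have eq: "\<Phi> Y - \<Phi> Z = (1/2) *\<^sub>R ((Y o\<^sub>L (Y - Z)) + ((Y - Z) o\<^sub>L Z))"
      by (rule blinfun_eqI)
        (simp add: \<Phi>_def blinfun.scaleR_left blinfun.add_left blinfun.diff_left blinfun.diff_right algebra_simps)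
    have "norm (\<Phi> Y - \<Phi> Z) \<le> (1/2) * (norm (Y o\<^sub>L (Y - Z)) + norm ((Y - Z) o\<^sub>L Z))"
      unfolding eq using norm_triangle_ineq[of "Y o\<^sub>L (Y - Z)" "(Y - Z) o\<^sub>L Z"] by simp
    also have "\<dots> \<le> (1/2) * (b * norm (Y - Z) + norm (Y - Z) * b)"
      by (intro mult_left_mono add_mono order_trans[OF norm_blinfun_compose] mult_mono nY) (use b in auto)
    finally show ?thesis by (simp add: dist_norm algebra_simps)
  qed
  have "\<exists>!Y. Y \<in> X \<and> \<Phi> Y = Y"
    using Banach_fix[OF _ ne b(1,2) maps lip] clX by (auto simp: complete_eq_closed)
  then obtain Y where Y: "Y \<in> X" "\<Phi> Y = Y" by blast
  have fixeq: "2 *\<^sub>R blinfun_apply Y v = v - e *\<^sub>R (M *v v) + blinfun_apply Y (blinfun_apply Y v)" for v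
    using arg_cong[OF Y(2), of "\<lambda>f. 2 *\<^sub>R blinfun_apply f v"]
    by (simp add: \<Phi>_def blinfun.scaleR_left blinfun.add_left Bapp)
  define g where "g = (\<lambda>v. (1 / sqrt e) *\<^sub>R (v - blinfun_apply Y v))"
  define S where "S = matrix g"
  have gc: "g (c *s v) = c *s g v" for c v
    using Y(1) by (auto simp: g_def X_def vec_eq_iff algebra_simps)
  have "Vector_Spaces.linear (*s) (*s) g"
    by unfold_locales (auto simp: gc, simp add: g_def blinfun.add_right algebra_simps)
  then have S: "S *v v = g v" for v unfolding S_def by (rule matrix_works)
  have "S ** S = M"
  proof (subst matrix_eq, rule allI)
    fix v
    have "(S ** S) *v v = g (g v)" by (simp add: S matrix_vector_mul_assoc[symmetric])
    also have "\<dots> = (1 / e) *\<^sub>R (v - 2 *\<^sub>R blinfun_apply Y v + blinfun_apply Y (blinfun_apply Y v))"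
      using e by (simp add: g_def blinfun.scaleR_right blinfun.diff_right scaleR_right_diff_distrib
          scaleR_right_distrib scaleR_2)
    also have "\<dots> = M *v v" unfolding fixeq using e by simp
    finally show "(S ** S) *v v = M *v v" .
  qed
  moreover have "hermitian S"
    by (rule hermitianI_inner) (use Y(1) in \<open>auto simp: S g_def X_def inner_diff_left inner_diff_right\<close>)
  \<comment> \<open>S is a positive multiple of 1 - Y, and Y has norm below 1.\<close>
  moreover have "Re (qform S v) \<ge> 0" for v
  proof -
    have "norm (blinfun_apply Y v) \<le> 1 * norm v"
      using Y(1) b by (intro order_trans[OF norm_blinfun] mult_right_mono) (auto simp: X_def)
    then have "v \<bullet> blinfun_apply Y v \<le> (norm v)\<^sup>2"
      using norm_cauchy_schwarz[of v "blinfun_apply Y v"] mult_left_mono[of "norm (blinfun_apply Y v)" "norm v" "norm v"]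
      by (simp add: power2_eq_square)
    then show ?thesis using e by (simp add: Re_qform S g_def inner_diff_right power2_norm_eq_inner)
  qed
  ultimately show ?thesis unfolding pos_semidef_def by blast
qed

text \<open>With w = S v, the form at v + t w is 2 t |w|^2 + t^2 c, which would be negative for
  small negative t unless w = 0. The denominator c + 1 in the choice of \<open>t\<close> covers c =
  0 as well.\<close>

lemma psd_inner_zero:
  fixes S :: "complex^'n^'n"
  assumes S: "pos_semidef S" and v: "v \<bullet> (S *v v) = 0"
  shows "S *v v = 0"
proof (rule ccontr)
  assume nz: "S *v v \<noteq> 0"
  define w where "w = S *v v"
  have herm: "(S *v x) \<bullet> y = x \<bullet> (S *v y)" for x y
    using S hermitian_inner by (auto simp: pos_semidef_def)
  define c where "c = w \<bullet> (S *v w)"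
  have pos: "0 \<le> 2 * t * (w \<bullet> w) + t\<^sup>2 * c" for t :: real
  proof -
    have "0 \<le> (v + t *\<^sub>R w) \<bullet> (S *v (v + t *\<^sub>R w))"
      using S unfolding pos_semidef_def Re_qform by blast
    also have "\<dots> = 2 * t * (w \<bullet> w) + t\<^sup>2 * c"
      using v herm[of v w]
      by (simp add: linear_simps[OF matrix_vector_mul_bounded_linear] inner_add_left inner_add_right w_def[symmetric]
          c_def power2_eq_square algebra_simps)
    finally show ?thesis .
  qed
  have ww: "w \<bullet> w > 0" using nz by (simp add: w_def)
  have c0: "c \<ge> 0" using S unfolding c_def pos_semidef_def Re_qform by blast
  define t where "t = - (w \<bullet> w) / (c + 1)"
  have "t * (c + 1) = - (w \<bullet> w)" "t < 0" using c0 ww by (auto simp: t_def divide_simps)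
  then have "t * (t * (c + 1)) = t * - (w \<bullet> w)" by simp
  then have "t\<^sup>2 * c + t\<^sup>2 = - (t * (w \<bullet> w))" by (simp add: power2_eq_square algebra_simps)
  moreover have "t * (w \<bullet> w) < 0" "t\<^sup>2 \<ge> 0" using \<open>t < 0\<close> ww by (auto simp: mult_neg_pos)
  ultimately show False using pos[of t] by linarith
qed

text \<open>Makes the trace of D S D visibly nonnegative when S is positive semidefinite, which
  drives the uniqueness of the square root.\<close>

lemma trace_conj_hermitian:
  fixes S D :: "complex^'n^'n"
  assumes "hermitian D"
  shows "trace (D ** S ** D) = (\<Sum>i\<in>UNIV. qform S (column i D))"
proof -
  have c: "D $ i $ k = cnj (D $ k $ i)" for i k using assms unfolding hermitian_def by blast
  have "(D ** S ** D) $ i $ i = qform S (column i D)" for i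
  proof -
    have "(D ** S ** D) $ i $ i = (\<Sum>k\<in>UNIV. \<Sum>j\<in>UNIV. D $ i $ j * S $ j $ k * D $ k $ i)"
      by (simp add: matrix_matrix_mult_def sum_distrib_right)
    also have "\<dots> = (\<Sum>j\<in>UNIV. \<Sum>k\<in>UNIV. D $ i $ j * S $ j $ k * D $ k $ i)" by (rule sum.swap)
    also have "\<dots> = (\<Sum>j\<in>UNIV. \<Sum>k\<in>UNIV. cnj (D $ j $ i) * S $ j $ k * D $ k $ i)"
      by (intro sum.cong refl arg_cong2[where f=times] c)
    finally show ?thesis by (simp add: qform_def column_def)
  qed
  then show ?thesis by (simp add: trace_def)
qed

text \<open>For D = S - T one has S D + D T = S^2 - T^2 = 0. Multiplying by D and taking traces
  gives two nonnegative numbers with sum 0, so S annihilates the columns of D; then so does M = S^2,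
  and M is definite.\<close>

lemma pos_def_sqrt_unique:
  fixes M :: "complex^'n^'n"
  assumes pd: "pos_def M" and S: "pos_semidef S" "S ** S = M" and T: "pos_semidef T" "T ** T = M"
  shows "S = T"
proof -
  define D where "D = S - T"
  have hD: "hermitian D"
    by (rule hermitianI_inner) (use S T in \<open>simp add: D_def matrix_vector_mult_diff_rdistrib inner_diff_left
      inner_diff_right pos_semidef_def hermitian_inner\<close>)
  have "S ** D + D ** T = S ** S - T ** T"
    by (subst matrix_eq) (simp add: D_def matrix_vector_mult_add_rdistrib matrix_vector_mult_diff_rdistrib
        matrix_vector_mul_assoc[symmetric] matrix_vector_mult_diff_distrib)
  then have "S ** D + D ** T = 0" using S T by simp
  then have "D ** (S ** D) + D ** (D ** T) = 0" 
    unfolding matrix_add_ldistrib[symmetric] by (simp add: matrix_matrix_mult_def vec_eq_iff)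
  then have "trace (D ** (S ** D)) + trace (D ** (D ** T)) = 0" by (metis trace_add trace_0 mat_0)
  moreover have "trace (D ** (D ** T)) = trace (D ** T ** D)" by (rule trace_mul_sym)
  ultimately have "(\<Sum>i\<in>UNIV. qform S (column i D)) + (\<Sum>i\<in>UNIV. qform T (column i D)) = 0"
    using trace_conj_hermitian[OF hD] by (simp add: matrix_mul_assoc)
  then have sum0: "(\<Sum>i\<in>UNIV. Re (qform S (column i D))) + (\<Sum>i\<in>UNIV. Re (qform T (column i D))) = 0"
    by (metis Re_sum plus_complex.sel(1) zero_complex.sel(1))
  have nn: "Re (qform S v) \<ge> 0" "Re (qform T v) \<ge> 0" for v using S T by (auto simp: pos_semidef_def)
  then have "(\<Sum>i\<in>UNIV. Re (qform S (column i D))) = 0"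
    using sum0 sum_nonneg[of UNIV "\<lambda>i. Re (qform S (column i D))"] sum_nonneg[of UNIV "\<lambda>i. Re (qform T (column i D))"]
    by (smt (verit))
  then have "Re (qform S (column i D)) = 0" for i using nn by (simp add: sum_nonneg_eq_0_iff)
  then have "S *v column i D = 0" for i using psd_inner_zero[OF S(1)] by (simp add: Re_qform)
  then have "M *v column i D = 0" for i using S(2)
    by (metis matrix_vector_mul_assoc matrix_vector_mult_0_right)
  then have "column i D = 0" for i
    using pd unfolding pos_def_def Re_qform by (metis inner_zero_right less_irrefl)
  then have "D = 0" by (simp add: column_def vec_eq_iff)
  then show ?thesis by (simp add: D_def)
qed

lemma msqrt_pos_def:
  assumes "pos_def M"
  shows "pos_semidef (msqrt M)" "msqrt M ** msqrt M = M"
proof -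
  have "\<exists>!S. pos_semidef S \<and> S ** S = M"
    using pos_def_sqrt_exists[OF assms] pos_def_sqrt_unique[OF assms] by blast
  from theI'[OF this] show "pos_semidef (msqrt M)" "msqrt M ** msqrt M = M"
    unfolding msqrt_def by auto
qed

text \<open>This is |M^(1/2) v| for positive definite M. Written through the quadratic form it is
  visibly a Borel function of M and v, which is not apparent for \<open>msqrt\<close>, a definite
  description.\<close>

definition wnorm :: "complex^'n^'n \<Rightarrow> complex^'n \<Rightarrow> real" where
  "wnorm M v = sqrt (Re (qform M v))"

definition wnorm_mat :: "complex^'n^'n \<Rightarrow> complex^'d^'n \<Rightarrow> real" where
  "wnorm_mat M G = sqrt (\<Sum>\<beta>\<in>UNIV. Re (qform M (column \<beta> G)))"

lemma norm_msqrt_vec: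
  assumes "pos_def M" shows "norm (msqrt M *v v) = wnorm M v"
proof -
  have "(msqrt M *v v) \<bullet> (msqrt M *v v) = v \<bullet> (msqrt M *v (msqrt M *v v))"
    using msqrt_pos_def(1)[OF assms] by (simp add: pos_semidef_def hermitian_inner)
  also have "\<dots> = Re (qform M v)"
    by (simp add: matrix_vector_mul_assoc msqrt_pos_def(2)[OF assms] Re_qform)
  finally show ?thesis by (simp add: wnorm_def norm_eq_sqrt_inner)
qed

lemma norm_mat_columns:
  fixes B :: "complex^'d^'n"
  shows "(norm B)\<^sup>2 = (\<Sum>\<beta>\<in>UNIV. (norm (column \<beta> B))\<^sup>2)"
  unfolding power2_norm_eq_inner inner_vec_def column_def by simp (rule sum.swap)

lemma column_matrix_mult: "column \<beta> (A ** B) = A *v column \<beta> B"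
  by (simp add: vec_eq_iff column_def matrix_matrix_mult_def matrix_vector_mult_def)

lemma norm_msqrt_mat:
  assumes "pos_def M" shows "norm (msqrt M ** G) = wnorm_mat M G"
proof -
  have "(norm (msqrt M *v v))\<^sup>2 = Re (qform M v)" for v
    using norm_msqrt_vec[OF assms, of v] by (metis norm_ge_zero wnorm_def real_sqrt_ge_0_iff real_sqrt_pow2)
  then have "(norm (msqrt M ** G))\<^sup>2 = (\<Sum>\<beta>\<in>UNIV. Re (qform M (column \<beta> G)))"
    by (simp add: norm_mat_columns column_matrix_mult)
  then show ?thesis unfolding wnorm_mat_def by (metis norm_ge_zero real_sqrt_abs abs_of_nonneg)
qed

lemma wnorm_le_onorm:
  assumes A: "pos_def A" and B: "pos_def B"
  shows "wnorm A v \<le> onorm (\<lambda>v. msqrt A *v (matrix_inv (msqrt B) *v v)) * wnorm B v"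
proof -
  \<comment> \<open>\<open>matrix_inv\<close> is meaningful only for invertible matrices; the square
    root is injective because its square \<open>B\<close> is.\<close>
  have "inj ((*v) (msqrt B))"
  proof (rule injI)
    fix x y assume "msqrt B *v x = msqrt B *v y"
    then have "msqrt B *v (x - y) = 0" by (simp add: matrix_vector_mult_diff_distrib)
    then have "B *v (x - y) = 0" using msqrt_pos_def(2)[OF B]
      by (metis matrix_vector_mul_assoc matrix_vector_mult_0_right)
    then have "x - y = 0"
      using B unfolding pos_def_def Re_qform by (metis inner_zero_right less_irrefl)
    then show "x = y" by simp
  qed
  then have "invertible (msqrt B)"
    using matrix_left_invertible_injective invertible_left_inverse by blast
  then have inv: "matrix_inv (msqrt B) ** msqrt B = mat 1"
    unfolding invertible_def matrix_inv_def by (metis (mono_tags, lifting) someI_ex)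
  have bl: "bounded_linear (\<lambda>v. msqrt A *v (matrix_inv (msqrt B) *v v))"
    by (rule bounded_linear_compose[OF matrix_vector_mul_bounded_linear matrix_vector_mul_bounded_linear])
  have "wnorm A v = norm (msqrt A *v (matrix_inv (msqrt B) *v (msqrt B *v v)))"
    using norm_msqrt_vec[OF A] by (simp add: matrix_vector_mul_assoc inv matrix_mul_assoc[symmetric])
  also have "\<dots> \<le> onorm (\<lambda>v. msqrt A *v (matrix_inv (msqrt B) *v v)) * norm (msqrt B *v v)"
    by (rule onorm[OF bl])
  finally show ?thesis by (simp add: norm_msqrt_vec[OF B])
qed

lemma wnorm_triangle: "pos_def M \<Longrightarrow> wnorm M (v + w) \<le> wnorm M v + wnorm M w"
  by (simp add: norm_msqrt_vec[symmetric] matrix_vector_right_distrib norm_triangle_ineq)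

lemma wnorm_nonneg: "pos_def M \<Longrightarrow> 0 \<le> wnorm M v"
  by (simp add: norm_msqrt_vec[symmetric])

lemma wnorm_minus_commute: "pos_def M \<Longrightarrow> wnorm M (v - w) = wnorm M (w - v)"
  by (simp add: norm_msqrt_vec[symmetric] matrix_vector_mult_diff_distrib norm_minus_commute)

lemma wnorm_zero_iff: "pos_def M \<Longrightarrow> wnorm M v = 0 \<longleftrightarrow> v = 0"
  by (metis less_irrefl norm_eq_zero norm_msqrt_vec matrix_vector_mult_0_right pos_def_def wnorm_def real_sqrt_eq_zero_cancel_iff)

lemma wnorm_mat_nonneg: "pos_def M \<Longrightarrow> 0 \<le> wnorm_mat M v"
  by (simp add: norm_msqrt_mat[symmetric])

lemma wnorm_mat_triangle: "pos_def M \<Longrightarrow> wnorm_mat M (v + w) \<le> wnorm_mat M v + wnorm_mat M w"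
  by (simp add: norm_msqrt_mat[symmetric] matrix_add_ldistrib norm_triangle_ineq)

lemma wnorm_mat_scale: "pos_def M \<Longrightarrow> wnorm_mat M (c *\<^sub>R v) = \<bar>c\<bar> * wnorm_mat M v"
  by (simp only: norm_msqrt_mat[symmetric] norm_scaleR[symmetric])
    (simp add: matrix_matrix_mult_def vec_eq_iff scaleR_sum_right norm_scaleR[symmetric] del: norm_scaleR,
     rule arg_cong[where f=norm], simp add: vec_eq_iff scaleR_sum_right)

text \<open>If the columns of \<open>G\<close> are the partial derivatives of f, the sum is the
  derivative of f along \<open>w\<close>. Since M^(1/2) acts on each column separately, the bound is
  Cauchy--Schwarz in \<beta>.\<close>

lemma wnorm_directional:
  fixes G :: "complex^'d^'n" and w :: "real^'d"
  assumes pd: "pos_def M"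
  shows "wnorm M (\<Sum>\<beta>\<in>UNIV. w $ \<beta> *\<^sub>R column \<beta> G) \<le> norm w * wnorm_mat M G"
proof -
  let ?S = "msqrt M"
  have "wnorm M (\<Sum>\<beta>\<in>UNIV. w $ \<beta> *\<^sub>R column \<beta> G) = norm (\<Sum>\<beta>\<in>UNIV. w $ \<beta> *\<^sub>R (?S *v column \<beta> G))"
    using bounded_linear.linear[OF matrix_vector_mul_bounded_linear[of ?S]]
    by (simp add: norm_msqrt_vec[OF pd, symmetric] linear_sum linear_scale)
  also have "\<dots> \<le> (\<Sum>\<beta>\<in>UNIV. \<bar>w $ \<beta>\<bar> * norm (?S *v column \<beta> G))"
    by (rule order_trans[OF norm_sum]) simp
  also have "\<dots> \<le> L2_set (\<lambda>\<beta>. w $ \<beta>) UNIV * L2_set (\<lambda>\<beta>. norm (?S *v column \<beta> G)) UNIV"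
    using L2_set_mult_ineq[of "\<lambda>\<beta>. w $ \<beta>" "\<lambda>\<beta>. norm (?S *v column \<beta> G)" UNIV] by simp
  also have "L2_set (\<lambda>\<beta>. norm (?S *v column \<beta> G)) UNIV = norm (?S ** G)"
    unfolding L2_set_def using norm_mat_columns[of "?S ** G"] by (simp add: column_matrix_mult real_sqrt_unique)
  also have "L2_set (\<lambda>\<beta>. w $ \<beta>) UNIV = norm w" by (simp add: norm_vec_def L2_set_def)
  finally show ?thesis by (simp add: norm_msqrt_mat[OF pd])
qed

section \<open>Smooth functions and cutoffs\<close>

lemma partial_eq:
  assumes "(f has_derivative f') (at x)"
  shows "partial \<beta> f x = f' (axis \<beta> 1)"
proof -
  have "((\<lambda>t::real. x + t *\<^sub>R axis \<beta> 1) has_derivative (\<lambda>t. t *\<^sub>R axis \<beta> 1)) (at 0)"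
    by (auto intro!: derivative_eq_intros)
  moreover have "(f has_derivative f') (at (x + 0 *\<^sub>R axis \<beta> 1))" using assms by simp
  ultimately have "((\<lambda>t. f (x + t *\<^sub>R axis \<beta> 1)) has_derivative (\<lambda>t. f' (t *\<^sub>R axis \<beta> 1))) (at 0)"
    by (rule has_derivative_compose)
  then have "((\<lambda>t. f (x + t *\<^sub>R axis \<beta> 1)) has_vector_derivative f' (axis \<beta> 1)) (at 0)"
    unfolding has_vector_derivative_def
    using linear_scale[OF has_derivative_linear[OF assms]] by simp
  then show ?thesis unfolding partial_def by (rule vector_derivative_at)
qed

lemma partial_cong_open:
  assumes "open U" "x \<in> U" "\<And>y. y \<in> U \<Longrightarrow> f y = g y"
  shows "partial \<beta> f x = partial \<beta> g x"
proof -
  have "((\<lambda>t::real. x + t *\<^sub>R axis \<beta> 1) \<longlongrightarrow> x + 0 *\<^sub>R axis \<beta> 1) (nhds 0)"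
    by (intro tendsto_intros) (rule filterlim_ident)
  then have "\<forall>\<^sub>F t in nhds 0. x + t *\<^sub>R axis \<beta> 1 \<in> U"
    using assms(1,2) by (auto intro: topological_tendstoD)
  then have "\<forall>\<^sub>F t in nhds 0. f (x + t *\<^sub>R axis \<beta> 1) = g (x + t *\<^sub>R axis \<beta> 1)"
    by eventually_elim (use assms(3) in auto)
  then show ?thesis
    unfolding partial_def by (intro vector_derivative_cong_eq) auto
qed

lemma partials_snoc: "partials (bs @ [\<beta>]) f = partials bs (partial \<beta> f)"
  by (induction bs) auto

text \<open>The recursion peels off the innermost derivative: the product and chain rules express a
  partial derivative of a composite by functions of one order less, so they go through by induction
  on n. The lists in \<open>smooth_on\<close> grow at the outer end instead.\<close>

fun Ck :: "nat \<Rightarrow> (real^'d) set \<Rightarrow> (real^'d \<Rightarrow> 'b::real_normed_vector) \<Rightarrow> bool" where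
  "Ck 0 U f \<longleftrightarrow> f differentiable_on U"
| "Ck (Suc n) U f \<longleftrightarrow> f differentiable_on U \<and> (\<forall>\<beta>. Ck n U (partial \<beta> f))"

lemma smooth_on_iff_Ck: "smooth_on U f \<longleftrightarrow> (\<forall>n. Ck n U f)"
proof
  assume *: "smooth_on U f"
  have "Ck n U f" if "smooth_on U f" for n using that
  proof (induction n arbitrary: f)
    case 0 then show ?case by (metis Ck.simps(1) partials.simps(1) smooth_on_def)
  next
    case (Suc n)
    have "smooth_on U (partial \<beta> f)" for \<beta>
      using Suc.prems unfolding smooth_on_def by (metis partials_snoc)
    then show ?case using Suc by (metis Ck.simps(2) partials.simps(1) smooth_on_def)
  qed
  then show "\<forall>n. Ck n U f" using * by blast
next
  assume *: "\<forall>n. Ck n U f"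
  have "partials bs f differentiable_on U" if "Ck (length bs) U f" for bs using that
  proof (induction bs arbitrary: f rule: rev_induct)
    case (snoc \<beta> bs) then show ?case by (simp add: partials_snoc)
  qed simp
  then show "smooth_on U f" using * by (auto simp: smooth_on_def)
qed

lemma Ck_differentiable_on: "Ck n U f \<Longrightarrow> f differentiable_on U"
  by (cases n) auto

lemma Ck_Suc: "Ck (Suc n) U f \<Longrightarrow> Ck n U f"
  by (induction n arbitrary: f) auto

lemma differentiable_on_cong:
  assumes "f differentiable_on U" "\<And>x. x \<in> U \<Longrightarrow> f x = g x"
  shows "g differentiable_on U"
  unfolding differentiable_on_def differentiable_def
proof
  fix x assume x: "x \<in> U"
  then obtain D where "(f has_derivative D) (at x within U)"
    using assms(1) unfolding differentiable_on_def differentiable_def by blast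
  then show "\<exists>D. (g has_derivative D) (at x within U)"
    using has_derivative_transform[OF x, of g f] assms(2) by auto
qed

text \<open>The rules of calculus identify derivatives only on \<open>U\<close>; openness of
  \<open>U\<close> makes such an equality stable under further differentiation.\<close>

lemma Ck_cong:
  assumes "open U" "Ck n U f" "\<And>x. x \<in> U \<Longrightarrow> f x = g x"
  shows "Ck n U g"
  using assms(2,3)
proof (induction n arbitrary: f g)
  case 0 then show ?case by (auto intro: differentiable_on_cong[of f U g])
next
  case (Suc n)
  have "Ck n U (partial \<beta> g)" for \<beta>
  proof (rule Suc.IH)
    show "Ck n U (partial \<beta> f)" using Suc.prems by simp
    show "partial \<beta> f x = partial \<beta> g x" if "x \<in> U" for x
      by (rule partial_cong_open[OF assms(1) that Suc.prems(2)])
  qed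
  moreover have "g differentiable_on U" using Suc.prems by (auto intro: differentiable_on_cong[of f U g])
  ultimately show ?case by simp
qed

lemma differentiable_on_openD:
  assumes "f differentiable_on U" "open U" "x \<in> U"
  shows "(f has_derivative frechet_derivative f (at x)) (at x)"
  using assms by (metis at_within_open differentiable_on_def frechet_derivative_works)

lemma partial_frechet:
  assumes "f differentiable_on U" "open U" "x \<in> U"
  shows "partial \<beta> f x = frechet_derivative f (at x) (axis \<beta> 1)"
  by (rule partial_eq[OF differentiable_on_openD[OF assms]])

lemma has_derivative_partials:
  fixes f :: "real^'d \<Rightarrow> 'b::real_normed_vector"
  assumes "f differentiable_on U" "open U" "x \<in> U"
  shows "(f has_derivative (\<lambda>v. \<Sum>\<beta>\<in>UNIV. v $ \<beta> *\<^sub>R partial \<beta> f x)) (at x)"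
proof -
  note d = differentiable_on_openD[OF assms]
  have "frechet_derivative f (at x) v = (\<Sum>\<beta>\<in>UNIV. v $ \<beta> *\<^sub>R partial \<beta> f x)" for v
  proof -
    have "v = (\<Sum>\<beta>\<in>UNIV. v $ \<beta> *\<^sub>R axis \<beta> 1)"
      by (metis basis_expansion scalar_mult_eq_scaleR)
    then have "frechet_derivative f (at x) v = frechet_derivative f (at x) (\<Sum>\<beta>\<in>UNIV. v $ \<beta> *\<^sub>R axis \<beta> 1)"
      by simp
    also have "\<dots> = (\<Sum>\<beta>\<in>UNIV. v $ \<beta> *\<^sub>R frechet_derivative f (at x) (axis \<beta> 1))"
      using has_derivative_linear[OF d] by (simp add: linear_sum linear_scale)
    finally show ?thesis using partial_frechet[OF assms] by simp
  qed
  then have "frechet_derivative f (at x) = (\<lambda>v. \<Sum>\<beta>\<in>UNIV. v $ \<beta> *\<^sub>R partial \<beta> f x)" by (intro ext)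
  then show ?thesis using d by simp
qed

lemma Ck_add:
  assumes "open U" "Ck n U f" "Ck n U g"
  shows "Ck n U (\<lambda>x. f x + g x)"
  using assms(2,3)
proof (induction n arbitrary: f g)
  case 0 then show ?case by (simp add: differentiable_on_add)
next
  case (Suc n)
  have d: "f differentiable_on U" "g differentiable_on U" using Suc.prems by auto
  have "Ck n U (partial \<beta> (\<lambda>x. f x + g x))" for \<beta>
  proof (rule Ck_cong[OF assms(1), of n "\<lambda>x. partial \<beta> f x + partial \<beta> g x"])
    show "Ck n U (\<lambda>x. partial \<beta> f x + partial \<beta> g x)" using Suc by auto
    fix x assume x: "x \<in> U"
    show "partial \<beta> f x + partial \<beta> g x = partial \<beta> (\<lambda>x. f x + g x) x"
      unfolding partial_eq[OF has_derivative_add[OF differentiable_on_openD[OF d(1) assms(1) x]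
            differentiable_on_openD[OF d(2) assms(1) x]]]
      using partial_frechet[OF d(1) assms(1) x] partial_frechet[OF d(2) assms(1) x] by simp
  qed
  then show ?case using d by (simp add: differentiable_on_add)
qed

lemma differentiable_on_scaleR_fun:
  fixes f :: "'a::real_normed_vector \<Rightarrow> real"
  assumes "f differentiable_on U" "g differentiable_on U"
  shows "(\<lambda>x. f x *\<^sub>R g x) differentiable_on U"
  using assms unfolding differentiable_on_def by (auto intro!: differentiable_scaleR)

lemma partial_scaleR:
  fixes f :: "real^'d \<Rightarrow> real"
  assumes "f differentiable_on U" "g differentiable_on U" "open U" "x \<in> U"
  shows "partial \<beta> (\<lambda>x. f x *\<^sub>R g x) x = f x *\<^sub>R partial \<beta> g x + partial \<beta> f x *\<^sub>R g x"
  using partial_frechet[OF assms(1,3,4)] partial_frechet[OF assms(2,3,4)]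
    partial_eq[OF has_derivative_scaleR[OF differentiable_on_openD[OF assms(1,3,4)] differentiable_on_openD[OF assms(2,3,4)]]]
  by simp

lemma Ck_scaleR:
  fixes f :: "real^'d \<Rightarrow> real"
  assumes "open U" "Ck n U f" "Ck n U g"
  shows "Ck n U (\<lambda>x. f x *\<^sub>R g x)"
  using assms(2,3)
proof (induction n arbitrary: f g)
  case 0 then show ?case by (simp add: differentiable_on_scaleR_fun)
next
  case (Suc n)
  have d: "f differentiable_on U" "g differentiable_on U" using Suc.prems by auto
  have "Ck n U (partial \<beta> (\<lambda>x. f x *\<^sub>R g x))" for \<beta>
  proof (rule Ck_cong[OF assms(1), of n "\<lambda>x. f x *\<^sub>R partial \<beta> g x + partial \<beta> f x *\<^sub>R g x"])
    show "Ck n U (\<lambda>x. f x *\<^sub>R partial \<beta> g x + partial \<beta> f x *\<^sub>R g x)"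
      using Suc.prems Ck_Suc[OF Suc.prems(1)] Ck_Suc[OF Suc.prems(2)]
      by (intro Ck_add[OF assms(1)] Suc.IH) auto
  qed (use partial_scaleR[OF d assms(1)] in auto)
  then show ?case using d by (simp add: differentiable_on_scaleR_fun)
qed

text \<open>\<open>D\<close> lists all derivatives of the outer function, so that the factor
  \<open>D (Suc k) (f x)\<close> produced by the chain rule is again covered by the induction
  hypothesis.\<close>

lemma Ck_compose:
  fixes f :: "real^'d \<Rightarrow> real" and D :: "nat \<Rightarrow> real \<Rightarrow> real"
  assumes "open U" and D: "\<And>k s. (D k has_real_derivative D (Suc k) s) (at s)" and f: "Ck n U f"
  shows "Ck n U (\<lambda>x. D k (f x))"
proof -
  have der: "((\<lambda>x. D k (f x)) has_derivative (\<lambda>v. D (Suc k) (f x) * frechet_derivative f (at x) v)) (at x)"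
    if "f differentiable_on U" "x \<in> U" for k x
    using has_derivative_compose[OF differentiable_on_openD[OF that(1) assms(1) that(2)]
        D[of k "f x", unfolded has_field_derivative_def]] .
  have diff: "(\<lambda>x. D k (f x)) differentiable_on U" if "f differentiable_on U" for k
    using der[OF that] unfolding differentiable_on_def by (meson differentiableI differentiable_at_withinI)
  from f show ?thesis
  proof (induction n arbitrary: k)
    case 0 then show ?case using diff by simp
  next
    case (Suc n)
    have d: "f differentiable_on U" using Suc.prems by auto
    have "Ck n U (partial \<beta> (\<lambda>x. D k (f x)))" for \<beta>
    proof (rule Ck_cong[OF assms(1), of n "\<lambda>x. D (Suc k) (f x) *\<^sub>R partial \<beta> f x"])
      show "Ck n U (\<lambda>x. D (Suc k) (f x) *\<^sub>R partial \<beta> f x)"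
        using Suc.prems Ck_Suc[OF Suc.prems] by (intro Ck_scaleR[OF assms(1)] Suc.IH) auto
      fix x assume x: "x \<in> U"
      show "D (Suc k) (f x) *\<^sub>R partial \<beta> f x = partial \<beta> (\<lambda>x. D k (f x)) x"
        unfolding partial_eq[OF der[OF d x]] partial_frechet[OF d assms(1) x] by simp
    qed
    then show ?case using diff[OF d] by simp
  qed
qed

lemma Ck_const: "Ck n (U :: (real^'d) set) (\<lambda>x. c)"
proof (induction n arbitrary: c)
  case (Suc n)
  have "partial \<beta> (\<lambda>x. c) = (\<lambda>x. 0)" for \<beta> :: 'd and c :: 'a by (intro ext) (simp add: partial_def)
  then show ?case using Suc by simp
qed simp

lemma Ck_coord: "Ck n U (\<lambda>x::real^'d. (x $ i - a) / r)"
proof -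
  have d: "((\<lambda>x::real^'d. (x $ i - a) / r) has_derivative (\<lambda>v. v $ i / r)) (at x)" for x
    by (auto intro!: derivative_eq_intros bounded_linear_imp_has_derivative bounded_linear_vec_nth simp: divide_inverse)
  have "partial \<beta> (\<lambda>x::real^'d. (x $ i - a) / r) = (\<lambda>x. axis \<beta> 1 $ i / r)" for \<beta>
    by (intro ext partial_eq[OF d])
  moreover have "(\<lambda>x::real^'d. (x $ i - a) / r) differentiable_on U"
    unfolding differentiable_on_def using d by (meson differentiableI differentiable_at_withinI)
  moreover have "\<forall>\<beta>. Ck m U (\<lambda>x. axis \<beta> 1 $ i / r)" for m using Ck_const by blast
  ultimately show ?thesis by (cases n) simp_all
qed

lemma Ck_sum:
  assumes "open U" "\<And>i. i \<in> I \<Longrightarrow> Ck n U (f i)"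
  shows "Ck n U (\<lambda>x. \<Sum>i\<in>I. f i x)"
  using assms(2)
  by (induction I rule: infinite_finite_induct) (auto intro: Ck_const Ck_add[OF assms(1)])

section \<open>Smooth functions and their products with cutoffs\<close>

lemma smooth_on_differentiable_on: "smooth_on U f \<Longrightarrow> f differentiable_on U"
  using Ck_differentiable_on smooth_on_iff_Ck by blast

lemma smooth_on_partial: "smooth_on U f \<Longrightarrow> smooth_on U (partial \<beta> f)"
  unfolding smooth_on_iff_Ck by (metis Ck.simps(2))

lemma smooth_on_continuous_partial: "smooth_on U f \<Longrightarrow> continuous_on U (partial \<beta> f)"
  by (intro differentiable_imp_continuous_on smooth_on_differentiable_on smooth_on_partial)

lemma smooth_on_const: "smooth_on U (\<lambda>x. c)"
  by (simp add: smooth_on_iff_Ck Ck_const)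

lemma smooth_on_diff_const: "open U \<Longrightarrow> smooth_on U f \<Longrightarrow> smooth_on U (\<lambda>x. f x - c)"
  using Ck_add[of U _ f "\<lambda>x. - c"] by (auto simp: smooth_on_iff_Ck Ck_const)

lemma smooth_on_Un:
  assumes "open U" "open V" "smooth_on U f" "smooth_on V f"
  shows "smooth_on (U \<union> V) f"
  using assms unfolding smooth_on_def differentiable_on_def
  by (metis Un_iff at_within_open open_Un)

lemma smooth_on_cong:
  assumes "open U" "smooth_on U f" "\<And>x. x \<in> U \<Longrightarrow> f x = g x"
  shows "smooth_on U g"
  using assms Ck_cong unfolding smooth_on_iff_Ck by blast

text \<open>\<open>f\<close> is controlled only on \<open>U\<close>. The product is smooth there and
  vanishes identically on the open complement of \<open>K\<close>, and these two sets cover the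
  space.\<close>

lemma smooth_on_cutoff:
  fixes \<eta> :: "real^'d \<Rightarrow> real"
  assumes U: "open U" and f: "smooth_on U f" and \<eta>: "smooth_on UNIV \<eta>"
    and K: "closed K" "K \<subseteq> U" "\<And>x. x \<notin> K \<Longrightarrow> \<eta> x = 0"
  shows "smooth_on UNIV (\<lambda>x. \<eta> x *\<^sub>R f x)"
proof -
  have "smooth_on U \<eta>" using \<eta> unfolding smooth_on_def by (metis differentiable_on_subset subset_UNIV)
  then have "smooth_on U (\<lambda>x. \<eta> x *\<^sub>R f x)"
    using f unfolding smooth_on_iff_Ck by (blast intro: Ck_scaleR[OF U])
  moreover have "smooth_on (- K) (\<lambda>x. \<eta> x *\<^sub>R f x)"
    by (rule smooth_on_cong[OF _ smooth_on_const[of _ 0]]) (use K in auto)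
  ultimately have "smooth_on (U \<union> - K) (\<lambda>x. \<eta> x *\<^sub>R f x)" using U K by (intro smooth_on_Un) auto
  moreover have "U \<union> - K = UNIV" using K by auto
  ultimately show ?thesis by simp
qed


text \<open>The recursion comes from differentiating \<open>p(1/s) exp (- 1/s)\<close>.\<close>
primrec flat_poly :: "nat \<Rightarrow> real poly" where
  "flat_poly 0 = 1"
| "flat_poly (Suc k) = [:0, 0, 1:] * (flat_poly k - pderiv (flat_poly k))"

definition flat :: "nat \<Rightarrow> real \<Rightarrow> real" where
  "flat k s = (if s > 0 then poly (flat_poly k) (1 / s) * exp (- (1 / s)) else 0)"

lemma poly_times_exp_minus_tendsto: "((\<lambda>u::real. poly p u * exp (- u)) \<longlongrightarrow> 0) at_top"
proof -
  have "((\<lambda>u::real. \<Sum>i\<le>degree p. coeff p i * (u ^ i / exp u)) \<longlongrightarrow> (\<Sum>i\<le>degree p. coeff p i * 0)) at_top"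
    by (intro tendsto_sum tendsto_mult tendsto_const tendsto_power_div_exp_0)
  moreover have "(\<lambda>u::real. \<Sum>i\<le>degree p. coeff p i * (u ^ i / exp u)) = (\<lambda>u. poly p u * exp (- u))"
    by (intro ext) (simp add: poly_altdef sum_distrib_right exp_minus divide_inverse mult.assoc)
  ultimately show ?thesis by simp
qed

text \<open>This makes \<open>flat k\<close> the k-th derivative of exp (- 1/s) extended by 0. At
  the origin the right difference quotient is u p(u) exp (- u) with u = 1/h, which tends to 0
  because the exponential beats every polynomial.\<close>

lemma flat_has_derivative: "(flat k has_real_derivative flat (Suc k) s) (at s)"
proof -
  consider "s > 0" | "s < 0" | "s = 0" by linarith
  then show ?thesis
  proof cases
    case 1
    have "((\<lambda>s. poly (flat_poly k) (1 / s) * exp (- (1 / s))) has_real_derivative flat (Suc k) s) (at s)"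
      using 1 by (auto intro!: derivative_eq_intros DERIV_chain2[OF poly_DERIV]
          simp: flat_def power2_eq_square field_simps)
    then show ?thesis
      by (rule DERIV_cong_ev[THEN iffD1, rotated 3])
        (use 1 in \<open>auto simp: flat_def intro: eventually_mono[OF eventually_nhds_in_open[of "{0<..}"]]\<close>)
  next
    case 2
    have "((\<lambda>s. 0) has_real_derivative 0) (at s)" by simp
    then show ?thesis
      by (rule DERIV_cong_ev[THEN iffD1, rotated 3])
        (use 2 in \<open>auto simp: flat_def intro: eventually_mono[OF eventually_nhds_in_open[of "{..<0}"]]\<close>)
  next
    case 3
    have "((\<lambda>h. (flat k (0 + h) - flat k 0) / h) \<longlongrightarrow> 0) (at 0)"
    proof (rule filterlim_split_at)
      have "\<forall>\<^sub>F h in at_left (0::real). 0 = (flat k (0 + h) - flat k 0) / h"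
        by (auto simp: flat_def eventually_at_left_field intro: exI[of _ "-1"])
      then show "((\<lambda>h. (flat k (0 + h) - flat k 0) / h) \<longlongrightarrow> 0) (at_left 0)"
        by (rule tendsto_eventually[OF eventually_mono]) simp
      have "((\<lambda>h::real. poly (pCons 0 (flat_poly k)) (inverse h) * exp (- inverse h)) \<longlongrightarrow> 0) (at_right 0)"
        by (rule filterlim_compose[OF poly_times_exp_minus_tendsto filterlim_inverse_at_top_right])
      moreover have "\<forall>\<^sub>F h in at_right (0::real). poly (pCons 0 (flat_poly k)) (inverse h) * exp (- inverse h)
          = (flat k (0 + h) - flat k 0) / h"
        by (auto simp: flat_def eventually_at_right_field divide_inverse intro: exI[of _ 1])
      ultimately show "((\<lambda>h. (flat k (0 + h) - flat k 0) / h) \<longlongrightarrow> 0) (at_right 0)"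
        by (rule Lim_transform_eventually)
    qed
    then show ?thesis using 3 by (simp add: DERIV_def flat_def)
  qed
qed

lemma flat_0: "flat 0 s = (if s > 0 then exp (- (1 / s)) else 0)"
  by (simp add: flat_def)

lemma flat_0_nonneg: "flat 0 s \<ge> 0"
  by (simp add: flat_0)

lemma flat_0_mono: "s \<le> t \<Longrightarrow> flat 0 s \<le> flat 0 t"
  by (auto simp: flat_0 frac_le)

lemma flat_0_le_1: "flat 0 s \<le> 1"
  by (simp add: flat_0)

text \<open>A cutoff for cubes that avoids absolute values: each coordinate contributes one flat
  term per side. All of them vanish when |x_i - x0_i| \<le> r for every i, while one of them reaches
  \<open>flat 0 1\<close> as soon as some such distance is at least 2r. The plateau value is
  \<open>flat 0 (flat 0 1)\<close> instead of 1, a positive constant that is carried into the energy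
  estimate.\<close>

definition bump :: "real^'d \<Rightarrow> real \<Rightarrow> real^'d \<Rightarrow> real" where
  "bump x0 r x = flat 0 (flat 0 1 -
     (\<Sum>i\<in>UNIV. flat 0 ((x $ i - x0 $ i) / r - 1) + flat 0 ((x $ i - x0 $ i) / (-r) - 1)))"

lemma smooth_bump: "smooth_on UNIV (bump x0 r)"
  unfolding smooth_on_iff_Ck
proof
  fix n
  have c: "Ck n UNIV (\<lambda>x::real^'d. (x $ i - a) / q - 1)" for i a q
    using Ck_add[OF open_UNIV Ck_coord Ck_const[of n UNIV "-1"]] by simp
  have "Ck n UNIV (\<lambda>x. \<Sum>i\<in>UNIV. flat 0 ((x $ i - x0 $ i) / r - 1) + flat 0 ((x $ i - x0 $ i) / (-r) - 1))"
    by (intro Ck_sum Ck_add Ck_compose[of _ flat] flat_has_derivative c) auto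
  from Ck_add[OF open_UNIV Ck_const[of n UNIV "flat 0 1"] Ck_scaleR[OF open_UNIV Ck_const[of n UNIV "-1"] this]]
  have "Ck n UNIV (\<lambda>x. flat 0 1 - (\<Sum>i\<in>UNIV. flat 0 ((x $ i - x0 $ i) / r - 1) + flat 0 ((x $ i - x0 $ i) / (-r) - 1)))"
    by simp
  then show "Ck n UNIV (bump x0 r)"
    unfolding bump_def by (intro Ck_compose[of _ flat] flat_has_derivative) auto
qed

lemma bump_nonneg: "bump x0 r x \<ge> 0" and bump_le_1: "bump x0 r x \<le> 1"
  unfolding bump_def by (rule flat_0_nonneg flat_0_le_1)+

lemma bump_inner:
  assumes r: "r > 0" and x: "\<And>i. \<bar>x $ i - x0 $ i\<bar> \<le> r"
  shows "bump x0 r x = flat 0 (flat 0 1)"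
proof -
  have "(x $ i - x0 $ i) / r \<le> 1 \<and> (x $ i - x0 $ i) / (-r) \<le> 1" for i
    using x[of i] r by (auto simp: field_simps abs_le_iff)
  then have "flat 0 ((x $ i - x0 $ i) / r - 1) + flat 0 ((x $ i - x0 $ i) / (-r) - 1) = 0" for i
    by (auto simp: flat_0 not_less)
  then show ?thesis unfolding bump_def by simp
qed

lemma bump_outer:
  assumes r: "r > 0" and x: "\<bar>x $ i - x0 $ i\<bar> \<ge> 2 * r"
  shows "bump x0 r x = 0"
proof -
  have "flat 0 1 \<le> flat 0 ((x $ i - x0 $ i) / r - 1) + flat 0 ((x $ i - x0 $ i) / (-r) - 1)"
  proof (cases "x $ i - x0 $ i \<ge> 0")
    case True
    then have "1 \<le> (x $ i - x0 $ i) / r - 1" using x r by (simp add: field_simps)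
    from flat_0_mono[OF this] show ?thesis using flat_0_nonneg[of "(x $ i - x0 $ i) / (-r) - 1"] by linarith
  next
    case False
    then have "1 \<le> (x $ i - x0 $ i) / (-r) - 1" using x r by (simp add: field_simps)
    from flat_0_mono[OF this] show ?thesis using flat_0_nonneg[of "(x $ i - x0 $ i) / r - 1"] by linarith
  qed
  also have "\<dots> \<le> (\<Sum>i\<in>UNIV. flat 0 ((x $ i - x0 $ i) / r - 1) + flat 0 ((x $ i - x0 $ i) / (-r) - 1))"
    by (rule member_le_sum) (auto simp: flat_0_nonneg)
  finally show ?thesis unfolding bump_def by (simp add: flat_0)
qed

lemma bump_rescale: "r > 0 \<Longrightarrow> bump x0 r x = bump 0 1 ((x - x0) /\<^sub>R r)"
  by (simp add: bump_def divide_inverse mult.commute)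

lemma partial_bump_rescale:
  assumes r: "r > 0"
  shows "partial \<beta> (bump x0 r) x = partial \<beta> (bump 0 1) ((x - x0) /\<^sub>R r) / r"
proof -
  have d: "bump 0 1 differentiable_on UNIV" by (rule smooth_on_differentiable_on[OF smooth_bump])
  note dd = differentiable_on_openD[OF d open_UNIV UNIV_I]
  have "((\<lambda>x. (x - x0) /\<^sub>R r) has_derivative (\<lambda>v. v /\<^sub>R r)) (at x)"
    by (auto intro!: derivative_eq_intros)
  from partial_eq[OF has_derivative_compose[OF this dd]]
  have "partial \<beta> (\<lambda>x. bump 0 1 ((x - x0) /\<^sub>R r)) x
      = frechet_derivative (bump 0 1) (at ((x - x0) /\<^sub>R r)) (axis \<beta> 1 /\<^sub>R r)" .
  also have "\<dots> = frechet_derivative (bump 0 1) (at ((x - x0) /\<^sub>R r)) (axis \<beta> 1) /\<^sub>R r"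
    using linear_scale[OF has_derivative_linear[OF dd]] by blast
  also have "\<dots> = partial \<beta> (bump 0 1) ((x - x0) /\<^sub>R r) / r"
    unfolding partial_frechet[OF d open_UNIV UNIV_I] by (simp add: divide_inverse mult.commute)
  finally show ?thesis using bump_rescale[OF r, of x0] by presburger
qed

text \<open>One constant serves all centres and radii: rescaling reduces to the unit bump, whose
  continuous derivatives vanish outside a compact cube. The factor 1/r later cancels the factor r of
  the Poincare inequality.\<close>

lemma partial_bump_bounded:
  obtains C where "C > 0" "\<And>\<beta> x0 r x. r > 0 \<Longrightarrow> \<bar>partial \<beta> (bump x0 r) (x::real^'d)\<bar> \<le> C / r"
proof -
  let ?K = "cbox (\<chi> i. -2) (\<chi> i. 2) :: (real^'d) set"
  have K: "x \<in> ?K \<longleftrightarrow> (\<forall>i. \<bar>x $ i\<bar> \<le> 2)" for x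
    by (auto simp: mem_box_cart abs_le_iff minus_le_iff)
  have out: "partial \<beta> (bump 0 1) x = 0" if "x \<notin> ?K" for x :: "real^'d" and \<beta>
  proof -
    have "bump 0 1 y = 0" if "y \<in> - ?K" for y :: "real^'d"
    proof -
      obtain i where "\<bar>y $ i\<bar> > 2" using \<open>y \<in> - ?K\<close> K[of y] by (auto simp: not_le)
      then show ?thesis by (intro bump_outer[of 1 y i 0]) auto
    qed
    then have "partial \<beta> (bump 0 1) x = partial \<beta> (\<lambda>x. 0) x"
      using that by (intro partial_cong_open[of "- ?K"]) (auto intro: open_Compl closed_cbox)
    then show ?thesis by (simp add: partial_def)
  qed
  have "\<exists>C. \<forall>x\<in>?K. \<bar>partial \<beta> (bump 0 1) x\<bar> \<le> C" for \<beta>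
  proof -
    have "compact (partial \<beta> (bump 0 1) ` ?K)"
      by (intro compact_continuous_image continuous_on_subset[OF smooth_on_continuous_partial[OF smooth_bump]]) auto
    then show ?thesis by (metis bounded_real compact_imp_bounded imageI)
  qed
  then obtain c where c: "\<And>\<beta> x. x \<in> ?K \<Longrightarrow> \<bar>partial \<beta> (bump 0 1) x\<bar> \<le> c \<beta>" by metis
  define C where "C = 1 + (\<Sum>\<beta>\<in>UNIV. \<bar>c \<beta>\<bar>)"
  have C: "C > 0" unfolding C_def by (simp add: add_pos_nonneg sum_nonneg)
  have "\<bar>partial \<beta> (bump 0 1) x\<bar> \<le> C" for x :: "real^'d" and \<beta>
  proof (cases "x \<in> ?K")
    case True
    have "\<bar>c \<beta>\<bar> \<le> (\<Sum>\<beta>\<in>UNIV. \<bar>c \<beta>\<bar>)" by (rule member_le_sum) auto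
    then show ?thesis using c[OF True, of \<beta>] unfolding C_def by linarith
  qed (use out C in auto)
  then have "\<bar>partial \<beta> (bump x0 r) x\<bar> \<le> C / r" if "r > 0" for \<beta> x0 r and x :: "real^'d"
    unfolding partial_bump_rescale[OF that] using that by (simp add: divide_right_mono)
  then show ?thesis using C that by blast
qed

lemma partial_bump_inner:
  assumes r: "r > 0" and x: "\<And>i. \<bar>x $ i - x0 $ i\<bar> < r"
  shows "partial \<beta> (bump x0 r) (x::real^'d) = 0"
proof -
  let ?U = "{x::real^'d. \<forall>i. \<bar>x $ i - x0 $ i\<bar> < r}"
  have "open ?U"
  proof -
    have "?U = box (\<chi> i. x0 $ i - r) (\<chi> i. x0 $ i + r)"
      by (auto simp: mem_box_cart abs_less_iff algebra_simps)
    then show ?thesis using open_box by metis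
  qed
  then have "partial \<beta> (bump x0 r) x = partial \<beta> (\<lambda>x. flat 0 (flat 0 1)) x"
    by (rule partial_cong_open) (use x r in \<open>auto intro!: bump_inner less_imp_le\<close>)
  then show ?thesis by (simp add: partial_def)
qed

lemma partial_bump_outer:
  assumes r: "r > 0" and x: "\<bar>x $ i - x0 $ i\<bar> > 2 * r"
  shows "partial \<beta> (bump x0 r) (x::real^'d) = 0"
proof -
  let ?U = "{x::real^'d. \<bar>x $ i - x0 $ i\<bar> > 2 * r}"
  have "open ?U" by (intro open_Collect_less continuous_intros)
  then have "partial \<beta> (bump x0 r) x = partial \<beta> (\<lambda>x. 0) x"
    by (rule partial_cong_open) (use x r in \<open>auto intro!: bump_outer[of r _ i]\<close>)
  then show ?thesis by (simp add: partial_def)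
qed

section \<open>Relative norms and the scale-invariant kernel bound\<close>

lemma One_cart: "(\<Sum>b\<in>Basis. (b :: real^'d) $ i) = 1"
proof -
  have "(\<Sum>b\<in>Basis. (b :: real^'d) $ i) = (\<Sum>b\<in>Basis. if (b :: real^'d) = axis i 1 then 1 else 0)"
    by (intro sum.cong refl) (simp add: cart_eq_inner_axis inner_Basis axis_in_Basis_iff)
  then show ?thesis by (simp add: axis_in_Basis_iff)
qed

definition cube :: "real^'d \<Rightarrow> real \<Rightarrow> (real^'d) set" where
  "cube p s = cbox p (p + s *\<^sub>R One)"

lemma mem_cube: "z \<in> cube p s \<longleftrightarrow> (\<forall>i. p $ i \<le> z $ i \<and> z $ i \<le> p $ i + s)"
  by (simp add: cube_def mem_box_cart One_cart)

lemma cube_sets[measurable]: "cube p s \<in> sets borel"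
  by (simp add: cube_def)

lemma emeasure_cbox_cart:
  fixes a b :: "real^'d"
  assumes "\<And>i. a $ i \<le> b $ i"
  shows "emeasure lborel (cbox a b) = ennreal (\<Prod>i\<in>UNIV. b $ i - a $ i)"
proof -
  have ne: "cbox a b \<noteq> {}" using assms by (auto simp: interval_ne_empty_cart)
  have "emeasure lborel (cbox a b) = ennreal (measure lborel (cbox a b))"
    by (intro emeasure_eq_ennreal_measure) (metis emeasure_lborel_cbox_finite infinity_ennreal_def less_irrefl)
  also have "measure lborel (cbox a b) = (\<Prod>i\<in>UNIV. b $ i - a $ i)"
    using content_cbox_cart[OF ne] by simp
  finally show ?thesis .
qed

lemma emeasure_cube: "s \<ge> 0 \<Longrightarrow> emeasure lborel (cube (p::real^'d) s) = ennreal (s ^ CARD('d))"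
  unfolding cube_def by (subst emeasure_cbox_cart) (auto simp: One_cart)

text \<open>Joint dependence on corner and point is what Tonelli needs when the cubes move with a
  variable of integration.\<close>

lemma measurable_indicator_cube[measurable]:
  fixes f g :: "'b \<Rightarrow> real^'d"
  assumes [measurable]: "f \<in> borel_measurable M" "g \<in> borel_measurable M"
  shows "(\<lambda>x. indicator (cube (f x) s) (g x) :: ennreal) \<in> borel_measurable M"
proof -
  have "closed {y :: (real^'d) \<times> (real^'d). \<forall>i. fst y $ i \<le> snd y $ i \<and> snd y $ i \<le> fst y $ i + s}"
    by (intro closed_Collect_all closed_Collect_conj closed_Collect_le continuous_intros)
  then have [measurable]: "{y :: (real^'d) \<times> (real^'d). snd y \<in> cube (fst y) s} \<in> sets borel"
    using borel_closed by (simp add: mem_cube)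
  have "(\<lambda>x. indicator {y. snd y \<in> cube (fst y) s} (f x, g x) :: ennreal) \<in> borel_measurable M"
    by measurable
  then show ?thesis by (simp add: indicator_def)
qed

section \<open>Measurability of weighted norms\<close>

lemma measurable_vec_nth[measurable (raw)]:
  fixes f :: "'b \<Rightarrow> ('a::real_normed_vector)^'n"
  assumes "f \<in> borel_measurable M" shows "(\<lambda>x. f x $ i) \<in> borel_measurable M"
  by (rule measurable_compose[OF assms borel_measurable_continuous_onI]) (intro continuous_intros)

lemma measurable_cnj[measurable (raw)]: "f \<in> borel_measurable M \<Longrightarrow> (\<lambda>x. cnj (f x)) \<in> borel_measurable M"
  by (rule measurable_compose[OF _ borel_measurable_continuous_onI]) (auto intro: continuous_intros)

lemma measurable_wnorm[measurable (raw)]: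
  fixes f :: "'b \<Rightarrow> complex^'n^'n"
  assumes [measurable]: "f \<in> borel_measurable M" "g \<in> borel_measurable M"
  shows "(\<lambda>x. wnorm (f x) (g x)) \<in> borel_measurable M"
  unfolding wnorm_def qform_def by measurable

lemma measurable_wnorm_mat[measurable (raw)]:
  fixes f :: "'b \<Rightarrow> complex^'n^'n" and g :: "'b \<Rightarrow> complex^'d^'n"
  assumes [measurable]: "f \<in> borel_measurable M" "g \<in> borel_measurable M"
  shows "(\<lambda>x. wnorm_mat (f x) (g x)) \<in> borel_measurable M"
  unfolding wnorm_mat_def qform_def column_def by simp

definition dense_set :: "('a::second_countable_topology) set" where
  "dense_set = (SOME D. countable D \<and> (\<forall>X. open X \<longrightarrow> X \<noteq> {} \<longrightarrow> (\<exists>d\<in>D. d \<in> X)))"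

lemma dense_set: "countable (dense_set :: ('a::second_countable_topology) set)"
    "open X \<Longrightarrow> X \<noteq> {} \<Longrightarrow> \<exists>d\<in>dense_set. d \<in> (X::'a set)"
  using someI_ex[OF countable_dense_exists[where 'a='a]] unfolding dense_set_def by auto

text \<open>The operator norm of \<open>M\<^sup>1\<^sup>/\<^sup>2 N\<^sup>-\<^sup>1\<^sup>/\<^sup>2\<close>, written as a supremum over a countable set so that it is
  visibly a Borel function of \<open>(M, N)\<close>. At \<open>v = 0\<close> the quotient is the junk value 0.\<close>
definition relnorm :: "complex^'n^'n \<Rightarrow> complex^'n^'n \<Rightarrow> ennreal" where
  "relnorm M N = (SUP v\<in>dense_set. ennreal (wnorm M v / wnorm N v))"

lemma measurable_relnorm[measurable (raw)]:
  fixes f g :: "'b \<Rightarrow> complex^'n^'n"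
  assumes [measurable]: "f \<in> borel_measurable M" "g \<in> borel_measurable M"
  shows "(\<lambda>x. relnorm (f x) (g x)) \<in> borel_measurable M"
  unfolding relnorm_def using dense_set(1) by (intro borel_measurable_SUP) measurable

text \<open>For a finite value c of \<open>relnorm M N\<close> the set where the inequality fails is
  open and, by the definition of the supremum, misses the dense set; hence it is empty. An infinite
  value is harmless because v \<noteq> 0 makes the other factor positive.\<close>

lemma wnorm_le_relnorm:
  fixes v :: "complex^'n"
  assumes M: "pos_def M" and N: "pos_def N"
  shows "ennreal (wnorm M v) \<le> relnorm M N * ennreal (wnorm N v)"
proof (cases "v = 0")
  case True then show ?thesis using wnorm_zero_iff[OF M, of v] by simp
next
  case False
  then have pos: "wnorm N v > 0" using wnorm_nonneg[OF N, of v] wnorm_zero_iff[OF N, of v] by simp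
  show ?thesis
  proof (cases "relnorm M N")
    case (real c)
    have cont: "continuous_on UNIV (wnorm K)" if "pos_def K" for K :: "complex^'n^'n"
      using that by (subst norm_msqrt_vec[OF that, symmetric, abs_def])
        (intro continuous_intros linear_continuous_on matrix_vector_mul_bounded_linear)
    have D: "wnorm M u \<le> c * wnorm N u" if "u \<in> dense_set" for u
    proof (cases "u = 0")
      case False
      have "ennreal (wnorm M u / wnorm N u) \<le> relnorm M N"
        unfolding relnorm_def by (rule SUP_upper[OF that])
      then have "wnorm M u / wnorm N u \<le> c" using real by simp
      moreover have "wnorm N u > 0" using False wnorm_nonneg[OF N, of u] wnorm_zero_iff[OF N, of u] by simp
      ultimately show ?thesis by (simp add: divide_le_eq)
    qed (use wnorm_zero_iff[OF M, of 0] wnorm_zero_iff[OF N, of 0] in simp)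
    have "open {u. wnorm M u > c * wnorm N u}"
      by (intro open_Collect_less continuous_intros cont M N)
    then have "{u. wnorm M u > c * wnorm N u} = {}" using dense_set(2) D by (metis (mono_tags, lifting) mem_Collect_eq not_le)
    then have "wnorm M v \<le> c * wnorm N v" by (auto simp: not_less)
    then show ?thesis using real pos by (simp add: ennreal_mult[symmetric])
  next
    case top then show ?thesis using pos by (simp add: ennreal_top_mult)
  qed
qed

lemma relnorm_le_onorm:
  assumes M: "pos_def M" and N: "pos_def N"
  shows "relnorm M N \<le> ennreal (onorm (\<lambda>v. msqrt M *v (matrix_inv (msqrt N) *v v)))"
  unfolding relnorm_def
proof (rule SUP_least)
  fix v
  have o: "onorm (\<lambda>v. msqrt M *v (matrix_inv (msqrt N) *v v)) \<ge> 0"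
    by (intro onorm_pos_le bounded_linear_compose[OF matrix_vector_mul_bounded_linear matrix_vector_mul_bounded_linear])
  show "ennreal (wnorm M v / wnorm N v) \<le> ennreal (onorm (\<lambda>v. msqrt M *v (matrix_inv (msqrt N) *v v)))"
  proof (intro ennreal_leI)
    show "wnorm M v / wnorm N v \<le> onorm (\<lambda>v. msqrt M *v (matrix_inv (msqrt N) *v v))"
      using wnorm_le_onorm[OF M N, of v] wnorm_nonneg[OF N, of v] o
      by (cases "wnorm N v = 0") (auto simp: divide_le_eq)
  qed
qed

lemma nn_integral_affine:
  fixes h :: "'a::euclidean_space \<Rightarrow> ennreal"
  assumes [measurable]: "h \<in> borel_measurable borel" and t: "t > 0"
  shows "(\<integral>\<^sup>+z. h z \<partial>lborel) = ennreal (t ^ DIM('a)) * (\<integral>\<^sup>+y. h (a + t *\<^sub>R y) \<partial>lborel)"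
  using t by (subst lborel_affine[of t a]) (simp_all add: nn_integral_density nn_integral_distr nn_integral_cmult ennreal_power)

lemma Cauchy_Schwarz_set_nn_integral:
  assumes [measurable]: "f \<in> borel_measurable M" "g \<in> borel_measurable M" "S \<in> sets M"
  shows "(\<integral>\<^sup>+x\<in>S. f x * g x \<partial>M)\<^sup>2 \<le> (\<integral>\<^sup>+x\<in>S. (f x)\<^sup>2 \<partial>M) * (\<integral>\<^sup>+x\<in>S. (g x)\<^sup>2 \<partial>M)"
proof -
  have i: "(indicator S x :: ennreal)\<^sup>2 = indicator S x" for x by (simp add: indicator_def)
  have "(\<integral>\<^sup>+x\<in>S. f x * g x \<partial>M) = (\<integral>\<^sup>+x. (f x * indicator S x) * (g x * indicator S x) \<partial>M)"
    by (intro nn_integral_cong) (simp add: indicator_def)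
  then show ?thesis
    using Cauchy_Schwarz_nn_integral[of "\<lambda>x. f x * indicator S x" M "\<lambda>x. g x * indicator S x"]
    by (simp add: power_mult_distrib i)
qed

text \<open>The weight as it is used from here on: Borel and positive definite at every point, so
  that it can be composed with affine maps and no null set has to be followed. \<open>A\<close>
  stands for [W]; its inequality is the A2 condition with \<open>relnorm\<close> in place of the
  operator norm, multiplied by the squared volume of the cube.\<close>

locale borel_weight =
  fixes W :: "real^'d \<Rightarrow> complex^'n^'n" and A :: real
  assumes W_measurable[measurable]: "W \<in> borel_measurable borel"
    and W_pos_def: "\<And>x. pos_def (W x)"
    and A_nonneg: "A \<ge> 0"
    and A2: "\<And>p s. s > 0 \<Longrightarrow> (\<integral>\<^sup>+x\<in>cube p s. (\<integral>\<^sup>+y\<in>cube p s. (relnorm (W x) (W y))\<^sup>2 \<partial>lborel) \<partial>lborel)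
               \<le> ennreal (A * (s ^ CARD('d))\<^sup>2)"
begin

text \<open>At fixed x, |T| |W^(1/2)(x) v| is at most the integral over T of relnorm times
  |W^(1/2)(y) v|. Cauchy--Schwarz separates the two factors, and integrating over x brings in the A2
  bound. The constant does not depend on v, so all the scalar weights |W^(1/2) v|^2 are doubling
  uniformly.\<close>

lemma doubling:
  assumes s: "s > 0" and [measurable]: "T \<in> sets borel" and T: "T \<subseteq> cube p s"
  shows "(emeasure lborel T)\<^sup>2 * (\<integral>\<^sup>+x\<in>cube p s. ennreal (wnorm (W x) v)^2 \<partial>lborel)
    \<le> ennreal (A * (s ^ CARD('d))\<^sup>2) * (\<integral>\<^sup>+x\<in>T. ennreal (wnorm (W x) v)^2 \<partial>lborel)"
proof -
  have pt: "(emeasure lborel T)\<^sup>2 * ennreal (wnorm (W x) v)^2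
      \<le> (\<integral>\<^sup>+y\<in>cube p s. (relnorm (W x) (W y))\<^sup>2 \<partial>lborel) * (\<integral>\<^sup>+y\<in>T. ennreal (wnorm (W y) v)^2 \<partial>lborel)" for x
  proof -
    have "emeasure lborel T * ennreal (wnorm (W x) v) = (\<integral>\<^sup>+y\<in>T. ennreal (wnorm (W x) v) \<partial>lborel)"
      by (subst nn_integral_cmult_indicator) (simp_all add: mult.commute)
    also have "\<dots> \<le> (\<integral>\<^sup>+y\<in>T. relnorm (W x) (W y) * ennreal (wnorm (W y) v) \<partial>lborel)"
      by (intro nn_integral_mono mult_right_mono wnorm_le_relnorm W_pos_def) auto
    finally have "(emeasure lborel T * ennreal (wnorm (W x) v))\<^sup>2
        \<le> (\<integral>\<^sup>+y\<in>T. relnorm (W x) (W y) * ennreal (wnorm (W y) v) \<partial>lborel)\<^sup>2" by (rule power_mono) simp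
    also have "\<dots> \<le> (\<integral>\<^sup>+y\<in>T. (relnorm (W x) (W y))\<^sup>2 \<partial>lborel) * (\<integral>\<^sup>+y\<in>T. ennreal (wnorm (W y) v)^2 \<partial>lborel)"
      by (rule Cauchy_Schwarz_set_nn_integral) measurable
    also have "\<dots> \<le> (\<integral>\<^sup>+y\<in>cube p s. (relnorm (W x) (W y))\<^sup>2 \<partial>lborel) * (\<integral>\<^sup>+y\<in>T. ennreal (wnorm (W y) v)^2 \<partial>lborel)"
      using T by (intro mult_right_mono nn_integral_mono mult_left_mono) (auto simp: indicator_def)
    finally show ?thesis by (simp add: power_mult_distrib)
  qed
  have "(emeasure lborel T)\<^sup>2 * (\<integral>\<^sup>+x\<in>cube p s. ennreal (wnorm (W x) v)^2 \<partial>lborel)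
      = (\<integral>\<^sup>+x\<in>cube p s. (emeasure lborel T)\<^sup>2 * ennreal (wnorm (W x) v)^2 \<partial>lborel)"
    by (subst nn_integral_cmult[symmetric]) (simp_all add: mult.assoc)
  also have "\<dots> \<le> (\<integral>\<^sup>+x\<in>cube p s. (\<integral>\<^sup>+y\<in>cube p s. (relnorm (W x) (W y))\<^sup>2 \<partial>lborel) * (\<integral>\<^sup>+y\<in>T. ennreal (wnorm (W y) v)^2 \<partial>lborel) \<partial>lborel)"
    by (intro nn_integral_mono mult_right_mono pt) auto
  also have "\<dots> = (\<integral>\<^sup>+x\<in>cube p s. (\<integral>\<^sup>+y\<in>cube p s. (relnorm (W x) (W y))\<^sup>2 \<partial>lborel) \<partial>lborel) * (\<integral>\<^sup>+y\<in>T. ennreal (wnorm (W y) v)^2 \<partial>lborel)"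
    by (subst nn_integral_multc[symmetric]) (simp_all add: ac_simps)
  also have "\<dots> \<le> ennreal (A * (s ^ CARD('d))\<^sup>2) * (\<integral>\<^sup>+x\<in>T. ennreal (wnorm (W x) v)^2 \<partial>lborel)"
    by (intro mult_right_mono A2 s) simp
  finally show ?thesis .
qed

text \<open>Averaging over all cubes of side \<open>s\<close> containing \<open>x\<close> replaces a decomposition of space into a grid.\<close>
lemma kernel_bound_scale:
  fixes g :: "real^'d \<Rightarrow> ennreal"
  assumes [measurable]: "g \<in> borel_measurable borel" and s: "s > 0"
  shows "(\<integral>\<^sup>+x. (\<integral>\<^sup>+z\<in>cube (x - s *\<^sub>R One) (2 * s). (relnorm (W x) (W z))\<^sup>2 \<partial>lborel)
             * (\<integral>\<^sup>+z\<in>cube (x - s *\<^sub>R One) (2 * s). g z \<partial>lborel) \<partial>lborel)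
    \<le> ennreal (27 ^ CARD('d) * (s ^ CARD('d))\<^sup>2 * A) * (\<integral>\<^sup>+z. g z \<partial>lborel)"
proof -
  define F where "F x = (\<integral>\<^sup>+z\<in>cube (x - s *\<^sub>R One) (2 * s). (relnorm (W x) (W z))\<^sup>2 \<partial>lborel)
             * (\<integral>\<^sup>+z\<in>cube (x - s *\<^sub>R One) (2 * s). g z \<partial>lborel)" for x
  \<comment> \<open>If x lies in \<open>cube p s\<close>, then x and the box of half-side s around x
    lie in \<open>Q p\<close>; this compares boxes that move with x to one cube.\<close>
  define Q where "Q p = cube (p - s *\<^sub>R One) (3 * s)" for p :: "real^'d"
  have [measurable]: "F \<in> borel_measurable borel" unfolding F_def by measurable
  \<comment> \<open>The corners of the cubes of side q that contain a given point again fill a cube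
    of side q.\<close>
  have shift: "(\<integral>\<^sup>+p. indicator (cube (p + c) q) z \<partial>lborel) = ennreal (q ^ CARD('d))" if "q \<ge> 0" for z c :: "real^'d" and q
  proof -
    have "(\<integral>\<^sup>+p. indicator (cube (p + c) q) z \<partial>lborel) = (\<integral>\<^sup>+p. indicator (cube (z - c - q *\<^sub>R One) q) p \<partial>lborel)"
      by (intro nn_integral_cong) (auto simp: mem_cube One_cart algebra_simps indicator_def)
    also have "\<dots> = ennreal (q ^ CARD('d))" using that by (simp add: emeasure_cube)
    finally show ?thesis .
  qed
  have sd: "ennreal (s ^ CARD('d)) \<noteq> 0" "ennreal (s ^ CARD('d)) \<noteq> top" using s by auto
  have "ennreal (s ^ CARD('d)) * (\<integral>\<^sup>+x. F x \<partial>lborel) = (\<integral>\<^sup>+x. (\<integral>\<^sup>+p. F x * indicator (cube p s) x \<partial>lborel) \<partial>lborel)"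
    using shift[of s 0] s by (simp add: nn_integral_cmult nn_integral_multc mult.commute)
  also have "\<dots> = (\<integral>\<^sup>+p. (\<integral>\<^sup>+x. F x * indicator (cube p s) x \<partial>lborel) \<partial>lborel)"
    by (rule lborel_pair.Fubini') measurable
  also have "\<dots> \<le> (\<integral>\<^sup>+p. ennreal (A * ((3 * s) ^ CARD('d))\<^sup>2) * (\<integral>\<^sup>+z\<in>Q p. g z \<partial>lborel) \<partial>lborel)"
  proof (rule nn_integral_mono)
    fix p :: "real^'d"
    have sub: "cube (x - s *\<^sub>R One) (2 * s) \<subseteq> Q p" "x \<in> Q p" if "x \<in> cube p s" for x
    proof -
      show "cube (x - s *\<^sub>R One) (2 * s) \<subseteq> Q p"
      proof
        fix z assume z: "z \<in> cube (x - s *\<^sub>R One) (2 * s)"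
        show "z \<in> Q p" unfolding Q_def mem_cube
        proof
          fix i
          have "p $ i \<le> x $ i \<and> x $ i \<le> p $ i + s" "(x - s *\<^sub>R One) $ i \<le> z $ i \<and> z $ i \<le> (x - s *\<^sub>R One) $ i + 2 * s"
            using that z unfolding mem_cube by blast+
          then show "(p - s *\<^sub>R One) $ i \<le> z $ i \<and> z $ i \<le> (p - s *\<^sub>R One) $ i + 3 * s"
            by (simp add: One_cart)
        qed
      qed
      show "x \<in> Q p" unfolding Q_def mem_cube
      proof
        fix i
        have "p $ i \<le> x $ i \<and> x $ i \<le> p $ i + s" using that unfolding mem_cube by blast
        then show "(p - s *\<^sub>R One) $ i \<le> x $ i \<and> x $ i \<le> (p - s *\<^sub>R One) $ i + 3 * s"
          using s by (simp add: One_cart)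
      qed
    qed
    have [measurable]: "Q p \<in> sets borel" by (simp add: Q_def)
    have "(\<integral>\<^sup>+x. F x * indicator (cube p s) x \<partial>lborel)
        \<le> (\<integral>\<^sup>+x. ((\<integral>\<^sup>+z\<in>Q p. (relnorm (W x) (W z))\<^sup>2 \<partial>lborel) * indicator (Q p) x) * (\<integral>\<^sup>+z\<in>Q p. g z \<partial>lborel) \<partial>lborel)"
    proof (rule nn_integral_mono)
      fix x
      show "F x * indicator (cube p s) x
        \<le> ((\<integral>\<^sup>+z\<in>Q p. (relnorm (W x) (W z))\<^sup>2 \<partial>lborel) * indicator (Q p) x) * (\<integral>\<^sup>+z\<in>Q p. g z \<partial>lborel)"
      proof (cases "x \<in> cube p s")
        case True
        have "F x \<le> (\<integral>\<^sup>+z\<in>Q p. (relnorm (W x) (W z))\<^sup>2 \<partial>lborel) * (\<integral>\<^sup>+z\<in>Q p. g z \<partial>lborel)"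
          unfolding F_def using sub(1)[OF True]
          by (intro mult_mono nn_integral_mono mult_left_mono) (auto simp: indicator_def)
        then show ?thesis using True sub(2)[OF True] by simp
      qed simp
    qed
    also have "\<dots> = (\<integral>\<^sup>+x\<in>Q p. (\<integral>\<^sup>+z\<in>Q p. (relnorm (W x) (W z))\<^sup>2 \<partial>lborel) \<partial>lborel) * (\<integral>\<^sup>+z\<in>Q p. g z \<partial>lborel)"
      by (rule nn_integral_multc) measurable
    also have "\<dots> \<le> ennreal (A * ((3 * s) ^ CARD('d))\<^sup>2) * (\<integral>\<^sup>+z\<in>Q p. g z \<partial>lborel)"
      unfolding Q_def using s by (intro mult_right_mono A2) auto
    finally show "(\<integral>\<^sup>+x. F x * indicator (cube p s) x \<partial>lborel)
      \<le> ennreal (A * ((3 * s) ^ CARD('d))\<^sup>2) * (\<integral>\<^sup>+z\<in>Q p. g z \<partial>lborel)" .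
  qed
  also have "\<dots> = ennreal (A * ((3 * s) ^ CARD('d))\<^sup>2) * (\<integral>\<^sup>+p. (\<integral>\<^sup>+z. g z * indicator (Q p) z \<partial>lborel) \<partial>lborel)"
    unfolding Q_def by (rule nn_integral_cmult) measurable
  also have "(\<integral>\<^sup>+p. (\<integral>\<^sup>+z. g z * indicator (Q p) z \<partial>lborel) \<partial>lborel) = (\<integral>\<^sup>+z. (\<integral>\<^sup>+p. g z * indicator (Q p) z \<partial>lborel) \<partial>lborel)"
    unfolding Q_def by (rule lborel_pair.Fubini') measurable
  also have "\<dots> = (\<integral>\<^sup>+z. g z * ennreal ((3 * s) ^ CARD('d)) \<partial>lborel)"
  proof (rule nn_integral_cong)
    fix z
    show "(\<integral>\<^sup>+p. g z * indicator (Q p) z \<partial>lborel) = g z * ennreal ((3 * s) ^ CARD('d))"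
      unfolding Q_def using shift[of "3 * s" "- s *\<^sub>R One" z] s
      by (subst nn_integral_cmult) (simp_all add: diff_conv_add_uminus del: diff_conv_add_uminus[symmetric])
  qed
  also have "\<dots> = (\<integral>\<^sup>+z. g z \<partial>lborel) * ennreal ((3 * s) ^ CARD('d))" by (rule nn_integral_multc) measurable
  finally have "ennreal (s ^ CARD('d)) * (\<integral>\<^sup>+x. F x \<partial>lborel)
     \<le> ennreal (A * ((3 * s) ^ CARD('d))\<^sup>2) * ((\<integral>\<^sup>+z. g z \<partial>lborel) * ennreal ((3 * s) ^ CARD('d)))" .
  also have "\<dots> = ennreal (A * ((3 * s) ^ CARD('d))\<^sup>2 * (3 * s) ^ CARD('d)) * (\<integral>\<^sup>+z. g z \<partial>lborel)"
    using s A_nonneg by (simp add: ennreal_mult ac_simps)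
  \<comment> \<open>Two factors 3^d come from the A2 bound on \<open>Q p\<close> and one from the
    volume of the admissible p.\<close>
  also have "A * ((3 * s) ^ CARD('d))\<^sup>2 * (3 * s) ^ CARD('d) = s ^ CARD('d) * (27 ^ CARD('d) * (s ^ CARD('d))\<^sup>2 * A)"
  proof -
    have "(27::real) ^ k = 3 ^ k * 3 ^ k * 3 ^ k" for k by (simp flip: power_mult_distrib)
    then show ?thesis by (simp add: power_mult_distrib power2_eq_square)
  qed
  also have "ennreal \<dots> = ennreal (s ^ CARD('d)) * ennreal (27 ^ CARD('d) * (s ^ CARD('d))\<^sup>2 * A)"
    using s A_nonneg by (intro ennreal_mult) auto
  finally have "ennreal (s ^ CARD('d)) * (\<integral>\<^sup>+x. F x \<partial>lborel)
     \<le> ennreal (s ^ CARD('d)) * (ennreal (27 ^ CARD('d) * (s ^ CARD('d))\<^sup>2 * A) * (\<integral>\<^sup>+z. g z \<partial>lborel))"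
    by (simp add: mult.assoc)
  then show ?thesis unfolding F_def using ennreal_mult_le_mult_iff[OF sd(1)] sd(2) by blast
qed

text \<open>Substituting z = x + t (y - x) costs t^(-d) in each inner integral and places z in the
  box of half-side t L around x. The bound at scale s = t L supplies (t L)^(2d), so t disappears and
  the result may be integrated over t.\<close>

lemma kernel_bound:
  fixes g :: "real^'d \<Rightarrow> ennreal"
  assumes [measurable]: "g \<in> borel_measurable borel" "S \<in> sets borel" and t: "t > 0" and L: "L > 0"
    and S: "\<And>x y i. x \<in> S \<Longrightarrow> y \<in> S \<Longrightarrow> \<bar>x $ i - y $ i\<bar> \<le> L"
  shows "(\<integral>\<^sup>+x\<in>S. (\<integral>\<^sup>+y\<in>S. (relnorm (W x) (W (x + t *\<^sub>R (y - x))))\<^sup>2 \<partial>lborel)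
             * (\<integral>\<^sup>+y\<in>S. g (x + t *\<^sub>R (y - x)) \<partial>lborel) \<partial>lborel)
    \<le> ennreal (27 ^ CARD('d) * (L ^ CARD('d))\<^sup>2 * A) * (\<integral>\<^sup>+z. g z \<partial>lborel)"
proof -
  define s where "s = t * L"
  have s: "s > 0" using t L by (simp add: s_def)
  let ?B = "\<lambda>x. cube (x - s *\<^sub>R One) (2 * s) :: (real^'d) set"
  have sub: "(\<integral>\<^sup>+y\<in>S. h (x + t *\<^sub>R (y - x)) \<partial>lborel) \<le> ennreal (inverse (t ^ CARD('d))) * (\<integral>\<^sup>+z\<in>?B x. h z \<partial>lborel)"
    if [measurable]: "h \<in> borel_measurable borel" and x: "x \<in> S" for h :: "real^'d \<Rightarrow> ennreal" and x
  proof -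
    have "(\<integral>\<^sup>+y\<in>S. h (x + t *\<^sub>R (y - x)) \<partial>lborel)
        \<le> (\<integral>\<^sup>+y. h ((x - t *\<^sub>R x) + t *\<^sub>R y) * indicator (?B x) ((x - t *\<^sub>R x) + t *\<^sub>R y) \<partial>lborel)"
    proof (rule nn_integral_mono)
      fix y
      have "(x - t *\<^sub>R x) + t *\<^sub>R y \<in> ?B x" if y: "y \<in> S"
        unfolding mem_cube
      proof
        fix i
        have "\<bar>t * (y $ i - x $ i)\<bar> \<le> s"
          using S[OF y x, of i] t by (simp add: s_def abs_mult)
        then show "(x - s *\<^sub>R One) $ i \<le> ((x - t *\<^sub>R x) + t *\<^sub>R y) $ i \<and> ((x - t *\<^sub>R x) + t *\<^sub>R y) $ i \<le> (x - s *\<^sub>R One) $ i + 2 * s"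
          by (auto simp: One_cart abs_le_iff algebra_simps)
      qed
      then show "h (x + t *\<^sub>R (y - x)) * indicator S y
         \<le> h ((x - t *\<^sub>R x) + t *\<^sub>R y) * indicator (?B x) ((x - t *\<^sub>R x) + t *\<^sub>R y)"
        by (auto simp: indicator_def algebra_simps)
    qed
    also have "\<dots> = ennreal (inverse (t ^ CARD('d))) * (ennreal (t ^ CARD('d)) *
        (\<integral>\<^sup>+y. h ((x - t *\<^sub>R x) + t *\<^sub>R y) * indicator (?B x) ((x - t *\<^sub>R x) + t *\<^sub>R y) \<partial>lborel))"
      using t by (simp add: mult.assoc[symmetric] ennreal_mult[symmetric])
    also have "\<dots> = ennreal (inverse (t ^ CARD('d))) * (\<integral>\<^sup>+z\<in>?B x. h z \<partial>lborel)"
      using nn_integral_affine[of "\<lambda>z. h z * indicator (?B x) z" t "x - t *\<^sub>R x"] t by simp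
    finally show ?thesis .
  qed
  let ?c = "ennreal (inverse (t ^ CARD('d)))"
  have "(\<integral>\<^sup>+x\<in>S. (\<integral>\<^sup>+y\<in>S. (relnorm (W x) (W (x + t *\<^sub>R (y - x))))\<^sup>2 \<partial>lborel)
             * (\<integral>\<^sup>+y\<in>S. g (x + t *\<^sub>R (y - x)) \<partial>lborel) \<partial>lborel)
      \<le> (\<integral>\<^sup>+x. (?c * ?c) * ((\<integral>\<^sup>+z\<in>?B x. (relnorm (W x) (W z))\<^sup>2 \<partial>lborel) * (\<integral>\<^sup>+z\<in>?B x. g z \<partial>lborel)) \<partial>lborel)"
  proof (rule nn_integral_mono)
    fix x
    show "(\<integral>\<^sup>+y\<in>S. (relnorm (W x) (W (x + t *\<^sub>R (y - x))))\<^sup>2 \<partial>lborel)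
             * (\<integral>\<^sup>+y\<in>S. g (x + t *\<^sub>R (y - x)) \<partial>lborel) * indicator S x
      \<le> (?c * ?c) * ((\<integral>\<^sup>+z\<in>?B x. (relnorm (W x) (W z))\<^sup>2 \<partial>lborel) * (\<integral>\<^sup>+z\<in>?B x. g z \<partial>lborel))"
    proof (cases "x \<in> S")
      case True
      have "(\<integral>\<^sup>+y\<in>S. (relnorm (W x) (W (x + t *\<^sub>R (y - x))))\<^sup>2 \<partial>lborel) * (\<integral>\<^sup>+y\<in>S. g (x + t *\<^sub>R (y - x)) \<partial>lborel)
        \<le> (?c * (\<integral>\<^sup>+z\<in>?B x. (relnorm (W x) (W z))\<^sup>2 \<partial>lborel)) * (?c * (\<integral>\<^sup>+z\<in>?B x. g z \<partial>lborel))"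
        by (intro mult_mono sub[of "\<lambda>z. (relnorm (W x) (W z))\<^sup>2"] sub[of g] True) auto
      then show ?thesis using True by (simp add: ac_simps)
    qed simp
  qed
  also have "\<dots> = (?c * ?c) * (\<integral>\<^sup>+x. ((\<integral>\<^sup>+z\<in>?B x. (relnorm (W x) (W z))\<^sup>2 \<partial>lborel) * (\<integral>\<^sup>+z\<in>?B x. g z \<partial>lborel)) \<partial>lborel)"
    by (rule nn_integral_cmult) measurable
  also have "\<dots> \<le> (?c * ?c) * (ennreal (27 ^ CARD('d) * (s ^ CARD('d))\<^sup>2 * A) * (\<integral>\<^sup>+z. g z \<partial>lborel))"
    by (intro mult_left_mono kernel_bound_scale s) auto
  also have "\<dots> = ennreal (27 ^ CARD('d) * (L ^ CARD('d))\<^sup>2 * A) * (\<integral>\<^sup>+z. g z \<partial>lborel)"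
  proof -
    have "inverse (t ^ CARD('d)) * inverse (t ^ CARD('d)) * (27 ^ CARD('d) * (s ^ CARD('d))\<^sup>2 * A)
      = 27 ^ CARD('d) * (L ^ CARD('d))\<^sup>2 * A"
      using t by (simp add: s_def power_mult_distrib power2_eq_square field_simps)
    moreover have "?c * ?c * ennreal (27 ^ CARD('d) * (s ^ CARD('d))\<^sup>2 * A)
      = ennreal (inverse (t ^ CARD('d)) * inverse (t ^ CARD('d)) * (27 ^ CARD('d) * (s ^ CARD('d))\<^sup>2 * A))"
      using t A_nonneg by (simp add: ennreal_mult)
    ultimately show ?thesis by (simp only: mult.assoc[symmetric])
  qed
  finally show ?thesis .
qed

end

section \<open>The Poincare inequality on boxes\<close>

lemma column_Dmat: "column \<beta> (Dmat f x) = partial \<beta> f x"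
  by (simp add: column_def Dmat_def vec_eq_iff)

lemma continuous_on_Dmat: "smooth_on U f \<Longrightarrow> continuous_on U (Dmat f)"
  unfolding Dmat_def
  by (intro continuous_on_vec_lambda continuous_intros smooth_on_continuous_partial)

lemma measurable_restrict_continuous:
  fixes f :: "'a::topological_space \<Rightarrow> 'b::{zero,topological_space}"
  assumes "continuous_on U f" "S \<subseteq> U" "S \<in> sets borel"
  shows "(\<lambda>x. if x \<in> S then f x else 0) \<in> borel_measurable borel"
  by (rule borel_measurable_continuous_on_if) (use assms in \<open>auto intro: continuous_on_subset\<close>)

context borel_weight begin

text \<open>W^(1/2)(x) is frozen, so the fundamental theorem of calculus applies to W^(1/2)(x) f
  along the segment; \<open>relnorm\<close> then moves the weight from x to the point where Df is
  evaluated.\<close>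

lemma segment_bound:
  assumes U: "open U" and f: "smooth_on U f" and S: "convex S" "S \<subseteq> U" and x: "x \<in> S" and y: "y \<in> S"
    and C: "norm (y - x) \<le> C"
  shows "ennreal (wnorm (W x) (f x - f y)) \<le>
    (\<integral>\<^sup>+t\<in>{0..1}. relnorm (W x) (W (x + t *\<^sub>R (y - x))) * (ennreal C *
        ennreal (wnorm_mat (W (x + t *\<^sub>R (y - x))) (Dmat f (x + t *\<^sub>R (y - x))))) \<partial>lborel)"
proof -
  let ?z = "\<lambda>t. x + t *\<^sub>R (y - x)"
  let ?M = "msqrt (W x)"
  have z: "?z t \<in> S" if "t \<in> {0..1}" for t
  proof -
    have "?z t = (1 - t) *\<^sub>R x + t *\<^sub>R y" by (simp add: algebra_simps)
    then show ?thesis using convexD_alt[OF S(1) x y, of t] that by simp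
  qed
  define g where "g t = ?M *v (\<Sum>\<beta>\<in>UNIV. (y - x) $ \<beta> *\<^sub>R partial \<beta> f (?z t))" for t
  have der: "((\<lambda>t. ?M *v f (?z t)) has_vector_derivative g t) (at t within {0..1})" if t: "t \<in> {0..1}" for t
  proof -
    have zU: "?z t \<in> U" using z[OF t] S by auto
    have "(?z has_derivative (\<lambda>s. s *\<^sub>R (y - x))) (at t)" by (auto intro!: derivative_eq_intros)
    from has_derivative_compose[OF this has_derivative_partials[OF smooth_on_differentiable_on[OF f] U zU]]
    have "((\<lambda>t. f (?z t)) has_derivative (\<lambda>s. \<Sum>\<beta>\<in>UNIV. (s *\<^sub>R (y - x)) $ \<beta> *\<^sub>R partial \<beta> f (?z t))) (at t)" .
    then have "((\<lambda>t. f (?z t)) has_vector_derivative (\<Sum>\<beta>\<in>UNIV. (y - x) $ \<beta> *\<^sub>R partial \<beta> f (?z t))) (at t)"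
      unfolding has_vector_derivative_def by (simp add: scaleR_sum_right)
    from bounded_linear.has_vector_derivative[OF matrix_vector_mul_bounded_linear[of ?M] this]
    show ?thesis unfolding g_def by (rule has_vector_derivative_at_within)
  qed
  have cont: "continuous_on {0..1} g"
    unfolding g_def
  proof (intro continuous_on_compose2[OF linear_continuous_on[OF matrix_vector_mul_bounded_linear]] continuous_on_sum
      continuous_on_scaleR continuous_on_const)
    fix \<beta>
    show "continuous_on {0..1} (\<lambda>t. partial \<beta> f (?z t))"
      by (rule continuous_on_compose2[OF smooth_on_continuous_partial[OF f]])
        (use z S in \<open>auto intro!: continuous_intros\<close>)
  qed auto
  have int: "integrable lborel (\<lambda>t. indicator {0..1} t *\<^sub>R g t)"
    using borel_integrable_atLeastAtMost'[OF cont] by (simp add: set_integrable_def)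
  have "integral\<^sup>L lborel (\<lambda>t. indicator {0..1} t *\<^sub>R g t) = ?M *v f (?z 1) - ?M *v f (?z 0)"
    by (rule integral_FTC_atLeastAtMost[OF _ der cont]) auto
  then have "wnorm (W x) (f x - f y) = norm (integral\<^sup>L lborel (\<lambda>t. indicator {0..1} t *\<^sub>R g t))"
    by (simp add: norm_msqrt_vec[OF W_pos_def, symmetric] matrix_vector_mult_diff_distrib norm_minus_commute)
  then have "ennreal (wnorm (W x) (f x - f y)) \<le> (\<integral>\<^sup>+t. norm (indicator {0..1} t *\<^sub>R g t) \<partial>lborel)"
    using integral_norm_bound_ennreal[OF int] by simp
  also have "\<dots> \<le> (\<integral>\<^sup>+t\<in>{0..1}. relnorm (W x) (W (?z t)) * (ennreal C *
        ennreal (wnorm_mat (W (?z t)) (Dmat f (?z t)))) \<partial>lborel)"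
  proof (rule nn_integral_mono)
    fix t :: real
    have "ennreal (norm (g t)) \<le> relnorm (W x) (W (?z t)) * (ennreal C * ennreal (wnorm_mat (W (?z t)) (Dmat f (?z t))))"
    proof -
      let ?v = "\<Sum>\<beta>\<in>UNIV. (y - x) $ \<beta> *\<^sub>R partial \<beta> f (?z t)"
      have "norm (g t) = wnorm (W x) ?v" unfolding g_def by (rule norm_msqrt_vec[OF W_pos_def])
      also have "ennreal \<dots> \<le> relnorm (W x) (W (?z t)) * ennreal (wnorm (W (?z t)) ?v)"
        by (rule wnorm_le_relnorm[OF W_pos_def W_pos_def])
      also have "wnorm (W (?z t)) ?v \<le> norm (y - x) * wnorm_mat (W (?z t)) (Dmat f (?z t))"
        using wnorm_directional[OF W_pos_def, of "?z t" "y - x" "Dmat f (?z t)"] by (simp add: column_Dmat)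
      also have "\<dots> \<le> C * wnorm_mat (W (?z t)) (Dmat f (?z t))"
        by (intro mult_right_mono C wnorm_mat_nonneg W_pos_def)
      also have "ennreal (C * wnorm_mat (W (?z t)) (Dmat f (?z t))) = ennreal C * ennreal (wnorm_mat (W (?z t)) (Dmat f (?z t)))"
        by (intro ennreal_mult wnorm_mat_nonneg W_pos_def) (use C norm_ge_zero order_trans in blast)
      finally show ?thesis by (simp add: mult_left_mono ennreal_leI)
    qed
    then show "ennreal (norm (indicator {0..1} t *\<^sub>R g t)) \<le> relnorm (W x) (W (?z t)) * (ennreal C *
        ennreal (wnorm_mat (W (?z t)) (Dmat f (?z t)))) * indicator {0..1} t"
      by (simp add: indicator_def)
  qed
  finally show ?thesis .
qed

text \<open>With W^(1/2)(x) fixed this is the norm inequality for an integral: u minus the mean of f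
  is the mean of u - f(y), and the linear map passes under the integral.\<close>

lemma wnorm_mean_deviation:
  fixes f :: "real^'d \<Rightarrow> complex^'n"
  assumes S: "compact S" "continuous_on S f" and m: "measure lborel S = m" "m > 0"
  shows "ennreal (wnorm (W x) (u - (1/m) *\<^sub>R (\<integral>y. indicator S y *\<^sub>R f y \<partial>lborel)))
    \<le> ennreal (1/m) * (\<integral>\<^sup>+y\<in>S. ennreal (wnorm (W x) (u - f y)) \<partial>lborel)"
proof -
  let ?M = "msqrt (W x)"
  have [measurable]: "S \<in> sets borel" using S by (simp add: borel_compact)
  have fin: "emeasure lborel S < \<infinity>" 
    using emeasure_bounded_finite[OF compact_imp_bounded[OF S(1)]] by simp
  have i1: "integrable lborel (\<lambda>y. indicator S y *\<^sub>R f y)" by (rule borel_integrable_compact[OF S])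
  have i0: "integrable lborel (\<lambda>y. indicator S y *\<^sub>R u)" using fin by simp
  have i: "integrable lborel (\<lambda>y. indicator S y *\<^sub>R (u - f y))"
    using Bochner_Integration.integrable_diff[OF i0 i1] by (simp add: scaleR_diff_right)
  have "(\<integral>y. indicator S y *\<^sub>R (u - f y) \<partial>lborel) = m *\<^sub>R u - (\<integral>y. indicator S y *\<^sub>R f y \<partial>lborel)"
    using Bochner_Integration.integral_diff[OF i0 i1] m fin by (simp add: scaleR_diff_right)
  then have "u - (1/m) *\<^sub>R (\<integral>y. indicator S y *\<^sub>R f y \<partial>lborel) = (1/m) *\<^sub>R (\<integral>y. indicator S y *\<^sub>R (u - f y) \<partial>lborel)"
    using m by (simp add: scaleR_diff_right)
  then have "?M *v (u - (1/m) *\<^sub>R (\<integral>y. indicator S y *\<^sub>R f y \<partial>lborel))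
      = (1/m) *\<^sub>R (\<integral>y. indicator S y *\<^sub>R (?M *v (u - f y)) \<partial>lborel)"
    using integral_bounded_linear[OF matrix_vector_mul_bounded_linear[of ?M] i]
    by (simp add: linear_simps(5)[OF matrix_vector_mul_bounded_linear])
  then have "wnorm (W x) (u - (1/m) *\<^sub>R (\<integral>y. indicator S y *\<^sub>R f y \<partial>lborel))
      = (1/m) * norm (\<integral>y. indicator S y *\<^sub>R (?M *v (u - f y)) \<partial>lborel)"
    using m by (simp add: norm_msqrt_vec[OF W_pos_def, symmetric])
  also have "ennreal \<dots> = ennreal (1/m) * ennreal (norm (\<integral>y. indicator S y *\<^sub>R (?M *v (u - f y)) \<partial>lborel))"
    using m by (intro ennreal_mult) auto
  also have "\<dots> \<le> ennreal (1/m) * (\<integral>\<^sup>+y. norm (indicator S y *\<^sub>R (?M *v (u - f y))) \<partial>lborel)"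
    using integrable_bounded_linear[OF matrix_vector_mul_bounded_linear[of ?M] i]
    by (intro mult_left_mono integral_norm_bound_ennreal) (simp_all add: linear_simps(5)[OF matrix_vector_mul_bounded_linear])
  also have "(\<integral>\<^sup>+y. norm (indicator S y *\<^sub>R (?M *v (u - f y))) \<partial>lborel) = (\<integral>\<^sup>+y\<in>S. ennreal (wnorm (W x) (u - f y)) \<partial>lborel)"
    by (intro nn_integral_cong) (simp add: norm_msqrt_vec[OF W_pos_def] indicator_def)
  finally show ?thesis .
qed

text \<open>Stated for boxes because it is applied to slabs. The witness c is the unweighted mean of
  f; when all sides are comparable to L, the factor in front is of order A L^2.\<close>

theorem poincare_box:
  fixes f :: "real^'d \<Rightarrow> complex^'n" and L m :: real
  assumes U: "open U" and f: "smooth_on U f" and S: "cbox a b \<subseteq> U"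
    and m: "measure lborel (cbox a b) = m" "m > 0" and L: "L > 0" "\<And>i. b $ i - a $ i \<le> L"
  shows "\<exists>c. (\<integral>\<^sup>+x\<in>cbox a b. ennreal (wnorm (W x) (f x - c))^2 \<partial>lborel)
    \<le> ennreal ((CARD('d) * L / m)\<^sup>2 * (27 ^ CARD('d) * (L ^ CARD('d))\<^sup>2 * A))
       * (\<integral>\<^sup>+x\<in>cbox a b. ennreal (wnorm_mat (W x) (Dmat f x))^2 \<partial>lborel)"
proof -
  let ?S = "cbox a b"
  define c where "c = (1/m) *\<^sub>R (\<integral>y. indicator ?S y *\<^sub>R f y \<partial>lborel)"
  define C where "C = CARD('d) * L"
  have C: "C \<ge> 0" using L by (simp add: C_def)
  have SL: "\<bar>x $ i - y $ i\<bar> \<le> L" if "x \<in> ?S" "y \<in> ?S" for x y i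
    using that L(2)[of i] by (simp add: mem_box_cart abs_le_iff) (smt (verit))
  have SC: "norm (y - x) \<le> C" if "x \<in> ?S" "y \<in> ?S" for x y
  proof -
    have "norm (y - x) \<le> (\<Sum>i\<in>UNIV. \<bar>(y - x) $ i\<bar>)" by (rule norm_le_l1_cart)
    also have "\<dots> \<le> (\<Sum>i\<in>(UNIV::'d set). L)" by (rule sum_mono) (use SL[OF that(2,1)] in simp)
    finally show ?thesis by (simp add: C_def)
  qed
  \<comment> \<open>The extension by 0 is Borel on the whole space, so Tonelli applies to a gradient
    that is controlled only on \<open>U\<close>.\<close>
  define D where "D z = (if z \<in> ?S then Dmat f z else 0)" for z
  have [measurable]: "D \<in> borel_measurable borel"
    unfolding D_def by (rule measurable_restrict_continuous[OF continuous_on_Dmat[OF f] S]) simp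
  define g where "g z = ennreal (wnorm_mat (W z) (D z))" for z
  have [measurable]: "g \<in> borel_measurable borel" unfolding g_def by measurable
  have contf: "continuous_on ?S f"
    by (rule continuous_on_subset[OF differentiable_imp_continuous_on[OF smooth_on_differentiable_on[OF f]] S])
  let ?z = "\<lambda>x y t::real. x + t *\<^sub>R (y - x)"
  have zS: "?z x y t \<in> ?S" if "x \<in> ?S" "y \<in> ?S" "t \<in> {0..1}" for x y t
  proof -
    have "?z x y t = (1 - t) *\<^sub>R x + t *\<^sub>R y" by (simp add: algebra_simps)
    then show ?thesis using convexD_alt[OF convex_box(1) that(1,2), of t] that by simp
  qed
  \<comment> \<open>Cauchy--Schwarz is used twice: in t against the constant 1 on the unit interval,
    then in y at fixed t, which puts \<open>relnorm\<close> and the gradient into separate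
    factors.\<close>
  have pt: "ennreal (wnorm (W x) (f x - c))^2 \<le> ennreal ((C/m)\<^sup>2) * (\<integral>\<^sup>+t\<in>{0..1}.
      (\<integral>\<^sup>+y\<in>?S. (relnorm (W x) (W (?z x y t)))\<^sup>2 \<partial>lborel) * (\<integral>\<^sup>+y\<in>?S. (g (?z x y t))\<^sup>2 \<partial>lborel) \<partial>lborel)"
    if x: "x \<in> ?S" for x
  proof -
    have "ennreal (wnorm (W x) (f x - c)) \<le> ennreal (1/m) * (\<integral>\<^sup>+y\<in>?S. ennreal (wnorm (W x) (f x - f y)) \<partial>lborel)"
      unfolding c_def by (rule wnorm_mean_deviation[OF compact_cbox contf m])
    also have "\<dots> \<le> ennreal (1/m) * (\<integral>\<^sup>+y\<in>?S. (\<integral>\<^sup>+t\<in>{0..1}. relnorm (W x) (W (?z x y t)) * (ennreal C * g (?z x y t)) \<partial>lborel) \<partial>lborel)"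
    proof (intro mult_left_mono nn_integral_mono)
      fix y
      show "ennreal (wnorm (W x) (f x - f y)) * indicator ?S y
        \<le> (\<integral>\<^sup>+t\<in>{0..1}. relnorm (W x) (W (?z x y t)) * (ennreal C * g (?z x y t)) \<partial>lborel) * indicator ?S y"
      proof (cases "y \<in> ?S")
        case True
        have "ennreal (wnorm (W x) (f x - f y)) \<le> (\<integral>\<^sup>+t\<in>{0..1}. relnorm (W x) (W (?z x y t)) * (ennreal C *
            ennreal (wnorm_mat (W (?z x y t)) (Dmat f (?z x y t)))) \<partial>lborel)"
          by (rule segment_bound[OF U f convex_box(1) S x True SC[OF x True]])
        also have "\<dots> = (\<integral>\<^sup>+t\<in>{0..1}. relnorm (W x) (W (?z x y t)) * (ennreal C * g (?z x y t)) \<partial>lborel)"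
          by (intro nn_integral_cong) (use zS[OF x True] in \<open>auto simp: g_def D_def indicator_def\<close>)
        finally show ?thesis using True by simp
      qed simp
    qed simp
    also have "(\<integral>\<^sup>+y\<in>?S. (\<integral>\<^sup>+t\<in>{0..1}. relnorm (W x) (W (?z x y t)) * (ennreal C * g (?z x y t)) \<partial>lborel) \<partial>lborel)
       = (\<integral>\<^sup>+y. (\<integral>\<^sup>+t. ennreal C * (relnorm (W x) (W (?z x y t)) * g (?z x y t) * indicator ?S y * indicator {0..1} t) \<partial>lborel) \<partial>lborel)"
      by (intro nn_integral_cong) (auto simp: indicator_def ac_simps intro!: nn_integral_cong)
    also have "\<dots> = (\<integral>\<^sup>+t. (\<integral>\<^sup>+y. ennreal C * (relnorm (W x) (W (?z x y t)) * g (?z x y t) * indicator ?S y * indicator {0..1} t) \<partial>lborel) \<partial>lborel)"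
      by (rule lborel_pair.Fubini') measurable
    also have "\<dots> = ennreal C * (\<integral>\<^sup>+t\<in>{0..1}. 1 * (\<integral>\<^sup>+y\<in>?S. relnorm (W x) (W (?z x y t)) * g (?z x y t) \<partial>lborel) \<partial>lborel)"
      by (simp add: nn_integral_cmult nn_integral_multc)
    finally have "ennreal (wnorm (W x) (f x - c))^2 \<le> (ennreal (1/m) * (ennreal C *
        (\<integral>\<^sup>+t\<in>{0..1}. 1 * (\<integral>\<^sup>+y\<in>?S. relnorm (W x) (W (?z x y t)) * g (?z x y t) \<partial>lborel) \<partial>lborel)))\<^sup>2"
      by (rule power_mono) simp
    also have "\<dots> = ennreal ((C/m)\<^sup>2) * (\<integral>\<^sup>+t\<in>{0..1}. 1 * (\<integral>\<^sup>+y\<in>?S. relnorm (W x) (W (?z x y t)) * g (?z x y t) \<partial>lborel) \<partial>lborel)\<^sup>2"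
    proof -
      have "ennreal (1/m) * (ennreal C * Z) = ennreal (C/m) * Z" for Z
        using C m by (simp add: mult.assoc[symmetric] ennreal_mult[symmetric])
      then show ?thesis using C m by (simp add: power_mult_distrib ennreal_power)
    qed
    also have "(\<integral>\<^sup>+t\<in>{0..1}. 1 * (\<integral>\<^sup>+y\<in>?S. relnorm (W x) (W (?z x y t)) * g (?z x y t) \<partial>lborel) \<partial>lborel)\<^sup>2
      \<le> (\<integral>\<^sup>+t\<in>{0..1::real}. 1\<^sup>2 \<partial>lborel) * (\<integral>\<^sup>+t\<in>{0..1}. (\<integral>\<^sup>+y\<in>?S. relnorm (W x) (W (?z x y t)) * g (?z x y t) \<partial>lborel)\<^sup>2 \<partial>lborel)"
      by (rule Cauchy_Schwarz_set_nn_integral) measurable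
    also have "(\<integral>\<^sup>+t\<in>{0..1::real}. 1\<^sup>2 \<partial>lborel) = 1" by simp
    also have "1 * (\<integral>\<^sup>+t\<in>{0..1}. (\<integral>\<^sup>+y\<in>?S. relnorm (W x) (W (?z x y t)) * g (?z x y t) \<partial>lborel)\<^sup>2 \<partial>lborel)
      \<le> (\<integral>\<^sup>+t\<in>{0..1}. (\<integral>\<^sup>+y\<in>?S. (relnorm (W x) (W (?z x y t)))\<^sup>2 \<partial>lborel) * (\<integral>\<^sup>+y\<in>?S. (g (?z x y t))\<^sup>2 \<partial>lborel) \<partial>lborel)"
      unfolding mult_1 by (intro nn_integral_mono mult_right_mono Cauchy_Schwarz_set_nn_integral) simp_all
    finally show ?thesis by (simp add: mult_left_mono)
  qed
  let ?K = "\<lambda>x t. (\<integral>\<^sup>+y\<in>?S. (relnorm (W x) (W (?z x y t)))\<^sup>2 \<partial>lborel) * (\<integral>\<^sup>+y\<in>?S. (g (?z x y t))\<^sup>2 \<partial>lborel)"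
  let ?B = "27 ^ CARD('d) * (L ^ CARD('d))\<^sup>2 * A"
  have "(\<integral>\<^sup>+x\<in>?S. ennreal (wnorm (W x) (f x - c))^2 \<partial>lborel)
     \<le> (\<integral>\<^sup>+x. (\<integral>\<^sup>+t. ennreal ((C/m)\<^sup>2) * (?K x t * indicator {0..1} t * indicator ?S x) \<partial>lborel) \<partial>lborel)"
  proof (rule nn_integral_mono)
    fix x
    show "ennreal (wnorm (W x) (f x - c))^2 * indicator ?S x
      \<le> (\<integral>\<^sup>+t. ennreal ((C/m)\<^sup>2) * (?K x t * indicator {0..1} t * indicator ?S x) \<partial>lborel)"
    proof (cases "x \<in> ?S")
      case True
      have "(\<integral>\<^sup>+t. ennreal ((C/m)\<^sup>2) * (?K x t * indicator {0..1} t) \<partial>lborel) = ennreal ((C/m)\<^sup>2) * (\<integral>\<^sup>+t\<in>{0..1}. ?K x t \<partial>lborel)"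
        by (rule nn_integral_cmult) measurable
      then show ?thesis using pt[OF True] True by simp
    qed simp
  qed
  also have "\<dots> = (\<integral>\<^sup>+t. (\<integral>\<^sup>+x. ennreal ((C/m)\<^sup>2) * (?K x t * indicator {0..1} t * indicator ?S x) \<partial>lborel) \<partial>lborel)"
    by (rule lborel_pair.Fubini') measurable
  also have "\<dots> \<le> (\<integral>\<^sup>+t. ennreal ((C/m)\<^sup>2) * (ennreal ?B * (\<integral>\<^sup>+z. (g z)\<^sup>2 \<partial>lborel)) * indicator {0..1::real} t \<partial>lborel)"
  proof (rule nn_integral_mono_AE, rule AE_mp[OF AE_lborel_singleton[of 0]], intro AE_I2 impI)
    \<comment> \<open>At t = 0 the substitution behind \<open>kernel_bound\<close> degenerates; a
      single point is negligible.\<close>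
    fix t :: real assume t: "t \<noteq> 0"
    show "(\<integral>\<^sup>+x. ennreal ((C/m)\<^sup>2) * (?K x t * indicator {0..1} t * indicator ?S x) \<partial>lborel)
      \<le> ennreal ((C/m)\<^sup>2) * (ennreal ?B * (\<integral>\<^sup>+z. (g z)\<^sup>2 \<partial>lborel)) * indicator {0..1} t"
    proof (cases "t \<in> {0..1}")
      case True
      then have t0: "t > 0" using t by simp
      have "(\<integral>\<^sup>+x. ennreal ((C/m)\<^sup>2) * (?K x t * indicator ?S x) \<partial>lborel) = ennreal ((C/m)\<^sup>2) * (\<integral>\<^sup>+x\<in>?S. ?K x t \<partial>lborel)"
        by (rule nn_integral_cmult) measurable
      also have "\<dots> \<le> ennreal ((C/m)\<^sup>2) * (ennreal ?B * (\<integral>\<^sup>+z. (g z)\<^sup>2 \<partial>lborel))"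
        by (intro mult_left_mono kernel_bound t0 L SL) auto
      finally show ?thesis using True by simp
    qed simp
  qed
  also have "\<dots> = ennreal ((C/m)\<^sup>2) * (ennreal ?B * (\<integral>\<^sup>+z. (g z)\<^sup>2 \<partial>lborel))"
    by (subst nn_integral_cmult_indicator) auto
  also have "(\<integral>\<^sup>+z. (g z)\<^sup>2 \<partial>lborel) = (\<integral>\<^sup>+x\<in>?S. ennreal (wnorm_mat (W x) (Dmat f x))^2 \<partial>lborel)"
    by (intro nn_integral_cong) (auto simp: g_def D_def indicator_def wnorm_mat_def qform_def column_def)
  also have "ennreal ((C/m)\<^sup>2) * (ennreal ?B * (\<integral>\<^sup>+x\<in>?S. ennreal (wnorm_mat (W x) (Dmat f x))^2 \<partial>lborel))
     = ennreal ((C/m)\<^sup>2 * ?B) * (\<integral>\<^sup>+x\<in>?S. ennreal (wnorm_mat (W x) (Dmat f x))^2 \<partial>lborel)"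
    using A_nonneg L by (subst ennreal_mult) (auto simp: mult.assoc)
  finally show ?thesis unfolding C_def by blast
qed

end

section \<open>The Poincare inequality on annuli\<close>

lemma prod_if_eq:
  fixes \<alpha> \<beta> :: real
  assumes "\<beta> \<noteq> 0"
  shows "(\<Prod>k\<in>(UNIV::'d::finite set). if k = i then \<alpha> else \<beta>) = \<beta> ^ CARD('d) * (\<alpha> / \<beta>)"
proof -
  have "(\<Prod>k\<in>(UNIV::'d set). if k = i then \<alpha> else \<beta>) = (\<Prod>k\<in>(UNIV::'d set). \<beta> * (if k = i then \<alpha> / \<beta> else 1))"
    by (intro prod.cong refl) (use assms in auto)
  then show ?thesis by (simp add: prod.distrib)
qed

lemma prod_if_eq2:
  fixes \<alpha> \<beta> :: real
  assumes "\<beta> \<noteq> 0" "i \<noteq> j"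
  shows "(\<Prod>k\<in>(UNIV::'d::finite set). if k = i then \<alpha> else if k = j then \<alpha> else \<beta>) = \<beta> ^ CARD('d) * (\<alpha> / \<beta>)\<^sup>2"
proof -
  have "(\<Prod>k\<in>(UNIV::'d set). if k = i then \<alpha> else if k = j then \<alpha> else \<beta>)
     = (\<Prod>k\<in>(UNIV::'d set). \<beta> * ((if k = i then \<alpha> / \<beta> else 1) * (if k = j then \<alpha> / \<beta> else 1)))"
    by (intro prod.cong refl) (use assms in auto)
  then show ?thesis by (simp add: prod.distrib power2_eq_square)
qed

text \<open>The index k selects the coordinate across which the slab is thin and, by its Boolean,
  the upper side (\<open>True\<close>) or the lower one. A slab has width 2r in that coordinate and
  6r in the others.\<close>

definition slab_lo :: "real^'d \<Rightarrow> real \<Rightarrow> 'd \<times> bool \<Rightarrow> real^'d" where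
  "slab_lo x0 r k = (\<chi> j. if j = fst k \<and> snd k then x0 $ j + r else x0 $ j - 3 * r)"

definition slab_hi :: "real^'d \<Rightarrow> real \<Rightarrow> 'd \<times> bool \<Rightarrow> real^'d" where
  "slab_hi x0 r k = (\<chi> j. if j = fst k \<and> \<not> snd k then x0 $ j - r else x0 $ j + 3 * r)"

definition slab :: "real^'d \<Rightarrow> real \<Rightarrow> 'd \<times> bool \<Rightarrow> (real^'d) set" where
  "slab x0 r k = cbox (slab_lo x0 r k) (slab_hi x0 r k)"

text \<open>Balls of the maximum norm, given by centre and half-side, whereas \<open>cube\<close> is
  given by corner and side.\<close>

definition mcball :: "real^'d \<Rightarrow> real \<Rightarrow> (real^'d) set" where
  "mcball x0 r = {x. \<forall>i. \<bar>x $ i - x0 $ i\<bar> \<le> r}"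

definition mball :: "real^'d \<Rightarrow> real \<Rightarrow> (real^'d) set" where
  "mball x0 r = {x. \<forall>i. \<bar>x $ i - x0 $ i\<bar> < r}"

lemma mcball_cube: "mcball x0 r = cube (x0 - r *\<^sub>R One) (2 * r)"
  by (auto simp: mcball_def mem_cube One_cart abs_le_iff algebra_simps)

lemma mcball_cbox: "mcball x0 r = cbox (\<chi> i. x0 $ i - r) (\<chi> i. x0 $ i + r)"
  by (auto simp: mcball_def mem_box_cart abs_le_iff algebra_simps)

lemma mball_box: "mball x0 r = box (\<chi> i. x0 $ i - r) (\<chi> i. x0 $ i + r)"
  by (auto simp: mball_def mem_box_cart abs_less_iff algebra_simps)

lemma mball_sets[measurable]: "mball x0 r \<in> sets borel" "mcball x0 r \<in> sets borel"
  unfolding mball_box mcball_cbox by simp_all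

lemma slab_sets[measurable]: "slab x0 r k \<in> sets borel"
  by (simp add: slab_def)

lemma annulus_slabs:
  assumes r: "r > 0"
  shows "mcball x0 (3 * r) - mball x0 r = (\<Union>k. slab x0 r k)"
proof
  show "mcball x0 (3 * r) - mball x0 r \<subseteq> (\<Union>k. slab x0 r k)"
  proof
    fix x assume x: "x \<in> mcball x0 (3 * r) - mball x0 r"
    then obtain i where i: "\<bar>x $ i - x0 $ i\<bar> \<ge> r" by (auto simp: mball_def not_less)
    have b: "x0 $ j - 3 * r \<le> x $ j \<and> x $ j \<le> x0 $ j + 3 * r" for j
      using x by (auto simp: mcball_def abs_le_iff algebra_simps)
    have "x \<in> slab x0 r (i, x $ i \<ge> x0 $ i)"
      unfolding slab_def mem_box_cart slab_lo_def slab_hi_def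
      using b i by (auto split: if_splits simp: abs_if)
    then show "x \<in> (\<Union>k. slab x0 r k)" by blast
  qed
  show "(\<Union>k. slab x0 r k) \<subseteq> mcball x0 (3 * r) - mball x0 r"
  proof
    fix x assume "x \<in> (\<Union>k. slab x0 r k)"
    then obtain i b where x: "x \<in> slab x0 r (i, b)" by auto
    have lo: "slab_lo x0 r (i,b) $ j \<le> x $ j" "x $ j \<le> slab_hi x0 r (i,b) $ j" for j
      using x by (auto simp: slab_def mem_box_cart)
    have "\<bar>x $ j - x0 $ j\<bar> \<le> 3 * r" for j
      using lo[of j] r by (auto simp: slab_lo_def slab_hi_def abs_le_iff split: if_splits)
    moreover have "\<not> \<bar>x $ i - x0 $ i\<bar> < r"
      using lo[of i] r by (auto simp: slab_lo_def slab_hi_def abs_less_iff split: if_splits)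
    ultimately show "x \<in> mcball x0 (3 * r) - mball x0 r" by (auto simp: mcball_def mball_def)
  qed
qed

lemma emeasure_slab:
  assumes "r > 0"
  shows "emeasure lborel (slab x0 r k :: (real^'d) set) = ennreal ((6 * r) ^ CARD('d) / 3)"
proof -
  have "slab_hi x0 r k $ j - slab_lo x0 r k $ j = (if j = fst k then 2 * r else 6 * r)" for j
    by (auto simp: slab_lo_def slab_hi_def)
  moreover have "slab_lo x0 r k $ j \<le> slab_hi x0 r k $ j" for j
    using assms by (auto simp: slab_lo_def slab_hi_def)
  ultimately show ?thesis
    unfolding slab_def using assms by (simp add: emeasure_cbox_cart prod_if_eq)
qed

text \<open>Slabs belonging to different coordinates meet in a box of width 2r in two directions, a
  ninth of the large cube. Slabs on opposite sides of one coordinate are disjoint, which is why the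
  coordinates must differ.\<close>

lemma emeasure_slab_Int:
  assumes r: "r > 0" and "fst k \<noteq> fst l"
  shows "emeasure lborel (slab x0 r k \<inter> slab x0 r l :: (real^'d) set) = ennreal ((6 * r) ^ CARD('d) / 9)"
proof -
  let ?a = "\<chi> j. max (slab_lo x0 r k $ j) (slab_lo x0 r l $ j)" and ?b = "\<chi> j. min (slab_hi x0 r k $ j) (slab_hi x0 r l $ j)"
  have eq: "slab x0 r k \<inter> slab x0 r l = cbox ?a ?b"
    by (auto simp: slab_def mem_box_cart)
  have "?b $ j - ?a $ j = (if j = fst k then 2 * r else if j = fst l then 2 * r else 6 * r)" for j
    using assms by (auto simp: slab_lo_def slab_hi_def)
  moreover have "?a $ j \<le> ?b $ j" for j
    using assms by (auto simp: slab_lo_def slab_hi_def)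
  ultimately show ?thesis
    unfolding eq using assms by (subst emeasure_cbox_cart) (simp_all only: prod_if_eq2, simp_all add: prod_if_eq2 power2_eq_square)
qed

lemma power2_sum_le_ennreal: "(x + y)\<^sup>2 \<le> 2 * x\<^sup>2 + 2 * (y::ennreal)\<^sup>2"
proof (cases x; cases y)
  fix a b assume ab: "x = ennreal a" "0 \<le> a" "y = ennreal b" "0 \<le> b"
  have "(a + b)\<^sup>2 \<le> 2 * a\<^sup>2 + 2 * b\<^sup>2" using sum_squares_ge_zero[of "a - b" 0] by (simp add: power2_eq_square algebra_simps)
  then have "ennreal ((a + b)\<^sup>2) \<le> ennreal (2 * a\<^sup>2 + 2 * b\<^sup>2)" by (rule ennreal_leI)
  then show ?thesis using ab by (simp add: ennreal_power[symmetric] ennreal_plus ennreal_mult)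
qed (auto simp: ennreal_mult_top power2_eq_square)

context borel_weight begin

text \<open>Since relnorm(x, y) relnorm(y, x) \<ge> 1 pointwise, the symmetrised integrand
  relnorm(x, y)^2 + relnorm(y, x)^2 is at least 2; integrating over the unit cube in both variables
  gives the bound.\<close>

lemma A_ge_1: "A \<ge> 1"
proof -
  let ?Q = "cube 0 1 :: (real^'d) set"
  define I where "I = (\<integral>\<^sup>+x. (\<integral>\<^sup>+y. (relnorm (W x) (W y))\<^sup>2 * indicator ?Q x * indicator ?Q y \<partial>lborel) \<partial>lborel)"
  have "I \<le> ennreal A"
    using A2[of 1 0] unfolding I_def by (simp add: nn_integral_multc nn_integral_cmult ac_simps)
  have I2: "I = (\<integral>\<^sup>+x. (\<integral>\<^sup>+y. (relnorm (W y) (W x))\<^sup>2 * indicator ?Q x * indicator ?Q y \<partial>lborel) \<partial>lborel)"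
    unfolding I_def by (subst lborel_pair.Fubini') (measurable, simp add: ac_simps)
  have one: "1 \<le> relnorm (W x) (W y) * relnorm (W y) (W x)" for x y
  proof -
    obtain v :: "complex^'n" where v: "norm v = 1" using vector_choose_size[of 1] by auto
    have pos: "wnorm (W x) v > 0"
      using wnorm_nonneg[OF W_pos_def, of x v] wnorm_zero_iff[OF W_pos_def, of x v] v by fastforce
    have "1 * ennreal (wnorm (W x) v) \<le> relnorm (W x) (W y) * ennreal (wnorm (W y) v)"
      by (simp add: wnorm_le_relnorm W_pos_def)
    also have "\<dots> \<le> relnorm (W x) (W y) * (relnorm (W y) (W x) * ennreal (wnorm (W x) v))"
      by (intro mult_left_mono wnorm_le_relnorm W_pos_def) simp
    finally have "ennreal (wnorm (W x) v) * 1 \<le> ennreal (wnorm (W x) v) * (relnorm (W x) (W y) * relnorm (W y) (W x))"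
      by (simp add: ac_simps)
    then show ?thesis using pos by (subst (asm) ennreal_mult_le_mult_iff) auto
  qed
  have "2 * (\<integral>\<^sup>+x. (\<integral>\<^sup>+y. indicator ?Q x * indicator ?Q y \<partial>lborel) \<partial>lborel)
    = (\<integral>\<^sup>+x. (\<integral>\<^sup>+y. 2 * (indicator ?Q x * indicator ?Q y) \<partial>lborel) \<partial>lborel)"
    by (simp add: nn_integral_cmult)
  also have "\<dots> \<le> (\<integral>\<^sup>+x. (\<integral>\<^sup>+y. (relnorm (W x) (W y))\<^sup>2 * indicator ?Q x * indicator ?Q y
       + (relnorm (W y) (W x))\<^sup>2 * indicator ?Q x * indicator ?Q y \<partial>lborel) \<partial>lborel)"
  proof (intro nn_integral_mono)
    fix x y
    have "2 * 1 \<le> 2 * (relnorm (W x) (W y) * relnorm (W y) (W x))" by (intro mult_left_mono one) simp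
    also have "\<dots> \<le> (relnorm (W x) (W y))\<^sup>2 + (relnorm (W y) (W x))\<^sup>2"
      using sum_of_squares_ge_ennreal[of "relnorm (W x) (W y)" "relnorm (W y) (W x)"] by (simp add: mult.assoc)
    finally have "2 * (indicator ?Q x * indicator ?Q y) \<le> ((relnorm (W x) (W y))\<^sup>2 + (relnorm (W y) (W x))\<^sup>2) * (indicator ?Q x * indicator ?Q y)"
      by (intro mult_right_mono) auto
    then show "2 * (indicator ?Q x * indicator ?Q y) \<le> (relnorm (W x) (W y))\<^sup>2 * indicator ?Q x * indicator ?Q y
       + (relnorm (W y) (W x))\<^sup>2 * indicator ?Q x * indicator ?Q y" by (simp add: distrib_right mult.assoc)
  qed
  also have "\<dots> = I + I"
    unfolding I2 using I2 unfolding I_def by (simp add: nn_integral_add)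
  finally have "2 * 1 \<le> 2 * I" by (simp add: nn_integral_cmult emeasure_cube mult_2)
  then have "1 \<le> I" by (subst (asm) ennreal_mult_le_mult_iff) auto
  with \<open>I \<le> ennreal A\<close> have "1 \<le> ennreal A" by (rule order_trans[rotated])
  then show ?thesis by simp
qed

text \<open>On the overlap c' - c is a sum of two controlled deviations, and \<open>doubling\<close>
  spreads its weighted norm from the overlap to the whole cube. This is the single move by which a
  constant chosen on one slab is used on another, at a cost linear in A.\<close>

lemma chain_averages:
  fixes F :: "real^'d \<Rightarrow> complex^'n"
  assumes [measurable]: "F \<in> borel_measurable borel" and r: "r > 0" and kl: "fst k \<noteq> fst l"
    and Nk: "(\<integral>\<^sup>+x\<in>slab x0 r k. ennreal (wnorm (W x) (F x - c))^2 \<partial>lborel) \<le> N"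
    and Nl: "(\<integral>\<^sup>+x\<in>slab x0 r l. ennreal (wnorm (W x) (F x - c'))^2 \<partial>lborel) \<le> N"
  shows "(\<integral>\<^sup>+x\<in>slab x0 r l. ennreal (wnorm (W x) (F x - c))^2 \<partial>lborel) \<le> ennreal (1000 * A) * N"
proof -
  let ?T = "slab x0 r k \<inter> slab x0 r l" and ?P = "cube (x0 - (3 * r) *\<^sub>R One) (6 * r)"
  let ?v = "(6 * r) ^ CARD('d)"
  have v: "?v > 0" using r by simp
  have Tm[measurable]: "?T \<in> sets borel" by simp
  have P: "?P = mcball x0 (3 * r)" by (simp add: mcball_cube)
  have sub: "slab x0 r m \<subseteq> ?P" for m using annulus_slabs[OF r, of x0] unfolding P by blast
  have sq: "ennreal (wnorm (W x) (a + b))^2 \<le> 2 * ennreal (wnorm (W x) a)^2 + 2 * ennreal (wnorm (W x) b)^2" for x a b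
  proof -
    have "ennreal (wnorm (W x) (a + b)) \<le> ennreal (wnorm (W x) a) + ennreal (wnorm (W x) b)"
      using wnorm_triangle[OF W_pos_def, of x a b] wnorm_nonneg[OF W_pos_def] by (simp flip: ennreal_plus)
    then have "(ennreal (wnorm (W x) (a + b)))\<^sup>2 \<le> (ennreal (wnorm (W x) a) + ennreal (wnorm (W x) b))\<^sup>2"
      by (rule power_mono) simp
    also note power2_sum_le_ennreal
    finally show ?thesis .
  qed
  have two: "(\<integral>\<^sup>+x\<in>B. ennreal (wnorm (W x) (p x + q x))^2 \<partial>lborel)
     \<le> 2 * (\<integral>\<^sup>+x\<in>B. ennreal (wnorm (W x) (p x))^2 \<partial>lborel) + 2 * (\<integral>\<^sup>+x\<in>B. ennreal (wnorm (W x) (q x))^2 \<partial>lborel)"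
    if [measurable]: "p \<in> borel_measurable borel" "q \<in> borel_measurable borel" "B \<in> sets borel" for p q B
  proof -
    have "(\<integral>\<^sup>+x\<in>B. ennreal (wnorm (W x) (p x + q x))^2 \<partial>lborel)
      \<le> (\<integral>\<^sup>+x. 2 * (ennreal (wnorm (W x) (p x))^2 * indicator B x) + 2 * (ennreal (wnorm (W x) (q x))^2 * indicator B x) \<partial>lborel)"
      by (intro nn_integral_mono) (use sq in \<open>auto simp: indicator_def\<close>)
    also have "\<dots> = 2 * (\<integral>\<^sup>+x\<in>B. ennreal (wnorm (W x) (p x))^2 \<partial>lborel) + 2 * (\<integral>\<^sup>+x\<in>B. ennreal (wnorm (W x) (q x))^2 \<partial>lborel)"
      by (subst nn_integral_add) (simp_all add: nn_integral_cmult)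
    finally show ?thesis .
  qed
  have mono: "(\<integral>\<^sup>+x\<in>B. h x \<partial>lborel) \<le> (\<integral>\<^sup>+x\<in>B'. h x \<partial>lborel)" if "B \<subseteq> B'" for B B' and h :: "real^'d \<Rightarrow> ennreal"
    by (intro nn_integral_mono) (use that in \<open>auto simp: indicator_def\<close>)
  define J where "J = (\<integral>\<^sup>+x\<in>?P. ennreal (wnorm (W x) (c' - c))^2 \<partial>lborel)"
  define JT where "JT = (\<integral>\<^sup>+x\<in>?T. ennreal (wnorm (W x) (c' - c))^2 \<partial>lborel)"
  have JT: "JT \<le> 4 * N"
  proof -
    have "JT = (\<integral>\<^sup>+x\<in>?T. ennreal (wnorm (W x) ((F x - c) + (c' - F x)))^2 \<partial>lborel)" by (simp add: JT_def)
    also have "\<dots> \<le> 2 * (\<integral>\<^sup>+x\<in>?T. ennreal (wnorm (W x) (F x - c))^2 \<partial>lborel) + 2 * (\<integral>\<^sup>+x\<in>?T. ennreal (wnorm (W x) (c' - F x))^2 \<partial>lborel)"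
      by (rule two) measurable
    also have "(\<integral>\<^sup>+x\<in>?T. ennreal (wnorm (W x) (F x - c))^2 \<partial>lborel) \<le> N"
      by (rule order_trans[OF mono Nk]) auto
    also have "(\<integral>\<^sup>+x\<in>?T. ennreal (wnorm (W x) (c' - F x))^2 \<partial>lborel) = (\<integral>\<^sup>+x\<in>?T. ennreal (wnorm (W x) (F x - c'))^2 \<partial>lborel)"
      by (simp add: wnorm_minus_commute[OF W_pos_def])
    also have "\<dots> \<le> N" by (rule order_trans[OF mono Nl]) auto
    finally show ?thesis by (simp add: add_mono mult_left_mono) (simp add: distrib_right[symmetric])
  qed
  \<comment> \<open>The overlap fills 1/9 of \<open>?P\<close>, and \<open>doubling\<close> uses the
    square of that ratio.\<close>
  have "ennreal (?v\<^sup>2) * (ennreal (1/81) * J) = (emeasure lborel ?T)\<^sup>2 * J"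
    unfolding emeasure_slab_Int[OF r kl] using v r
    by (simp add: ennreal_power mult.assoc[symmetric] ennreal_mult[symmetric] power_divide)
  also have "\<dots> \<le> ennreal (A * ?v\<^sup>2) * JT"
    unfolding J_def JT_def by (rule doubling) (use r sub[of k] in auto)
  also have "\<dots> = ennreal (?v\<^sup>2) * (ennreal A * JT)"
    using A_nonneg by (simp add: ennreal_mult ac_simps)
  finally have "ennreal (1/81) * J \<le> ennreal A * JT" using v r by (subst (asm) ennreal_mult_le_mult_iff) auto
  then have "ennreal 81 * (ennreal (1/81) * J) \<le> ennreal 81 * (ennreal A * JT)" by (rule mult_left_mono) simp
  moreover have "ennreal 81 * (ennreal (1/81) * J) = J"
  proof -
    have "ennreal 81 * ennreal (1/81) = 1" by (simp add: ennreal_mult[symmetric] del: ennreal_numeral)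
    then show ?thesis by (simp only: mult.assoc[symmetric] mult_1)
  qed
  ultimately have "J \<le> ennreal 81 * (ennreal A * JT)" by metis
  also have "\<dots> \<le> ennreal 81 * (ennreal A * (4 * N))" by (intro mult_left_mono JT) auto
  also have "\<dots> = ennreal (324 * A) * N"
  proof -
    have "ennreal (324 * A) = ennreal 81 * (ennreal A * ennreal 4)"
      using A_nonneg by (simp add: ennreal_mult[symmetric] del: ennreal_numeral)
    then show ?thesis by (simp add: mult.assoc)
  qed
  finally have J: "J \<le> ennreal (324 * A) * N" .
  have "(\<integral>\<^sup>+x\<in>slab x0 r l. ennreal (wnorm (W x) (F x - c))^2 \<partial>lborel)
     = (\<integral>\<^sup>+x\<in>slab x0 r l. ennreal (wnorm (W x) ((F x - c') + (c' - c)))^2 \<partial>lborel)" by simp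
  also have "\<dots> \<le> 2 * (\<integral>\<^sup>+x\<in>slab x0 r l. ennreal (wnorm (W x) (F x - c'))^2 \<partial>lborel)
      + 2 * (\<integral>\<^sup>+x\<in>slab x0 r l. ennreal (wnorm (W x) (c' - c))^2 \<partial>lborel)"
    by (rule two) measurable
  also have "\<dots> \<le> 2 * N + 2 * J"
    unfolding J_def by (intro add_mono mult_left_mono Nl mono sub) auto
  \<comment> \<open>A \<ge> 1 lets the term without A be absorbed; 648 = 2 * 81 * 4.\<close>
  also have "\<dots> \<le> ennreal (2 * A) * N + ennreal (648 * A) * N"
  proof (rule add_mono)
    have "ennreal 2 * N \<le> ennreal (2 * A) * N" by (intro mult_right_mono ennreal_leI) (use A_ge_1 in auto)
    then show "2 * N \<le> ennreal (2 * A) * N" by simp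
    have "2 * J \<le> 2 * (ennreal (324 * A) * N)" by (rule mult_left_mono[OF J]) simp
    also have "\<dots> = ennreal (648 * A) * N"
    proof -
      have "ennreal (648 * A) = ennreal 2 * ennreal (324 * A)"
        using A_nonneg by (simp add: ennreal_mult[symmetric] del: ennreal_numeral)
      then show ?thesis by (simp add: mult.assoc)
    qed
    finally show "2 * J \<le> ennreal (648 * A) * N" .
  qed
  also have "\<dots> = ennreal (650 * A) * N" using A_nonneg by (simp add: distrib_right[symmetric] ennreal_plus[symmetric] del: ennreal_plus)
  also have "\<dots> \<le> ennreal (1000 * A) * N" using A_nonneg by (intro mult_right_mono ennreal_leI) auto
  finally show ?thesis .
qed

text \<open>One constant must serve all 2d slabs. A single box costs A, and at most two moves of the
  constant cost 1000 A each, hence A^3; the number 648 * 10^6 is 2 * 324 * 1000^2.\<close>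

theorem poincare_annulus:
  fixes f :: "real^'d \<Rightarrow> complex^'n"
  assumes d2: "CARD('d) \<ge> 2" and U: "open U" and f: "smooth_on U f" and r: "r > 0" and P: "mcball x0 (3 * r) \<subseteq> U"
  defines "Z \<equiv> mcball x0 (3 * r) - mball x0 r"
  shows "\<exists>c. (\<integral>\<^sup>+x\<in>Z. ennreal (wnorm (W x) (f x - c))^2 \<partial>lborel)
    \<le> ennreal (648 * 10^6 * real CARD('d) ^ 3 * 27 ^ CARD('d) * A ^ 3 * r\<^sup>2) * (\<integral>\<^sup>+x\<in>Z. ennreal (wnorm_mat (W x) (Dmat f x))^2 \<partial>lborel)"
proof -
  define F where "F x = (if x \<in> mcball x0 (3 * r) then f x else 0)" for x
  have [measurable]: "F \<in> borel_measurable borel"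
    unfolding F_def
    by (rule measurable_restrict_continuous[OF differentiable_imp_continuous_on[OF smooth_on_differentiable_on[OF f]] P]) simp
  have ZU: "Z = (\<Union>k. slab x0 r k)" unfolding Z_def by (rule annulus_slabs[OF r])
  have slabZ: "slab x0 r k \<subseteq> Z" for k unfolding ZU by blast
  have slabP: "slab x0 r k \<subseteq> mcball x0 (3 * r)" for k using slabZ[of k] by (auto simp: Z_def)
  define E where "E = (\<integral>\<^sup>+x\<in>Z. ennreal (wnorm_mat (W x) (Dmat f x))^2 \<partial>lborel)"
  define v where "v = (6 * r) ^ CARD('d)"
  have v: "v > 0" using r by (simp add: v_def)
  \<comment> \<open>From \<open>poincare_box\<close> with L = 6r and m = (6r)^d / 3: the powers of
    (6r)^d cancel, and 324 = 18^2.\<close>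
  define \<kappa> where "\<kappa> = 324 * CARD('d) ^ 2 * 27 ^ CARD('d) * A * r\<^sup>2"
  have \<kappa>: "\<kappa> \<ge> 0" using A_nonneg by (simp add: \<kappa>_def)
  have "\<exists>c. (\<integral>\<^sup>+x\<in>slab x0 r k. ennreal (wnorm (W x) (F x - c))^2 \<partial>lborel) \<le> ennreal \<kappa> * E" for k
  proof -
    have m: "measure lborel (slab x0 r k) = v / 3"
      using emeasure_slab[OF r, of x0 k] v unfolding v_def measure_def by (simp del: ennreal_numeral)
    have len: "slab_hi x0 r k $ i - slab_lo x0 r k $ i \<le> 6 * r" for i
      using r by (auto simp: slab_hi_def slab_lo_def)
    obtain c where "(\<integral>\<^sup>+x\<in>slab x0 r k. ennreal (wnorm (W x) (f x - c))^2 \<partial>lborel)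
      \<le> ennreal ((CARD('d) * (6 * r) / (v / 3))\<^sup>2 * (27 ^ CARD('d) * ((6 * r) ^ CARD('d))\<^sup>2 * A))
       * (\<integral>\<^sup>+x\<in>slab x0 r k. ennreal (wnorm_mat (W x) (Dmat f x))^2 \<partial>lborel)"
      using poincare_box[OF U f _ m[unfolded slab_def] _ _ len] slabP[of k] P r v unfolding slab_def by auto
    also have "(CARD('d) * (6 * r) / (v / 3))\<^sup>2 * (27 ^ CARD('d) * ((6 * r) ^ CARD('d))\<^sup>2 * A) = \<kappa>"
      using v unfolding v_def[symmetric] \<kappa>_def by (simp add: power2_eq_square field_simps)
    also have "ennreal \<kappa> * (\<integral>\<^sup>+x\<in>slab x0 r k. ennreal (wnorm_mat (W x) (Dmat f x))^2 \<partial>lborel) \<le> ennreal \<kappa> * E"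
      unfolding E_def using slabZ[of k] by (intro mult_left_mono nn_integral_mono) (auto simp: indicator_def)
    also have "(\<integral>\<^sup>+x\<in>slab x0 r k. ennreal (wnorm (W x) (f x - c))^2 \<partial>lborel) = (\<integral>\<^sup>+x\<in>slab x0 r k. ennreal (wnorm (W x) (F x - c))^2 \<partial>lborel)"
      using slabP[of k] by (intro nn_integral_cong) (auto simp: F_def indicator_def)
    finally show ?thesis by blast
  qed
  then have "\<forall>k. \<exists>c. (\<integral>\<^sup>+x\<in>slab x0 r k. ennreal (wnorm (W x) (F x - c))^2 \<partial>lborel) \<le> ennreal \<kappa> * E" by blast
  from choice[OF this] obtain c
    where c: "\<And>k. (\<integral>\<^sup>+x\<in>slab x0 r k. ennreal (wnorm (W x) (F x - c k))^2 \<partial>lborel) \<le> ennreal \<kappa> * E" by blast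
  have "\<not> CARD('d) \<le> Suc 0" using d2 by simp
  then obtain i j :: 'd where ij: "i \<noteq> j" by (auto simp: card_le_Suc0_iff_eq)
  define N where "N = ennreal \<kappa> * E"
  define c0 where "c0 = c (i, True)"
  have N1: "N \<le> ennreal (1000 * A) * N"
    using mult_right_mono[of 1 "ennreal (1000 * A)" N] A_ge_1 by simp
  have step1: "(\<integral>\<^sup>+x\<in>slab x0 r k. ennreal (wnorm (W x) (F x - c0))^2 \<partial>lborel) \<le> ennreal (1000 * A) * N" if "fst k \<noteq> i" for k
    using chain_averages[OF _ r, where F=F and k="(i, True)" and l=k and c=c0 and N=N and c'="c k"] c[of k] c[of "(i,True)"] that
    by (simp add: c0_def N_def)
  \<comment> \<open>A slab in direction i, in particular the one opposite to the reference slab, is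
    reached through \<open>(j, True)\<close>; any other slab meets the reference slab
    itself.\<close>
  have all: "(\<integral>\<^sup>+x\<in>slab x0 r k. ennreal (wnorm (W x) (F x - c0))^2 \<partial>lborel) \<le> ennreal (1000 * A) * (ennreal (1000 * A) * N)" for k
  proof (cases "fst k = i")
    case False
    have "ennreal (1000 * A) * N \<le> ennreal (1000 * A) * (ennreal (1000 * A) * N)" by (intro mult_left_mono N1) simp
    then show ?thesis using step1[OF False] order_trans by blast
  next
    case True
    show ?thesis
      by (rule chain_averages[OF _ r, where F=F and k="(j, True)" and l=k and c=c0 and c'="c k"])
        (use True ij step1[of "(j,True)"] order_trans[OF c[of k] N1[unfolded N_def]] in \<open>auto simp: N_def\<close>)
  qed
  have "(\<integral>\<^sup>+x\<in>Z. ennreal (wnorm (W x) (f x - c0))^2 \<partial>lborel)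
     \<le> (\<integral>\<^sup>+x. (\<Sum>k\<in>UNIV. ennreal (wnorm (W x) (F x - c0))^2 * indicator (slab x0 r k) x) \<partial>lborel)"
  proof (rule nn_integral_mono)
    fix x
    show "ennreal (wnorm (W x) (f x - c0))^2 * indicator Z x
       \<le> (\<Sum>k\<in>UNIV. ennreal (wnorm (W x) (F x - c0))^2 * indicator (slab x0 r k) x)"
    proof (cases "x \<in> Z")
      case True
      then obtain k where k: "x \<in> slab x0 r k" unfolding ZU by blast
      have "ennreal (wnorm (W x) (f x - c0))^2 * indicator Z x = ennreal (wnorm (W x) (F x - c0))^2 * indicator (slab x0 r k) x"
        using True k by (auto simp: F_def Z_def)
      also have "\<dots> \<le> (\<Sum>k\<in>UNIV. ennreal (wnorm (W x) (F x - c0))^2 * indicator (slab x0 r k) x)"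
        by (rule member_le_sum) auto
      finally show ?thesis .
    qed simp
  qed
  also have "\<dots> = (\<Sum>k\<in>UNIV. (\<integral>\<^sup>+x\<in>slab x0 r k. ennreal (wnorm (W x) (F x - c0))^2 \<partial>lborel))"
    by (rule nn_integral_sum) measurable
  also have "\<dots> \<le> (\<Sum>k\<in>(UNIV::('d\<times>bool) set). ennreal (1000 * A) * (ennreal (1000 * A) * N))"
    by (rule sum_mono[OF all])
  also have "\<dots> = ennreal (2 * CARD('d)) * (ennreal (1000 * A) * (ennreal (1000 * A) * (ennreal \<kappa> * E)))"
    by (simp add: N_def card_cartesian_product UNIV_Times_UNIV[symmetric] del: UNIV_Times_UNIV)
       (simp add: ennreal_of_nat_eq_real_of_nat ennreal_mult mult.commute)
  also have "\<dots> = ennreal (2 * CARD('d) * (1000 * A * (1000 * A * \<kappa>))) * E"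
  proof -
    have "ennreal a * (ennreal b * (ennreal b * (ennreal k * E))) = ennreal (a * (b * (b * k))) * E"
      if "a \<ge> 0" "b \<ge> 0" "k \<ge> 0" for a b k using that by (simp add: ennreal_mult mult.assoc)
    then show ?thesis using A_nonneg \<kappa> by simp
  qed
  also have "2 * CARD('d) * (1000 * A * (1000 * A * \<kappa>)) = 648 * 10^6 * real CARD('d) ^ 3 * 27 ^ CARD('d) * A ^ 3 * r\<^sup>2"
    by (simp add: \<kappa>_def power2_eq_square power3_eq_cube)
  finally show ?thesis unfolding E_def by blast
qed

end

section \<open>The energy estimate\<close>

lemma borel_measurable_lebesgueI:
  assumes "f \<in> borel_measurable borel" shows "f \<in> borel_measurable lebesgue"
proof (rule measurable_completion)
  show "f \<in> borel_measurable lborel" using assms by simp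
qed

text \<open>F has no sign, so the inequality must be integrated among integrable functions. If the
  integral of H is infinite there is nothing to prove; otherwise u is integrable, being dominated by
  |F| + H.\<close>

lemma nn_integral_le_of_integral_zero:
  fixes F u H :: "'a \<Rightarrow> real"
  assumes F: "integrable M F" "integral\<^sup>L M F = 0"
    and [measurable]: "u \<in> borel_measurable M" "H \<in> borel_measurable M"
    and u: "\<And>x. 0 \<le> u x" and H: "\<And>x. 0 \<le> H x" and le: "AE x in M. u x \<le> F x + H x"
  shows "(\<integral>\<^sup>+x. u x \<partial>M) \<le> (\<integral>\<^sup>+x. H x \<partial>M)"
proof (cases "(\<integral>\<^sup>+x. H x \<partial>M) < \<infinity>")
  case True
  then have iH: "integrable M H" using H by (intro integrableI_nonneg) auto
  have iu: "integrable M u"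
  proof (rule Bochner_Integration.integrable_bound)
    show "integrable M (\<lambda>x. \<bar>F x\<bar> + H x)" using F iH by auto
    show "AE x in M. norm (u x) \<le> norm (\<bar>F x\<bar> + H x)" using le
    proof eventually_elim
      case (elim x) then show ?case using u[of x] H[of x] by simp
    qed
  qed simp
  have "(\<integral>x. u x \<partial>M) \<le> (\<integral>x. F x + H x \<partial>M)" by (rule integral_mono_AE) (use iu F iH le in auto)
  then have "(\<integral>x. u x \<partial>M) \<le> (\<integral>x. H x \<partial>M)" using F iH by simp
  then show ?thesis using u H iu iH by (simp add: nn_integral_eq_integral ennreal_leI)
qed (simp add: not_less top_unique)

lemma ennreal_le_of_power2_le: "x \<le> y" if "x\<^sup>2 \<le> y\<^sup>2" for x y :: ennreal
proof (cases y)
  case (real b)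
  show ?thesis
  proof (cases x)
    case (real a)
    then have "a\<^sup>2 \<le> b\<^sup>2" using that \<open>y = ennreal b\<close> \<open>0 \<le> b\<close> by (simp add: ennreal_power)
    then have "a \<le> b" using \<open>0 \<le> b\<close> by (rule power2_le_imp_le)
    then show ?thesis using real \<open>y = ennreal b\<close> by (simp add: ennreal_leI)
  next
    case top then show ?thesis using that real by (simp add: power2_eq_square ennreal_mult[symmetric] top_unique)
  qed
qed simp

lemma bform_add_right: "bform a x \<nu> (\<eta> + \<eta>') = bform a x \<nu> \<eta> + bform a x \<nu> \<eta>'"
  by (simp add: bform_def algebra_simps sum.distrib)

lemma bform_scaleR_right: "bform a x \<nu> (c *\<^sub>R \<eta>) = c *\<^sub>R bform a x \<nu> \<eta>"
  by (simp add: bform_def scaleR_sum_right)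

lemma measurable_bform[measurable (raw)]:
  assumes a: "coeffs_measurable a" and [measurable]: "p \<in> borel_measurable lebesgue" "q \<in> borel_measurable lebesgue"
  shows "(\<lambda>x. bform a x (p x) (q x)) \<in> borel_measurable lebesgue"
proof -
  have [measurable]: "a \<alpha> \<beta> i j \<in> borel_measurable lebesgue" for \<alpha> \<beta> i j using a by (simp add: coeffs_measurable_def)
  show ?thesis unfolding bform_def by measurable
qed

lemma wnorm_scaleR: "pos_def M \<Longrightarrow> wnorm M (c *\<^sub>R v) = \<bar>c\<bar> * wnorm M v"
  by (simp add: norm_msqrt_vec[symmetric] linear_simps(5)[OF matrix_vector_mul_bounded_linear])

text \<open>The matrix is the tensor product of a cutoff gradient with a vector: the term that
  arises when the derivative falls on the cutoff.\<close>

lemma wnorm_mat_tensor: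
  fixes p :: "'d::finite \<Rightarrow> real" and C :: real
  assumes M: "pos_def M" and p: "\<And>\<beta>. \<bar>p \<beta>\<bar> \<le> C"
  shows "wnorm_mat M (\<chi> j \<beta>. p \<beta> *\<^sub>R v $ j) \<le> CARD('d) * C * wnorm M v"
proof -
  have col: "column \<beta> (\<chi> j \<beta>. p \<beta> *\<^sub>R v $ j) = p \<beta> *\<^sub>R v" for \<beta>
    by (simp add: column_def vec_eq_iff)
  have re: "Re (qform M u) = (wnorm M u)\<^sup>2" for u
    using wnorm_nonneg[OF M, of u] by (simp add: wnorm_def)
  have "wnorm_mat M (\<chi> j \<beta>. p \<beta> *\<^sub>R v $ j) = sqrt (\<Sum>\<beta>\<in>UNIV. (\<bar>p \<beta>\<bar> * wnorm M v)\<^sup>2)"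
    unfolding wnorm_mat_def col re wnorm_scaleR[OF M] ..
  also have "\<dots> = L2_set (\<lambda>\<beta>. \<bar>p \<beta>\<bar> * wnorm M v) UNIV" by (simp add: L2_set_def)
  also have "\<dots> \<le> (\<Sum>\<beta>\<in>UNIV. \<bar>p \<beta>\<bar> * wnorm M v)"
    by (rule L2_set_le_sum) (use wnorm_nonneg[OF M] in auto)
  also have "\<dots> \<le> (\<Sum>\<beta>\<in>(UNIV::'d set). C * wnorm M v)"
    by (intro sum_mono mult_right_mono p wnorm_nonneg M)
  finally show ?thesis by simp
qed

context borel_weight begin

lemma W_lebesgue[measurable]: "W \<in> borel_measurable lebesgue"
  by (rule borel_measurable_lebesgueI) (rule W_measurable)

text \<open>The identity \<eta> G = D\<psi> + \<eta> (G - D\<phi>) - D\<eta> (\<phi> - c) is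
  inserted in the second slot of the form. The equation removes the first term, the second is the
  approximation error, and the third lives on the annulus. The third is kept as a product of the
  gradient and the deviation from c, so nothing has to be absorbed and the first power of \<eta>
  suffices. Squaring avoids roots of extended reals.\<close>

lemma caccioppoli:
  fixes a :: "('d, 'n) coeffs" and G :: "real^'d \<Rightarrow> complex^'d^'n" and \<phi> :: "real^'d \<Rightarrow> complex^'n" and c :: "complex^'n"
    and C r :: real
  assumes \<Omega>: "open \<Omega>" and a: "coeffs_measurable a" and E1: "E1 c1 W \<Omega> a" and E2: "E2 C2 W \<Omega> a"
    and pos: "c1 > 0" "C2 > 0" and G[measurable]: "G \<in> borel_measurable lebesgue" and weak: "weak_solution \<Omega> a G"
    and \<phi>: "smooth_on \<Omega> \<phi>" and r: "r > 0" and P: "mcball x0 (3 * r) \<subseteq> \<Omega>"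
    and C: "C > 0" "\<And>\<beta> x. \<bar>partial \<beta> (bump x0 r) x\<bar> \<le> C / r"
  defines "Z \<equiv> mcball x0 (3 * r) - mball x0 r"
  defines "e \<equiv> \<lambda>S. (\<integral>\<^sup>+x\<in>S. (ennreal (wnorm_mat (W x) (G x)))\<^sup>2 \<partial>lebesgue)"
  defines "\<delta> \<equiv> (\<integral>\<^sup>+x\<in>\<Omega>. (ennreal (wnorm_mat (W x) (G x - Dmat \<phi> x)))\<^sup>2 \<partial>lebesgue)"
  defines "b \<equiv> (\<integral>\<^sup>+x\<in>Z. (ennreal (wnorm (W x) (\<phi> x - c)))\<^sup>2 \<partial>lebesgue)"
  assumes fin: "e \<Omega> < \<infinity>" "\<delta> < \<infinity>" "b < \<infinity>"
  shows "(ennreal (c1 * flat 0 (flat 0 1)) * e (mball x0 r))\<^sup>2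
    \<le> ennreal (2 * C2\<^sup>2) * (e \<Omega> * \<delta> + ennreal ((CARD('d) * C / r)\<^sup>2) * (e Z * b))"
proof -
  define \<eta> where "\<eta> = bump x0 r"
  define \<kappa> where "\<kappa> = CARD('d) * (C / r)"
  have \<kappa>: "\<kappa> \<ge> 0" using C r by (simp add: \<kappa>_def)
  have \<eta>: "0 \<le> \<eta> x" "\<eta> x \<le> 1" for x by (auto simp: \<eta>_def bump_nonneg bump_le_1)
  have sub23: "mcball x0 (2 * r) \<subseteq> mcball x0 (3 * r)"
  proof
    fix x assume x: "x \<in> mcball x0 (2 * r)"
    have "\<bar>x $ i - x0 $ i\<bar> \<le> 3 * r" for i
    proof -
      have "\<bar>x $ i - x0 $ i\<bar> \<le> 2 * r" using x by (simp add: mcball_def)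
      then show ?thesis using r by linarith
    qed
    then show "x \<in> mcball x0 (3 * r)" by (simp add: mcball_def)
  qed
  have \<eta>0: "\<eta> x = 0" if "x \<notin> mcball x0 (2 * r)" for x
    using that r unfolding \<eta>_def mcball_def by (auto simp: not_le intro: bump_outer less_imp_le)
  have d\<eta>0: "partial \<beta> \<eta> x = 0" if "x \<notin> Z" for x \<beta>
  proof (cases "x \<in> mball x0 r")
    case True then show ?thesis unfolding \<eta>_def mball_def by (intro partial_bump_inner r) auto
  next
    case False
    then have "x \<notin> mcball x0 (2 * r)" using that sub23 by (auto simp: Z_def)
    then show ?thesis unfolding \<eta>_def mcball_def using partial_bump_outer[OF r] by (auto simp: not_le)
  qed
  have [measurable]: "\<Omega> \<in> sets lebesgue" using \<Omega> by auto
  have Zb: "Z \<in> sets borel" unfolding Z_def by measurable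
  have [measurable]: "Z \<in> sets lebesgue" using Zb by auto
  have [measurable]: "mball x0 r \<in> sets lebesgue" using mball_sets(1)[of x0 r] by auto
  have Z\<Omega>: "Z \<subseteq> \<Omega>" using P by (auto simp: Z_def)
  \<comment> \<open>Outside \<Omega> the approximant is arbitrary; cutting it off there makes it
    measurable.\<close>
  define D where "D x = (if x \<in> \<Omega> then Dmat \<phi> x else 0)" for x
  define \<phi>c where "\<phi>c x = (if x \<in> \<Omega> then \<phi> x - c else 0)" for x
  have "D \<in> borel_measurable borel"
    unfolding D_def by (rule measurable_restrict_continuous[OF continuous_on_Dmat[OF \<phi>]]) (use \<Omega> in auto)
  then have [measurable]: "D \<in> borel_measurable lebesgue" by (rule borel_measurable_lebesgueI)
  have sm\<phi>c: "smooth_on \<Omega> (\<lambda>x. \<phi> x - c)" by (rule smooth_on_diff_const[OF \<Omega> \<phi>])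
  have "\<phi>c \<in> borel_measurable borel"
    unfolding \<phi>c_def
    by (rule measurable_restrict_continuous[OF differentiable_imp_continuous_on[OF smooth_on_differentiable_on[OF sm\<phi>c]]])
      (use \<Omega> in auto)
  then have [measurable]: "\<phi>c \<in> borel_measurable lebesgue" by (rule borel_measurable_lebesgueI)
  define \<psi> where "\<psi> x = \<eta> x *\<^sub>R (\<phi> x - c)" for x
  have sm\<psi>: "smooth_on UNIV \<psi>"
    unfolding \<psi>_def
  proof (rule smooth_on_cutoff[OF \<Omega> sm\<phi>c])
    show "smooth_on UNIV \<eta>" unfolding \<eta>_def by (rule smooth_bump)
    show "closed (mcball x0 (2 * r))" unfolding mcball_cbox by (rule closed_cbox)
  qed (use sub23 P \<eta>0 in auto)
  have supp: "closure {x. \<psi> x \<noteq> 0} \<subseteq> mcball x0 (2 * r)"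
  proof (rule closure_minimal)
    show "{x. \<psi> x \<noteq> 0} \<subseteq> mcball x0 (2 * r)"
    proof
      fix x assume "x \<in> {x. \<psi> x \<noteq> 0}"
      then have "\<eta> x \<noteq> 0" by (simp add: \<psi>_def)
      then show "x \<in> mcball x0 (2 * r)" using \<eta>0 by blast
    qed
    show "closed (mcball x0 (2 * r))" unfolding mcball_cbox by (rule closed_cbox)
  qed
  have "bounded (mcball x0 (2 * r))" unfolding mcball_cbox by (rule bounded_cbox)
  then have "bounded {x. \<psi> x \<noteq> 0}" by (rule bounded_subset) (rule order_trans[OF closure_subset supp])
  then have "compact (closure {x. \<psi> x \<noteq> 0})" by (simp add: compact_closure)
  then have int0: "(LINT x : \<Omega> | lebesgue. bform a x (G x) (Dmat \<psi> x)) = 0"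
    using weak sm\<psi> supp sub23 P unfolding weak_solution_def by blast
  have "Dmat \<psi> \<in> borel_measurable borel"
    using borel_measurable_continuous_onI[OF continuous_on_Dmat[OF sm\<psi>]] .
  then have [measurable]: "Dmat \<psi> \<in> borel_measurable lebesgue" by (rule borel_measurable_lebesgueI)
  define T where "T x = (\<chi> j \<beta>. partial \<beta> \<eta> x *\<^sub>R \<phi>c x $ j)" for x
  have D\<psi>: "Dmat \<psi> x = \<eta> x *\<^sub>R D x + T x" if x: "x \<in> \<Omega>" for x
  proof -
    have d\<eta>: "\<eta> differentiable_on \<Omega>"
      using smooth_on_differentiable_on[OF smooth_bump] unfolding \<eta>_def by (rule differentiable_on_subset) simp
    have "partial \<beta> \<psi> x = \<eta> x *\<^sub>R partial \<beta> \<phi> x + partial \<beta> \<eta> x *\<^sub>R (\<phi> x - c)" for \<beta>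
    proof -
      have "partial \<beta> (\<lambda>x. \<phi> x - c) x = partial \<beta> \<phi> x"
        using partial_eq[OF has_derivative_diff[OF differentiable_on_openD[OF smooth_on_differentiable_on[OF \<phi>] \<Omega> x] has_derivative_const]]
          partial_frechet[OF smooth_on_differentiable_on[OF \<phi>] \<Omega> x] by simp
      then show ?thesis unfolding \<psi>_def
        using partial_scaleR[OF d\<eta> smooth_on_differentiable_on[OF sm\<phi>c] \<Omega> x] by simp
    qed
    then show ?thesis using x by (simp add: Dmat_def D_def T_def \<phi>c_def vec_eq_iff)
  qed
  define w where "w x = wnorm_mat (W x) (G x)" for x
  define d where "d x = wnorm_mat (W x) (G x - D x)" for x
  define v where "v x = wnorm (W x) (\<phi>c x)" for x
  have nn: "w x \<ge> 0" "d x \<ge> 0" "v x \<ge> 0" for x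
    by (auto simp: w_def d_def v_def wnorm_mat_nonneg wnorm_nonneg W_pos_def)
  have [measurable]: "w \<in> borel_measurable lebesgue" "d \<in> borel_measurable lebesgue" "v \<in> borel_measurable lebesgue"
    unfolding w_def d_def v_def by measurable
  have wT: "wnorm_mat (W x) (T x) \<le> \<kappa> * v x * indicator Z x" for x
  proof (cases "x \<in> Z")
    case True
    then show ?thesis unfolding T_def \<kappa>_def v_def
      using wnorm_mat_tensor[OF W_pos_def, of "\<lambda>\<beta>. partial \<beta> \<eta> x" "C / r" x "\<phi>c x"] C(2) by (simp add: \<eta>_def)
  next
    case False
    then have "T x = 0" by (simp add: T_def d\<eta>0 vec_eq_iff)
    then show ?thesis using False wnorm_mat_scale[OF W_pos_def, of x 0 "T x"] by simp
  qed
  define F where "F x = indicator \<Omega> x *\<^sub>R bform a x (G x) (Dmat \<psi> x)" for x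
  have Fm[measurable]: "F \<in> borel_measurable lebesgue"
    unfolding F_def using measurable_bform[OF a, of G "Dmat \<psi>"] by measurable
  \<comment> \<open>H collects the two error terms. It appears in the lower bound \<open>key\<close>
    and, together with C2 w^2 on \<Omega>, in the majorant that makes F integrable.\<close>
  define H where "H x = C2 * (w x * d x * indicator \<Omega> x) + C2 * \<kappa> * (w x * v x * indicator Z x)" for x
  have Hm[measurable]: "H \<in> borel_measurable lebesgue" unfolding H_def by measurable
  have H0: "H x \<ge> 0" for x unfolding H_def using nn \<kappa> pos by (intro add_nonneg_nonneg mult_nonneg_nonneg) auto
  have E2': "AE x in lebesgue. x \<in> \<Omega> \<longrightarrow> (\<forall>\<eta> \<nu>. norm (bform a x \<nu> \<eta>) \<le> C2 * wnorm_mat (W x) \<eta> * wnorm_mat (W x) \<nu>)"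
    using E2 unfolding E2_def norm_msqrt_mat[OF W_pos_def] .
  have E1': "AE x in lebesgue. x \<in> \<Omega> \<longrightarrow> (\<forall>\<eta>. Re (bform a x \<eta> \<eta>) \<ge> c1 * (wnorm_mat (W x) \<eta>)\<^sup>2)"
    using E1 unfolding E1_def norm_msqrt_mat[OF W_pos_def] .
  have Fbound: "AE x in lebesgue. norm (F x) \<le> C2 * ((w x)\<^sup>2 * indicator \<Omega> x) + H x"
    using E2'
  proof eventually_elim
    case (elim x)
    show ?case
    proof (cases "x \<in> \<Omega>")
      case True
      have "wnorm_mat (W x) (Dmat \<psi> x) \<le> wnorm_mat (W x) (\<eta> x *\<^sub>R D x) + wnorm_mat (W x) (T x)"
        unfolding D\<psi>[OF True] by (rule wnorm_mat_triangle[OF W_pos_def])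
      also have "wnorm_mat (W x) (\<eta> x *\<^sub>R D x) \<le> wnorm_mat (W x) (D x)"
        using \<eta>[of x] mult_right_mono[of "\<eta> x" 1 "wnorm_mat (W x) (D x)"] wnorm_mat_nonneg[OF W_pos_def, of x "D x"]
        by (simp add: wnorm_mat_scale[OF W_pos_def])
      also have "wnorm_mat (W x) (D x) \<le> w x + d x"
      proof -
        have "wnorm_mat (W x) (G x + (-1) *\<^sub>R (G x - D x)) \<le> wnorm_mat (W x) (G x) + wnorm_mat (W x) ((-1) *\<^sub>R (G x - D x))"
          by (rule wnorm_mat_triangle[OF W_pos_def])
        then show ?thesis by (simp only: wnorm_mat_scale[OF W_pos_def]) (simp add: w_def d_def)
      qed
      finally have "wnorm_mat (W x) (Dmat \<psi> x) \<le> w x + d x + \<kappa> * v x * indicator Z x" using wT[of x] by linarith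
      then have "C2 * wnorm_mat (W x) (Dmat \<psi> x) * w x \<le> C2 * (w x + d x + \<kappa> * v x * indicator Z x) * w x"
        using pos nn by (intro mult_right_mono mult_left_mono) auto
      moreover have "norm (F x) \<le> C2 * wnorm_mat (W x) (Dmat \<psi> x) * w x"
        using elim True by (simp add: F_def w_def)
      ultimately show ?thesis using True by (simp add: H_def algebra_simps power2_eq_square)
    qed (use H0 in \<open>simp add: F_def\<close>)
  qed
  have key: "AE x in lebesgue. c1 * \<eta> x * (w x)\<^sup>2 * indicator \<Omega> x \<le> Re (F x) + H x"
    using E1' E2'
  proof eventually_elim
    case (elim x)
    show ?case
    proof (cases "x \<in> \<Omega>")
      case True
      have dec: "\<eta> x *\<^sub>R G x = Dmat \<psi> x + (\<eta> x *\<^sub>R (G x - D x) + (-1) *\<^sub>R T x)"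
        unfolding D\<psi>[OF True] by (simp add: scaleR_diff_right)
      have "c1 * \<eta> x * (w x)\<^sup>2 = \<eta> x * (c1 * (w x)\<^sup>2)" by simp
      also have "\<dots> \<le> \<eta> x * Re (bform a x (G x) (G x))"
        using elim(1) True \<eta> by (intro mult_left_mono) (auto simp: w_def)
      also have "\<dots> = Re (bform a x (G x) (\<eta> x *\<^sub>R G x))" by (simp add: bform_scaleR_right)
      also have "\<dots> = Re (bform a x (G x) (Dmat \<psi> x)) + \<eta> x * Re (bform a x (G x) (G x - D x)) - Re (bform a x (G x) (T x))"
        unfolding dec bform_add_right bform_scaleR_right by simp
      also have "\<dots> \<le> Re (F x) + \<eta> x * (C2 * d x * w x) + C2 * (\<kappa> * v x * indicator Z x) * w x"
      proof -
        have b1: "norm (bform a x (G x) (G x - D x)) \<le> C2 * d x * w x"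
          using elim(2) True by (simp add: d_def w_def)
        have b2: "norm (bform a x (G x) (T x)) \<le> C2 * wnorm_mat (W x) (T x) * w x"
          using elim(2) True by (simp add: w_def)
        also have "\<dots> \<le> C2 * (\<kappa> * v x * indicator Z x) * w x"
          using pos nn wT[of x] by (intro mult_right_mono mult_left_mono) auto
        finally have "- Re (bform a x (G x) (T x)) \<le> C2 * (\<kappa> * v x * indicator Z x) * w x"
          using abs_Re_le_cmod[of "bform a x (G x) (T x)"] by linarith
        moreover have "\<eta> x * Re (bform a x (G x) (G x - D x)) \<le> \<eta> x * (C2 * d x * w x)"
          using \<eta>(1)[of x] b1 abs_Re_le_cmod[of "bform a x (G x) (G x - D x)"] by (intro mult_left_mono) auto
        ultimately show ?thesis using True by (simp add: F_def)
      qed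
      also have "\<eta> x * (C2 * d x * w x) \<le> 1 * (C2 * d x * w x)"
        using \<eta>[of x] pos nn by (intro mult_right_mono) auto
      finally show ?thesis using True by (simp add: H_def algebra_simps)
    qed (use H0 in \<open>simp add: F_def\<close>)
  qed
  define I1 where "I1 = (\<integral>\<^sup>+x\<in>\<Omega>. ennreal (w x) * ennreal (d x) \<partial>lebesgue)"
  define I2 where "I2 = (\<integral>\<^sup>+x\<in>Z. ennreal (w x) * ennreal (v x) \<partial>lebesgue)"
  have d\<delta>: "(\<integral>\<^sup>+x\<in>\<Omega>. (ennreal (d x))\<^sup>2 \<partial>lebesgue) = \<delta>"
    unfolding \<delta>_def by (intro nn_integral_cong) (simp add: d_def D_def indicator_def)
  have vb: "(\<integral>\<^sup>+x\<in>Z. (ennreal (v x))\<^sup>2 \<partial>lebesgue) = b"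
    unfolding b_def using Z\<Omega> by (intro nn_integral_cong) (auto simp: v_def \<phi>c_def indicator_def)
  have I1: "I1\<^sup>2 \<le> e \<Omega> * \<delta>"
    unfolding I1_def e_def d\<delta>[symmetric] w_def[symmetric] by (rule Cauchy_Schwarz_set_nn_integral) measurable
  have I2: "I2\<^sup>2 \<le> e Z * b"
    unfolding I2_def e_def vb[symmetric] w_def[symmetric] by (rule Cauchy_Schwarz_set_nn_integral) measurable
  have eZ: "e Z \<le> e \<Omega>"
    unfolding e_def using Z\<Omega> by (intro nn_integral_mono) (auto simp: indicator_def)
  have fin1: "I1 < \<infinity>" "I2 < \<infinity>"
  proof -
    have "I1\<^sup>2 < \<infinity>" using I1 fin by (metis ennreal_mult_less_top infinity_ennreal_def order_le_less_trans)
    then show "I1 < \<infinity>" by (simp add: power_less_top_ennreal)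
    have "I2\<^sup>2 < \<infinity>" using I2 fin eZ by (metis ennreal_mult_less_top infinity_ennreal_def order_le_less_trans)
    then show "I2 < \<infinity>" by (simp add: power_less_top_ennreal)
  qed
  have HI: "(\<integral>\<^sup>+x. H x \<partial>lebesgue) = ennreal C2 * (I1 + ennreal \<kappa> * I2)"
  proof -
    have "(\<integral>\<^sup>+x. H x \<partial>lebesgue) = (\<integral>\<^sup>+x. ennreal C2 * (ennreal (w x) * ennreal (d x) * indicator \<Omega> x)
        + ennreal C2 * ennreal \<kappa> * (ennreal (w x) * ennreal (v x) * indicator Z x) \<partial>lebesgue)"
      using nn \<kappa> pos by (intro nn_integral_cong) (simp add: H_def ennreal_mult indicator_def)
    also have "\<dots> = ennreal C2 * I1 + ennreal C2 * ennreal \<kappa> * I2"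
      unfolding I1_def I2_def by (subst nn_integral_add) (simp_all add: nn_integral_cmult)
    finally show ?thesis by (simp add: distrib_left mult.assoc)
  qed
  \<comment> \<open>The integral of a function that is not integrable is 0 by convention, so
    \<open>int0\<close> carries information only once integrability is known.\<close>
  have "integrable lebesgue F"
  proof (rule integrableI_bounded)
    have "(\<integral>\<^sup>+x. ennreal (norm (F x)) \<partial>lebesgue) \<le> (\<integral>\<^sup>+x. ennreal C2 * ((ennreal (w x))\<^sup>2 * indicator \<Omega> x) + ennreal (H x) \<partial>lebesgue)"
    proof (rule nn_integral_mono_AE, use Fbound in eventually_elim)
      case (elim x)
      have "ennreal (norm (F x)) \<le> ennreal (C2 * ((w x)\<^sup>2 * indicator \<Omega> x) + H x)" by (rule ennreal_leI[OF elim])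
      also have "\<dots> = ennreal C2 * ((ennreal (w x))\<^sup>2 * indicator \<Omega> x) + ennreal (H x)"
        using pos H0[of x] nn by (simp add: ennreal_plus ennreal_mult ennreal_power indicator_def)
      finally show ?case .
    qed
    also have "\<dots> = ennreal C2 * e \<Omega> + ennreal C2 * (I1 + ennreal \<kappa> * I2)"
      unfolding HI[symmetric] e_def w_def[symmetric] by (subst nn_integral_add) (simp_all add: nn_integral_cmult)
    also have "\<dots> < \<infinity>" using fin fin1 by (simp add: ennreal_mult_less_top)
    finally show "(\<integral>\<^sup>+x. ennreal (norm (F x)) \<partial>lebesgue) < \<infinity>" .
  qed simp
  then have "integrable lebesgue (\<lambda>x. Re (F x))" "(\<integral>x. Re (F x) \<partial>lebesgue) = 0"
    using int0 unfolding set_lebesgue_integral_def F_def[symmetric] by auto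
  then have "(\<integral>\<^sup>+x. ennreal (c1 * \<eta> x * (w x)\<^sup>2 * indicator \<Omega> x) \<partial>lebesgue) \<le> (\<integral>\<^sup>+x. H x \<partial>lebesgue)"
  proof (rule nn_integral_le_of_integral_zero[OF _ _ _ Hm _ H0 key])
    have "\<eta> \<in> borel_measurable borel"
      unfolding \<eta>_def by (intro borel_measurable_continuous_onI differentiable_imp_continuous_on smooth_on_differentiable_on smooth_bump)
    then have [measurable]: "\<eta> \<in> borel_measurable lebesgue" by (rule borel_measurable_lebesgueI)
    show "(\<lambda>x. c1 * \<eta> x * (w x)\<^sup>2 * indicator \<Omega> x) \<in> borel_measurable lebesgue" by measurable
    show "0 \<le> c1 * \<eta> x * (w x)\<^sup>2 * indicator \<Omega> x" for x using pos \<eta> by simp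
  qed
  moreover have "ennreal (c1 * flat 0 (flat 0 1)) * e (mball x0 r) \<le> (\<integral>\<^sup>+x. ennreal (c1 * \<eta> x * (w x)\<^sup>2 * indicator \<Omega> x) \<partial>lebesgue)"
  proof -
    have "ennreal (c1 * flat 0 (flat 0 1)) * e (mball x0 r)
       = (\<integral>\<^sup>+x. ennreal (c1 * flat 0 (flat 0 1)) * ((ennreal (w x))\<^sup>2 * indicator (mball x0 r) x) \<partial>lebesgue)"
      unfolding e_def w_def[symmetric] by (subst nn_integral_cmult) auto
    also have "\<dots> \<le> (\<integral>\<^sup>+x. ennreal (c1 * \<eta> x * (w x)\<^sup>2 * indicator \<Omega> x) \<partial>lebesgue)"
    proof (rule nn_integral_mono)
      fix x
      show "ennreal (c1 * flat 0 (flat 0 1)) * ((ennreal (w x))\<^sup>2 * indicator (mball x0 r) x)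
        \<le> ennreal (c1 * \<eta> x * (w x)\<^sup>2 * indicator \<Omega> x)"
      proof (cases "x \<in> mball x0 r")
        case True
        then have "\<eta> x = flat 0 (flat 0 1)" unfolding \<eta>_def mball_def by (intro bump_inner r less_imp_le) auto
        moreover have "x \<in> \<Omega>"
        proof -
          have "\<bar>x $ i - x0 $ i\<bar> \<le> 3 * r" for i
          proof -
            have "\<bar>x $ i - x0 $ i\<bar> < r" using True by (simp add: mball_def)
            then show ?thesis using r by linarith
          qed
          then show ?thesis using P by (auto simp: mcball_def)
        qed
        ultimately show ?thesis using True pos nn flat_0_nonneg by (simp add: ennreal_mult ennreal_power)
      qed simp
    qed
    finally show ?thesis .
  qed
  ultimately have "ennreal (c1 * flat 0 (flat 0 1)) * e (mball x0 r) \<le> ennreal C2 * (I1 + ennreal \<kappa> * I2)"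
    unfolding HI by (rule order_trans[rotated])
  then have "(ennreal (c1 * flat 0 (flat 0 1)) * e (mball x0 r))\<^sup>2 \<le> (ennreal C2 * (I1 + ennreal \<kappa> * I2))\<^sup>2"
    by (rule power_mono) simp
  also have "\<dots> = ennreal (C2\<^sup>2) * (I1 + ennreal \<kappa> * I2)\<^sup>2"
    using pos by (simp add: power_mult_distrib ennreal_power)
  also have "\<dots> \<le> ennreal (C2\<^sup>2) * (2 * I1\<^sup>2 + 2 * (ennreal \<kappa> * I2)\<^sup>2)"
    by (intro mult_left_mono power2_sum_le_ennreal) simp
  also have "\<dots> = ennreal (2 * C2\<^sup>2) * (I1\<^sup>2 + ennreal (\<kappa>\<^sup>2) * I2\<^sup>2)"
    using \<kappa> by (simp add: power_mult_distrib ennreal_power ennreal_mult distrib_left ac_simps)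
  also have "\<dots> \<le> ennreal (2 * C2\<^sup>2) * (e \<Omega> * \<delta> + ennreal (\<kappa>\<^sup>2) * (e Z * b))"
    by (intro mult_left_mono add_mono I1 I2) auto
  finally show ?thesis by (simp add: \<kappa>_def)
qed

end

section \<open>Filling the hole and Borel representatives of weights\<close>

context borel_weight begin

text \<open>The energy estimate and the annulus inequality hold for each approximant, and then k
  tends to infinity. The constant c changes with k, but the coefficients of its bound do not. In the
  limit the squared bound is a multiple of (e Z)^2, so a root leaves the energy to first
  power.\<close>

lemma hole_filling:
  fixes a :: "('d, 'n) coeffs" and G :: "real^'d \<Rightarrow> complex^'d^'n" and \<phi> :: "nat \<Rightarrow> real^'d \<Rightarrow> complex^'n"
    and C r :: real
  assumes d2: "CARD('d) \<ge> 2" and \<Omega>: "open \<Omega>" and a: "coeffs_measurable a"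
    and E1: "E1 c1 W \<Omega> a" and E2: "E2 C2 W \<Omega> a"
    and pos: "c1 > 0" "C2 > 0" and G[measurable]: "G \<in> borel_measurable lebesgue" and weak: "weak_solution \<Omega> a G"
    and \<phi>: "\<And>k. smooth_on \<Omega> (\<phi> k)" and r: "r > 0" and P: "mcball x0 (3 * r) \<subseteq> \<Omega>"
    and C: "C > 0" "\<And>\<beta> x. \<bar>partial \<beta> (bump x0 r) x\<bar> \<le> C / r"
  defines "Z \<equiv> mcball x0 (3 * r) - mball x0 r"
  defines "e \<equiv> \<lambda>S. (\<integral>\<^sup>+x\<in>S. (ennreal (wnorm_mat (W x) (G x)))\<^sup>2 \<partial>lebesgue)"
  assumes fin: "e \<Omega> < \<infinity>"
    and lim: "(\<lambda>k. (\<integral>\<^sup>+x\<in>\<Omega>. (ennreal (wnorm_mat (W x) (G x - Dmat (\<phi> k) x)))\<^sup>2 \<partial>lebesgue)) \<longlonglongrightarrow> 0"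
  shows "ennreal (c1 * flat 0 (flat 0 1)) * e (mball x0 r)
    \<le> ennreal (2 * C2 * CARD('d) * C * sqrt (648 * 10^6 * real CARD('d) ^ 3 * 27 ^ CARD('d)) * A\<^sup>2) * e Z"
proof -
  define \<delta> where "\<delta> k = (\<integral>\<^sup>+x\<in>\<Omega>. (ennreal (wnorm_mat (W x) (G x - Dmat (\<phi> k) x)))\<^sup>2 \<partial>lebesgue)" for k
  define p where "p = 648 * 10^6 * real CARD('d) ^ 3 * 27 ^ CARD('d)"
  have p: "p > 0" by (simp add: p_def)
  define q where "q = p * A ^ 3 * r\<^sup>2"
  have q: "q \<ge> 0" using p A_nonneg by (simp add: q_def)
  define \<kappa> where "\<kappa> = CARD('d) * C / r"
  have "Z \<in> sets borel" unfolding Z_def by measurable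
  then have [measurable]: "Z \<in> sets lebesgue" by auto
  have Z\<Omega>: "Z \<subseteq> \<Omega>" using P by (auto simp: Z_def)
  have eZ: "e Z < \<infinity>"
  proof -
    have "e Z \<le> e \<Omega>" unfolding e_def using Z\<Omega> by (intro nn_integral_mono) (auto simp: indicator_def)
    then show ?thesis using fin by (rule order_le_less_trans)
  qed
  let ?X = "ennreal (c1 * flat 0 (flat 0 1)) * e (mball x0 r)"
  \<comment> \<open>The bound for approximant k is sorted into a part linear in the error \<delta> k
    and a part independent of k.\<close>
  define \<alpha> where "\<alpha> = ennreal (2 * C2\<^sup>2) * (e \<Omega> + ennreal (\<kappa>\<^sup>2) * (e Z * (ennreal q * 2)))"
  define \<beta> where "\<beta> = ennreal (2 * C2\<^sup>2) * (ennreal (\<kappa>\<^sup>2) * (e Z * (ennreal q * (2 * e Z))))"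
  have step: "?X\<^sup>2 \<le> \<alpha> * \<delta> k + \<beta>" if fink: "\<delta> k < \<infinity>" for k
  proof -
    define D where "D x = (if x \<in> Z then Dmat (\<phi> k) x else 0)" for x
    have "D \<in> borel_measurable borel"
      unfolding D_def by (rule measurable_restrict_continuous[OF continuous_on_Dmat[OF \<phi>] Z\<Omega>]) fact
    then have [measurable]: "D \<in> borel_measurable lebesgue" by (rule borel_measurable_lebesgueI)
    have Dle: "(\<integral>\<^sup>+x\<in>Z. ennreal (wnorm_mat (W x) (Dmat (\<phi> k) x))^2 \<partial>lebesgue) \<le> 2 * e Z + 2 * \<delta> k"
    proof -
      have "(\<integral>\<^sup>+x\<in>Z. ennreal (wnorm_mat (W x) (Dmat (\<phi> k) x))^2 \<partial>lebesgue)
         \<le> (\<integral>\<^sup>+x. 2 * (ennreal (wnorm_mat (W x) (G x))^2 * indicator Z x) + 2 * (ennreal (wnorm_mat (W x) (G x - D x))^2 * indicator Z x) \<partial>lebesgue)"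
      proof (rule nn_integral_mono)
        fix x
        show "ennreal (wnorm_mat (W x) (Dmat (\<phi> k) x))^2 * indicator Z x
          \<le> 2 * (ennreal (wnorm_mat (W x) (G x))^2 * indicator Z x) + 2 * (ennreal (wnorm_mat (W x) (G x - D x))^2 * indicator Z x)"
        proof (cases "x \<in> Z")
          case True
          have "wnorm_mat (W x) (G x + (-1) *\<^sub>R (G x - D x)) \<le> wnorm_mat (W x) (G x) + wnorm_mat (W x) ((-1) *\<^sub>R (G x - D x))"
            by (rule wnorm_mat_triangle[OF W_pos_def])
          then have "wnorm_mat (W x) (Dmat (\<phi> k) x) \<le> wnorm_mat (W x) (G x) + wnorm_mat (W x) (G x - D x)"
            using True by (simp only: wnorm_mat_scale[OF W_pos_def]) (simp add: D_def)
          then have "ennreal (wnorm_mat (W x) (Dmat (\<phi> k) x)) \<le> ennreal (wnorm_mat (W x) (G x)) + ennreal (wnorm_mat (W x) (G x - D x))"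
            using wnorm_mat_nonneg[OF W_pos_def, of x "G x"] wnorm_mat_nonneg[OF W_pos_def, of x "G x - D x"]
            by (simp add: ennreal_leI flip: ennreal_plus)
          then have "(ennreal (wnorm_mat (W x) (Dmat (\<phi> k) x)))\<^sup>2 \<le> (ennreal (wnorm_mat (W x) (G x)) + ennreal (wnorm_mat (W x) (G x - D x)))\<^sup>2"
            by (rule power_mono) simp
          also note power2_sum_le_ennreal
          finally show ?thesis using True by simp
        qed simp
      qed
      also have "\<dots> = 2 * e Z + 2 * (\<integral>\<^sup>+x\<in>Z. ennreal (wnorm_mat (W x) (G x - D x))^2 \<partial>lebesgue)"
        unfolding e_def by (subst nn_integral_add) (simp_all add: nn_integral_cmult)
      also have "(\<integral>\<^sup>+x\<in>Z. ennreal (wnorm_mat (W x) (G x - D x))^2 \<partial>lebesgue) \<le> \<delta> k"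
        unfolding \<delta>_def using Z\<Omega> by (intro nn_integral_mono) (auto simp: D_def indicator_def)
      finally show ?thesis by (simp add: mult_left_mono add_left_mono)
    qed
    obtain c where c: "(\<integral>\<^sup>+x\<in>Z. ennreal (wnorm (W x) (\<phi> k x - c))^2 \<partial>lborel)
        \<le> ennreal q * (\<integral>\<^sup>+x\<in>Z. ennreal (wnorm_mat (W x) (Dmat (\<phi> k) x))^2 \<partial>lborel)"
      using poincare_annulus[OF d2 \<Omega> \<phi> r P] unfolding Z_def q_def p_def by blast
    define b where "b = (\<integral>\<^sup>+x\<in>Z. (ennreal (wnorm (W x) (\<phi> k x - c)))\<^sup>2 \<partial>lebesgue)"
    have b: "b \<le> ennreal q * (2 * e Z + 2 * \<delta> k)"
      using c Dle unfolding b_def nn_integral_completion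
      by (meson mult_left_mono order_trans zero_le)
    have "ennreal q * (2 * e Z + 2 * \<delta> k) < \<infinity>" using eZ fink by (simp add: ennreal_mult_less_top)
    then have finb: "b < \<infinity>" using b by (rule order_le_less_trans[rotated])
    have "?X\<^sup>2 \<le> ennreal (2 * C2\<^sup>2) * (e \<Omega> * \<delta> k + ennreal ((CARD('d) * C / r)\<^sup>2) * (e Z * b))"
      using caccioppoli[OF \<Omega> a E1 E2 pos G weak \<phi> r P C fin[unfolded e_def] fink[unfolded \<delta>_def] finb[unfolded b_def Z_def]]
      unfolding e_def \<delta>_def b_def Z_def .
    also have "\<dots> \<le> ennreal (2 * C2\<^sup>2) * (e \<Omega> * \<delta> k + ennreal (\<kappa>\<^sup>2) * (e Z * (ennreal q * (2 * e Z + 2 * \<delta> k))))"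
      unfolding \<kappa>_def by (intro mult_left_mono add_left_mono b) auto
    also have "\<dots> = \<alpha> * \<delta> k + \<beta>"
      unfolding \<alpha>_def \<beta>_def by (simp add: distrib_left distrib_right ac_simps)
    finally show ?thesis .
  qed
  \<comment> \<open>Finiteness matters: in the extended reals an infinite factor times \<delta> k
    need not tend to 0.\<close>
  have "\<alpha> < \<infinity>" unfolding \<alpha>_def using fin eZ by (simp add: ennreal_mult_less_top)
  then have "(\<lambda>k. \<alpha> * \<delta> k + \<beta>) \<longlonglongrightarrow> \<alpha> * 0 + \<beta>"
    using lim unfolding \<delta>_def[symmetric] by (intro tendsto_add ennreal_tendsto_cmult tendsto_const) auto
  moreover have "\<forall>\<^sub>F k in sequentially. \<delta> k < 1"
    using lim unfolding \<delta>_def[symmetric] by (rule order_tendstoD) simp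
  then have "\<forall>\<^sub>F k in sequentially. ?X\<^sup>2 \<le> \<alpha> * \<delta> k + \<beta>"
  proof eventually_elim
    case (elim k)
    then have "\<delta> k < \<infinity>" using order_less_trans[OF elim, of \<infinity>] by simp
    then show ?case by (rule step)
  qed
  ultimately have "?X\<^sup>2 \<le> \<beta>"
    by (intro tendsto_lowerbound[of "\<lambda>k. \<alpha> * \<delta> k + \<beta>" _ sequentially]) auto
  \<comment> \<open>The radius cancels: the square of \<kappa> is of order r^(-2) and q of order
    r^2.\<close>
  also have "\<beta> = (ennreal (2 * C2 * CARD('d) * C * sqrt p * sqrt (A ^ 3)) * e Z)\<^sup>2"
  proof -
    have "(ennreal (2 * C2 * CARD('d) * C * sqrt p * sqrt (A ^ 3)) * e Z)\<^sup>2
       = ennreal ((2 * C2 * CARD('d) * C * sqrt p * sqrt (A ^ 3))\<^sup>2) * (e Z)\<^sup>2"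
      using pos C p A_nonneg by (simp add: power_mult_distrib ennreal_power)
    also have "(2 * C2 * CARD('d) * C * sqrt p * sqrt (A ^ 3))\<^sup>2 = 2 * C2\<^sup>2 * (\<kappa>\<^sup>2 * (q * 2))"
      using r p A_nonneg by (simp add: power_mult_distrib \<kappa>_def q_def power_divide)
    also have "ennreal (2 * C2\<^sup>2 * (\<kappa>\<^sup>2 * (q * 2))) = ennreal (2 * C2\<^sup>2) * (ennreal (\<kappa>\<^sup>2) * (ennreal q * ennreal 2))"
    proof -
      have "ennreal (x * (y * (z * 2))) = ennreal x * (ennreal y * (ennreal z * ennreal 2))" if "x \<ge> 0" "y \<ge> 0" "z \<ge> 0" for x y z
        using that by (simp add: ennreal_mult)
      from this[of "2 * C2\<^sup>2" "\<kappa>\<^sup>2" q] show ?thesis using q by simp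
    qed
    also have "\<dots> * (e Z)\<^sup>2 = \<beta>" unfolding \<beta>_def by (simp add: power2_eq_square ac_simps)
    finally show ?thesis by simp
  qed
  finally have "?X \<le> ennreal (2 * C2 * CARD('d) * C * sqrt p * sqrt (A ^ 3)) * e Z" by (rule ennreal_le_of_power2_le)
  also have "\<dots> \<le> ennreal (2 * C2 * CARD('d) * C * sqrt p * A\<^sup>2) * e Z"
  proof (intro mult_right_mono ennreal_leI mult_left_mono)
    \<comment> \<open>The square root of A^3 is rounded up to A^2, which is possible since A \<ge>
      1.\<close>
    have "A ^ 3 \<le> A ^ 4" using A_ge_1 by (intro power_increasing) auto
    then have "A ^ 3 \<le> (A\<^sup>2)\<^sup>2" by (simp flip: power_mult)
    then show "sqrt (A ^ 3) \<le> A\<^sup>2" using A_nonneg by (intro real_le_lsqrt) auto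
  qed (use pos C p in auto)
  finally show ?thesis unfolding p_def .
qed

end

section \<open>Replacing a weight by a Borel one\<close>

lemma measurable_vec_components:
  fixes f :: "'b \<Rightarrow> ('a::euclidean_space)^'n"
  assumes "\<And>i. (\<lambda>x. f x $ i) \<in> borel_measurable M"
  shows "f \<in> borel_measurable M"
  unfolding borel_measurable_euclidean_space[of f]
proof
  fix b :: "'a^'n" assume "b \<in> Basis"
  then obtain i u where b: "b = axis i u" by (auto simp: Basis_vec_def)
  have "(\<lambda>x. f x $ i \<bullet> u) \<in> borel_measurable M" using assms[of i] by measurable
  then show "(\<lambda>x. f x \<bullet> b) \<in> borel_measurable M" by (simp add: b inner_axis)
qed

lemma pos_def_mat_1: "pos_def (mat 1 :: complex^'n^'n)"
proof -
  have "hermitian (mat 1 :: complex^'n^'n)" by (simp add: hermitian_def mat_def)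
  then show ?thesis unfolding pos_def_def Re_qform by simp
qed

text \<open>Local integrability makes truncations to balls measurable, hence the entries as their
  limits. Each entry agrees almost everywhere with a Borel function; on one Borel null set
  containing all exceptions the value is reset to the identity, which restores positive definiteness
  everywhere.\<close>

lemma matrix_weight_borel_version:
  fixes W :: "real^'d \<Rightarrow> complex^'n^'n"
  assumes "matrix_weight W"
  obtains V where "V \<in> borel_measurable borel" "\<And>x. pos_def (V x)" "AE x in lebesgue. W x = V x"
proof -
  have meas: "(\<lambda>x. W x $ i $ j) \<in> borel_measurable lebesgue" for i j
  proof (rule borel_measurable_LIMSEQ_metric)
    fix k :: nat
    have "set_integrable lebesgue (cball 0 (real k)) (\<lambda>x. W x $ i $ j)"
      using assms by (auto simp: matrix_weight_def loc_integrable_matrix_def)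
    then show "(\<lambda>x. indicator (cball 0 (real k)) x *\<^sub>R W x $ i $ j) \<in> borel_measurable lebesgue"
      unfolding set_integrable_def by (rule borel_measurable_integrable)
  next
    fix x :: "real^'d"
    have "\<forall>\<^sub>F k in sequentially. indicator (cball 0 (real k)) x *\<^sub>R W x $ i $ j = W x $ i $ j"
      using eventually_ge_at_top[of "nat \<lceil>norm x\<rceil>"]
    proof eventually_elim
      case (elim k)
      then have "norm x \<le> real k" by linarith
      then show ?case by simp
    qed
    then show "(\<lambda>k. indicator (cball 0 (real k)) x *\<^sub>R W x $ i $ j) \<longlonglongrightarrow> W x $ i $ j"
      by (rule tendsto_eventually)
  qed
  have "\<exists>g. g \<in> borel_measurable borel \<and> (AE x in lborel. W x $ i $ j = g x)" for i j
  proof -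
    have re: "(\<lambda>x. Re (W x $ i $ j)) \<in> borel_measurable lebesgue" "(\<lambda>x. Im (W x $ i $ j)) \<in> borel_measurable lebesgue"
      using meas[of i j] by measurable
    obtain g1 where g1: "g1 \<in> borel_measurable lborel" "AE x in lborel. Re (W x $ i $ j) = g1 x"
      using completion_ex_borel_measurable_real[OF re(1)] by blast
    obtain g2 where g2: "g2 \<in> borel_measurable lborel" "AE x in lborel. Im (W x $ i $ j) = g2 x"
      using completion_ex_borel_measurable_real[OF re(2)] by blast
    have "AE x in lborel. W x $ i $ j = of_real (g1 x) + \<i> * of_real (g2 x)"
      using g1(2) g2(2) by eventually_elim (simp add: complex_eq_iff)
    moreover have "(\<lambda>x. of_real (g1 x) + \<i> * of_real (g2 x) :: complex) \<in> borel_measurable lborel"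
      using g1(1) g2(1) by measurable
    then have "(\<lambda>x. of_real (g1 x) + \<i> * of_real (g2 x) :: complex) \<in> borel_measurable borel" by simp
    ultimately show ?thesis by blast
  qed
  then have "\<forall>i. \<exists>g. \<forall>j. g j \<in> borel_measurable borel \<and> (AE x in lborel. W x $ i $ j = g j x)"
    by (intro allI choice) blast
  from choice[OF this] obtain g where g: "\<And>i j. g i j \<in> borel_measurable borel" "\<And>i j. AE x in lborel. W x $ i $ j = g i j x"
    by blast
  define V0 where "V0 x = (\<chi> i j. g i j x)" for x
  have V0[measurable]: "V0 \<in> borel_measurable borel"
    by (intro measurable_vec_components) (simp add: V0_def g)
  have "AE x in lborel. \<forall>i\<in>UNIV. \<forall>j\<in>UNIV. W x $ i $ j = g i j x"
    using g(2) by (intro AE_finite_allI) auto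
  moreover have "AE x in lborel. pos_def (W x)"
    using assms by (simp add: matrix_weight_def AE_completion_iff)
  ultimately have "AE x in lborel. W x = V0 x \<and> pos_def (W x)"
    by eventually_elim (simp add: V0_def vec_eq_iff)
  then obtain N where N: "\<And>x. x \<in> space lborel - N \<Longrightarrow> W x = V0 x \<and> pos_def (W x)" "N \<in> null_sets lborel"
    by (rule AE_E3) blast
  define V where "V x = (if x \<in> N then mat 1 else V0 x)" for x
  have [measurable]: "N \<in> sets borel" using N(2) by auto
  show ?thesis
  proof (rule that)
    show "V \<in> borel_measurable borel" unfolding V_def by measurable
    show "pos_def (V x)" for x
    proof (cases "x \<in> N")
      case False
      have "W x = V0 x \<and> pos_def (W x)" by (rule N(1)) (use False in simp)
      then show ?thesis using False unfolding V_def by (metis (full_types))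
    qed (simp add: V_def pos_def_mat_1)
    have "AE x in lborel. W x = V x"
      using AE_not_in[OF N(2)] by eventually_elim (use N(1) in \<open>auto simp: V_def\<close>)
    then show "AE x in lebesgue. W x = V x" by (simp add: AE_completion_iff)
  qed
qed

lemma ennreal_divide_divide_le:
  fixes J v a :: ennreal
  assumes "J / v / v \<le> a" "v \<noteq> 0" "v \<noteq> top"
  shows "J \<le> a * v * v"
proof -
  have c: "x / v * v = x" for x
    using mult_divide_eq_ennreal[OF assms(2,3), of x] by (metis ennreal_times_divide mult.commute)
  have "J / v / v * v * v \<le> a * v * v" by (intro mult_right_mono assms) auto
  then show ?thesis by (simp add: c)
qed

text \<open>For almost every x and then almost every y the values of W and V agree, and there
  \<open>relnorm\<close> is bounded by the operator norm. The operator norm enters through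
  monotonicity of \<open>nn_integral\<close> only, which holds for nonmeasurable integrands
  too.\<close>

lemma A2_weight_borel_version:
  fixes W :: "real^'d \<Rightarrow> complex^'n^'n"
  assumes "A2_weight W"
  obtains V where "borel_weight V (enn2real (A2_char W))" "AE x in lebesgue. W x = V x"
proof -
  have mw: "matrix_weight W" and fin: "A2_char W < \<infinity>" using assms by (auto simp: A2_weight_def)
  obtain V where V[measurable]: "V \<in> borel_measurable borel" and pd: "\<And>x. pos_def (V x)"
    and eq: "AE x in lebesgue. W x = V x"
    using matrix_weight_borel_version[OF mw] by blast
  have "borel_weight V (enn2real (A2_char W))"
  proof
    show "V \<in> borel_measurable borel" "pos_def (V x)" "0 \<le> enn2real (A2_char W)" for x by (simp_all add: pd)
    fix p :: "real^'d" and s :: real assume s: "s > 0"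
    let ?v = "ennreal (s ^ CARD('d))"
    let ?Q = "cube p s"
    let ?o = "\<lambda>x y. ennreal ((onorm (\<lambda>v. msqrt (W x) *v (matrix_inv (msqrt (W y)) *v v)))\<^sup>2)"
    have rel: "(relnorm (V x) (V y))\<^sup>2 \<le> ?o x y" if "W x = V x" "W y = V y" for x y
    proof -
      have "(relnorm (V x) (V y))\<^sup>2 \<le> (ennreal (onorm (\<lambda>v. msqrt (V x) *v (matrix_inv (msqrt (V y)) *v v))))\<^sup>2"
        by (intro power_mono relnorm_le_onorm pd) simp
      also have "\<dots> = ?o x y" unfolding that
        by (intro ennreal_power onorm_pos_le bounded_linear_compose[OF matrix_vector_mul_bounded_linear matrix_vector_mul_bounded_linear])
      finally show ?thesis .
    qed
    have "(\<integral>\<^sup>+x\<in>?Q. (\<integral>\<^sup>+y\<in>?Q. (relnorm (V x) (V y))\<^sup>2 \<partial>lborel) / ?v \<partial>lborel) / ?v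
      \<le> (\<integral>\<^sup>+x\<in>?Q. (\<integral>\<^sup>+y\<in>?Q. ?o x y \<partial>lebesgue) / ?v \<partial>lebesgue) / ?v"
      unfolding nn_integral_completion
    proof (intro divide_right_mono_ennreal nn_integral_mono_AE)
      have eq': "AE x in lborel. W x = V x" using eq by (simp add: AE_completion_iff)
      show "AE x in lborel. (\<integral>\<^sup>+y\<in>?Q. (relnorm (V x) (V y))\<^sup>2 \<partial>lborel) / ?v * indicator ?Q x
         \<le> (\<integral>\<^sup>+y\<in>?Q. ?o x y \<partial>lborel) / ?v * indicator ?Q x"
        using eq'
      proof eventually_elim
        case x: (elim x)
        show ?case
        proof (intro mult_right_mono divide_right_mono_ennreal nn_integral_mono_AE)
          show "AE y in lborel. (relnorm (V x) (V y))\<^sup>2 * indicator ?Q y \<le> ?o x y * indicator ?Q y"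
            using eq' by eventually_elim (intro mult_right_mono rel x; simp)
        qed simp
      qed
    qed
    also have "\<dots> \<le> A2_char W"
      unfolding A2_char_def using s
      by (intro SUP_upper2[of "(p, s)"]) (auto simp: Let_def cube_def)
    also have "\<dots> = ennreal (enn2real (A2_char W))" using fin by simp
    also have "(\<integral>\<^sup>+x\<in>?Q. (\<integral>\<^sup>+y\<in>?Q. (relnorm (V x) (V y))\<^sup>2 \<partial>lborel) / ?v \<partial>lborel)
      = (\<integral>\<^sup>+x\<in>?Q. (\<integral>\<^sup>+y\<in>?Q. (relnorm (V x) (V y))\<^sup>2 \<partial>lborel) \<partial>lborel) / ?v"
      by (subst nn_integral_divide[symmetric]) (auto simp: divide_ennreal_def ac_simps)
    finally have "(\<integral>\<^sup>+x\<in>?Q. (\<integral>\<^sup>+y\<in>?Q. (relnorm (V x) (V y))\<^sup>2 \<partial>lborel) \<partial>lborel)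
      \<le> ennreal (enn2real (A2_char W)) * ?v * ?v"
      by (rule ennreal_divide_divide_le) (use s in auto)
    also have "\<dots> = ennreal (enn2real (A2_char W) * (s ^ CARD('d))\<^sup>2)"
      using s by (simp add: ennreal_mult power2_eq_square mult.assoc)
    finally show "(\<integral>\<^sup>+x\<in>?Q. (\<integral>\<^sup>+y\<in>?Q. (relnorm (V x) (V y))\<^sup>2 \<partial>lborel) \<partial>lborel)
      \<le> ennreal (enn2real (A2_char W) * (s ^ CARD('d))\<^sup>2)" .
  qed
  then show ?thesis using that eq by blast
qed

section \<open>Decay of the energy\<close>

text \<open>Each tripling gains the factor M / (1 + M). The factor 1 + M is removed by multiplying
  with its inverse, so infinite values of E are allowed; \<open>\<rho>max\<close> limits the
  iteration to scales at which the step is available.\<close>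

lemma ennreal_geometric_decay:
  fixes E :: "real \<Rightarrow> ennreal"
  assumes M: "M \<ge> 0" and step: "\<And>\<rho>. 0 < \<rho> \<Longrightarrow> 3 * \<rho> \<le> \<rho>max \<Longrightarrow> ennreal (1 + M) * E \<rho> \<le> ennreal M * E (3 * \<rho>)"
    and "\<rho> > 0" "3 ^ N * \<rho> \<le> \<rho>max"
  shows "E \<rho> \<le> ennreal ((M / (1 + M)) ^ N) * E (3 ^ N * \<rho>)"
  using assms(4)
proof (induction N)
  case (Suc N)
  let ?s = "3 ^ N * \<rho>"
  have s: "?s > 0" "3 * ?s \<le> \<rho>max" using \<open>\<rho> > 0\<close> Suc.prems by simp_all
  have "?s \<le> \<rho>max" using s by linarith
  have "E ?s = ennreal (1 / (1 + M)) * (ennreal (1 + M) * E ?s)"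
    using M by (simp add: mult.assoc[symmetric] ennreal_mult[symmetric] del: ennreal_plus)
  also have "\<dots> \<le> ennreal (1 / (1 + M)) * (ennreal M * E (3 * ?s))" by (intro mult_left_mono step s) simp
  also have "\<dots> = ennreal (M / (1 + M)) * E (3 * ?s)"
    using M by (simp add: mult.assoc[symmetric] ennreal_mult[symmetric])
  finally have "E ?s \<le> ennreal (M / (1 + M)) * E (3 * ?s)" .
  then have "ennreal ((M / (1 + M)) ^ N) * E ?s \<le> ennreal ((M / (1 + M)) ^ N) * (ennreal (M / (1 + M)) * E (3 * ?s))"
    by (rule mult_left_mono) simp
  also have "\<dots> = ennreal ((M / (1 + M)) ^ Suc N) * E (3 ^ Suc N * \<rho>)"
    using M by (simp add: mult.assoc[symmetric] ennreal_mult[symmetric] mult.commute)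
  finally show ?case using Suc.IH[OF \<open>?s \<le> \<rho>max\<close>] order_trans by blast
qed simp

section \<open>Comparison of cubes with balls\<close>

lemma norm_le_of_mcball:
  fixes x x0 :: "real^'d" and \<rho> :: real
  assumes "x \<in> mcball x0 \<rho>" shows "dist x0 x \<le> CARD('d) * \<rho>"
proof -
  have "norm (x - x0) \<le> (\<Sum>i\<in>UNIV. \<bar>(x - x0) $ i\<bar>)" by (rule norm_le_l1_cart)
  also have "\<dots> \<le> (\<Sum>i\<in>(UNIV::'d set). \<rho>)" using assms by (intro sum_mono) (simp add: mcball_def)
  finally show ?thesis by (simp add: dist_norm norm_minus_commute)
qed

lemma ball_subset_mcball: "ball x0 r \<subseteq> mcball x0 r"
proof
  fix x assume "x \<in> ball x0 r"
  then have "norm (x - x0) < r" by (simp add: dist_norm norm_minus_commute)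
  then have "\<bar>(x - x0) $ i\<bar> \<le> r" for i using component_le_norm_cart[of "x - x0" i] by linarith
  then show "x \<in> mcball x0 r" by (simp add: mcball_def)
qed

text \<open>The exponent only has to satisfy \<open>2 \<gamma> (1 + M) \<le> 1\<close>, because \<open>M / (1 + M) \<le> exp (- 1 / (1 + M))\<close>.\<close>
lemma geometric_decay_powr:
  fixes M \<gamma> q :: real
  assumes M: "M \<ge> 0" and \<gamma>: "0 \<le> \<gamma>" "2 * \<gamma> * (1 + M) \<le> 1" and q: "q \<ge> 1" and rR: "0 < r" "R \<le> 3 ^ Suc N * (q * r)" "R > 0"
  shows "(M / (1 + M)) ^ N \<le> 3 * q * (r / R) powr \<gamma>"
proof -
  have "2 * \<gamma> * 1 \<le> 2 * \<gamma> * (1 + M)" using M \<gamma> by (intro mult_left_mono) auto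
  then have \<gamma>1: "\<gamma> \<le> 1" using \<gamma> by linarith
  have "M / (1 + M) = 1 + - (1 / (1 + M))" using M by (simp add: field_simps)
  also have "\<dots> \<le> exp (- (1 / (1 + M)))" by (rule exp_ge_add_one_self)
  also have "\<dots> \<le> exp (- (\<gamma> * ln 3))"
  proof -
    have "ln (3::real) \<le> 2" using ln_le_minus_one[of "3::real"] by simp
    then have "\<gamma> * ln 3 \<le> \<gamma> * 2" using \<gamma> by (intro mult_left_mono) auto
    also have "\<dots> \<le> 1 / (1 + M)" using \<gamma> M by (simp add: field_simps)
    finally show ?thesis by simp
  qed
  also have "\<dots> = 3 powr (- \<gamma>)" by (simp add: powr_def)
  finally have "(M / (1 + M)) ^ N \<le> (3 powr (- \<gamma>)) ^ N" using M by (intro power_mono) auto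
  also have "\<dots> = (inverse (3 ^ N)) powr \<gamma>"
    by (simp add: powr_realpow[symmetric] powr_powr powr_minus[symmetric] mult.commute)
  also have "\<dots> \<le> (3 * q * (r / R)) powr \<gamma>"
  proof (rule powr_mono2)
    show "inverse (3 ^ N) \<le> 3 * q * (r / R)" using rR by (simp add: field_simps)
  qed (use \<gamma> in auto)
  also have "\<dots> = (3 * q) powr \<gamma> * (r / R) powr \<gamma>" by (rule powr_mult)
  also have "\<dots> \<le> (3 * q) powr 1 * (r / R) powr \<gamma>"
    using q \<gamma>1 by (intro mult_right_mono powr_mono) auto
  finally show ?thesis using q by simp
qed

text \<open>The iteration runs on cubes, the claim on balls. A ball lies in the cube of the same
  half-side, and a cube of half-side \<rho> lies in the closed ball of radius d \<rho>; this
  mismatch costs the factor d, and restricting to powers of 3 costs the factor 3.\<close>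

theorem (in borel_weight) energy_decay:
  fixes a :: "('d, 'n) coeffs" and G :: "real^'d \<Rightarrow> complex^'d^'n" and \<phi> :: "nat \<Rightarrow> real^'d \<Rightarrow> complex^'n"
    and c1 C2 C r R \<gamma> :: real
  assumes d2: "CARD('d) \<ge> 2" and \<Omega>: "open \<Omega>" and a: "coeffs_measurable a"
    and E1: "E1 c1 W \<Omega> a" and E2: "E2 C2 W \<Omega> a"
    and pos: "c1 > 0" "C2 > 0" and G[measurable]: "G \<in> borel_measurable lebesgue" and weak: "weak_solution \<Omega> a G"
    and \<phi>: "\<And>k. smooth_on \<Omega> (\<phi> k)"
    and C: "C > 0" "\<And>\<beta> x0 r x. r > 0 \<Longrightarrow> \<bar>partial \<beta> (bump x0 r) (x::real^'d)\<bar> \<le> C / r"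
  defines "e \<equiv> \<lambda>S. (\<integral>\<^sup>+x\<in>S. (ennreal (wnorm_mat (W x) (G x)))\<^sup>2 \<partial>lebesgue)"
  defines "K \<equiv> 2 * C2 * CARD('d) * C * sqrt (648 * 10^6 * real CARD('d) ^ 3 * 27 ^ CARD('d)) / (c1 * flat 0 (flat 0 1))"
  assumes fin: "e \<Omega> < \<infinity>"
    and lim: "(\<lambda>k. (\<integral>\<^sup>+x\<in>\<Omega>. (ennreal (wnorm_mat (W x) (G x - Dmat (\<phi> k) x)))\<^sup>2 \<partial>lebesgue)) \<longlonglongrightarrow> 0"
    and \<gamma>: "0 \<le> \<gamma>" "2 * \<gamma> * (1 + K * A\<^sup>2) \<le> 1"
    and rR: "0 < r" "r \<le> R" "cball x0 R \<subseteq> \<Omega>"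
  shows "e (ball x0 r) \<le> ennreal (3 * real CARD('d) * (r / R) powr \<gamma>) * e (ball x0 R)"
proof -
  define h where "h = c1 * flat 0 (flat 0 1)"
  have h: "h > 0" using pos by (simp add: h_def flat_0)
  define M where "M = K * A\<^sup>2"
  have M: "M \<ge> 0" using pos C h unfolding M_def K_def h_def[symmetric] by simp
  have mono: "e S \<le> e T" if "S \<subseteq> T" for S T
    unfolding e_def using that by (intro nn_integral_mono) (auto simp: indicator_def)
  let ?d = "real CARD('d)"
  have d1: "?d \<ge> 1" using d2 by simp
  have step: "ennreal (1 + M) * e (mcball x0 \<rho>) \<le> ennreal M * e (mcball x0 (3 * \<rho>))"
    if \<rho>: "0 < \<rho>" "mcball x0 (3 * \<rho>) \<subseteq> \<Omega>" for \<rho>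
  proof -
    let ?Z = "mcball x0 (3 * \<rho>) - mball x0 \<rho>"
    have [measurable]: "mball x0 \<rho> \<in> sets lebesgue" using mball_sets(1)[of x0 \<rho>] by auto
    have "?Z \<in> sets borel" by measurable
    then have [measurable]: "?Z \<in> sets lebesgue" by auto
    \<comment> \<open>Hole filling bounds the energy of an open cube, whereas the iteration uses
      closed ones; the faces form a null set.\<close>
    have "negligible (mcball x0 \<rho> - mball x0 \<rho>)"
      unfolding mcball_cbox mball_box by (rule negligible_frontier_interval)
    then have "AE x in lebesgue. x \<notin> mcball x0 \<rho> - mball x0 \<rho>"
      by (intro AE_not_in) (simp add: negligible_iff_null_sets)
    then have eq: "e (mcball x0 \<rho>) = e (mball x0 \<rho>)"
      unfolding e_def
      by (intro nn_integral_cong_AE, eventually_elim)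
        (auto simp: indicator_def mball_def mcball_def intro: less_imp_le)
    have sub: "mball x0 \<rho> \<subseteq> mcball x0 (3 * \<rho>)"
    proof
      fix x assume x: "x \<in> mball x0 \<rho>"
      have "\<bar>x $ i - x0 $ i\<bar> \<le> 3 * \<rho>" for i
      proof -
        have "\<bar>x $ i - x0 $ i\<bar> < \<rho>" using x by (simp add: mball_def)
        then show ?thesis using \<rho> by linarith
      qed
      then show "x \<in> mcball x0 (3 * \<rho>)" by (simp add: mcball_def)
    qed
    have add: "e (mcball x0 (3 * \<rho>)) = e (mball x0 \<rho>) + e ?Z"
    proof -
      have "e (mcball x0 (3 * \<rho>)) = (\<integral>\<^sup>+x. (ennreal (wnorm_mat (W x) (G x)))\<^sup>2 * indicator (mball x0 \<rho>) x
          + (ennreal (wnorm_mat (W x) (G x)))\<^sup>2 * indicator ?Z x \<partial>lebesgue)"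
        unfolding e_def using sub by (intro nn_integral_cong) (auto simp: indicator_def)
      then show ?thesis unfolding e_def by (simp add: nn_integral_add)
    qed
    have "ennreal h * e (mball x0 \<rho>) \<le> ennreal (h * M) * e ?Z"
      using hole_filling[OF d2 \<Omega> a E1 E2 pos G weak \<phi> \<rho> C(1) C(2)[OF \<rho>(1)] fin[unfolded e_def] lim] h
      unfolding e_def M_def K_def h_def[symmetric] by (simp add: mult.assoc)
    also have "\<dots> = ennreal h * (ennreal M * e ?Z)" using h M by (simp add: ennreal_mult mult.assoc)
    finally have hf: "e (mball x0 \<rho>) \<le> ennreal M * e ?Z"
      using h by (subst (asm) ennreal_mult_le_mult_iff) auto
    \<comment> \<open>The hole is filled here: adding M times the energy of the inner cube turns the
      annulus into the full cube of triple size.\<close>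
    have "ennreal (1 + M) * e (mcball x0 \<rho>) = e (mball x0 \<rho>) + ennreal M * e (mball x0 \<rho>)"
      using M unfolding eq by (simp add: distrib_right)
    also have "\<dots> \<le> ennreal M * e ?Z + ennreal M * e (mball x0 \<rho>)" by (intro add_right_mono hf)
    also have "\<dots> = ennreal M * e (mcball x0 (3 * \<rho>))" unfolding add by (simp add: distrib_left add.commute)
    finally show ?thesis .
  qed
  show ?thesis
  proof (cases "R \<le> ?d * r")
    case True
    \<comment> \<open>Comparable radii: here r / R \<ge> 1/d, and \<gamma> \<le> 1 gives (r /
      R)^\<gamma> \<ge> r / R, so monotonicity of the energy suffices.\<close>
    have "2 * \<gamma> * 1 \<le> 2 * \<gamma> * (1 + K * A\<^sup>2)" using M \<gamma> unfolding M_def by (intro mult_left_mono) auto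
    then have \<gamma>1: "\<gamma> \<le> 1" using \<gamma> by linarith
    have rr: "0 < r / R" "r / R \<le> 1" using rR by auto
    have "1 \<le> 3 * ?d * (r / R)" using True rR by (simp add: field_simps)
    also have "r / R = (r / R) powr 1" using rR by simp
    also have "\<dots> \<le> (r / R) powr \<gamma>" using rr \<gamma>1 by (intro powr_mono') auto
    finally have "1 \<le> 3 * ?d * (r / R) powr \<gamma>" using d1 by (simp add: mult_left_mono)
    then have "1 * e (ball x0 R) \<le> ennreal (3 * ?d * (r / R) powr \<gamma>) * e (ball x0 R)"
      by (intro mult_right_mono) auto
    moreover have "e (ball x0 r) \<le> e (ball x0 R)" using rR by (intro mono) auto
    ultimately show ?thesis by (simp add: order_trans)
  next
    case False
    have dr: "?d * r > 0" using d1 rR by simp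
    \<comment> \<open>\<open>n\<close> is positive because R > d r. Its predecessor N is the last
      exponent with d 3^N r < R, which puts the cube of half-side 3^N r inside the ball of radius
      R.\<close>
    define n where "n = (LEAST n. R \<le> 3 ^ n * (?d * r))"
    have "\<exists>n. R / (?d * r) < 3 ^ n" by (rule real_arch_pow) simp
    then obtain n0 where "R / (?d * r) < 3 ^ n0" by blast
    then have "R \<le> 3 ^ n0 * (?d * r)" using dr by (simp add: pos_divide_less_eq less_imp_le)
    then have n: "R \<le> 3 ^ n * (?d * r)" unfolding n_def by (rule LeastI)
    have "n \<noteq> 0" using n False by (intro notI) simp
    then obtain N where N: "n = Suc N" by (cases n) auto
    have "\<not> R \<le> 3 ^ N * (?d * r)" using not_less_Least[of N "\<lambda>n. R \<le> 3 ^ n * (?d * r)"] N n_def by simp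
    then have NR: "?d * (3 ^ N * r) < R" by (simp add: mult.left_commute)
    have inball: "mcball x0 \<rho> \<subseteq> ball x0 R" if "\<rho> \<le> 3 ^ N * r" for \<rho>
    proof
      fix x assume "x \<in> mcball x0 \<rho>"
      then have "dist x0 x \<le> ?d * \<rho>" by (rule norm_le_of_mcball)
      also have "\<dots> \<le> ?d * (3 ^ N * r)" using that by (intro mult_left_mono) auto
      finally show "x \<in> ball x0 R" using NR by simp
    qed
    have "e (ball x0 r) \<le> e (mcball x0 r)" by (rule mono[OF ball_subset_mcball])
    also have "\<dots> \<le> ennreal ((M / (1 + M)) ^ N) * e (mcball x0 (3 ^ N * r))"
    proof (rule ennreal_geometric_decay[where E="\<lambda>\<rho>. e (mcball x0 \<rho>)" and \<rho>max="3 ^ N * r", OF M])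
      fix \<rho> :: real assume "0 < \<rho>" "3 * \<rho> \<le> 3 ^ N * r"
      then show "ennreal (1 + M) * e (mcball x0 \<rho>) \<le> ennreal M * e (mcball x0 (3 * \<rho>))"
        using inball[of "3 * \<rho>"] rR(3) ball_subset_cball by (intro step) blast+
    qed (use rR in auto)
    also have "\<dots> \<le> ennreal (3 * ?d * (r / R) powr \<gamma>) * e (ball x0 R)"
    proof (intro mult_mono ennreal_leI mono inball)
      show "(M / (1 + M)) ^ N \<le> 3 * ?d * (r / R) powr \<gamma>"
        using geometric_decay_powr[OF M \<gamma>(1) _ d1 rR(1), of R N] \<gamma>(2) n rR unfolding N M_def by simp
    qed (use rR in auto)
    finally show ?thesis .
  qed
qed

text \<open>With t = [W] and K as in \<open>energy_decay\<close>, every nonnegative \<gamma> with 2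
  \<gamma> (1 + K t^2) \<le> 1 is admissible, hence a suitable multiple of t^(-2). Since t \<ge> 1,
  the exact choice k t^(-8) lies below it, and it serves as its own lower and upper bound.\<close>

theorem mainTheorem19:
  fixes dummy :: "'d::finite itself" and dummy2 :: "'n::finite itself"
  assumes "CARD('d) \<ge> 2"
  shows "\<forall>c\<^sub>1 C\<^sub>2 :: real. c\<^sub>1 > 0 \<and> C\<^sub>2 > 0 \<longrightarrow>
    (\<exists>K k\<^sub>1 k\<^sub>2 :: real. K > 0 \<and> k\<^sub>1 > 0 \<and> k\<^sub>2 > 0 \<and>
      (\<forall>(W :: real^'d \<Rightarrow> complex^'n^'n) (\<Omega> :: (real^'d) set) (A :: ('d, 'n) coeffs)
          (u :: real^'d \<Rightarrow> complex^'n) (G :: real^'d \<Rightarrow> complex^'d^'n).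
         A2_weight W \<and> open \<Omega> \<and> coeffs_measurable A \<and> E1 c\<^sub>1 W \<Omega> A \<and> E2 C\<^sub>2 W \<Omega> A \<and>
         H12 \<Omega> W u G \<and> weak_solution \<Omega> A G \<longrightarrow>
         (\<exists>\<gamma>. k\<^sub>1 * enn2real (A2_char W) powr (-8) \<le> \<gamma> \<and> \<gamma> \<le> k\<^sub>2 * enn2real (A2_char W) powr (-8) \<and>
           (\<forall>x\<^sub>0 r R. 0 < r \<and> r \<le> R \<and> cball x\<^sub>0 R \<subseteq> \<Omega> \<longrightarrow>
              (\<integral>\<^sup>+ x \<in> ball x\<^sub>0 r. ennreal ((norm (msqrt (W x) ** G x))\<^sup>2) \<partial>lebesgue)
              \<le> ennreal (K * (r / R) powr \<gamma>) *
                (\<integral>\<^sup>+ x \<in> ball x\<^sub>0 R. ennreal ((norm (msqrt (W x) ** G x))\<^sup>2) \<partial>lebesgue)))))"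
proof (intro allI impI, elim conjE)
  fix c1 C2 :: real assume pos: "c1 > 0" "C2 > 0"
  obtain C where C: "C > 0" "\<And>\<beta> x0 r x. r > 0 \<Longrightarrow> \<bar>partial \<beta> (bump x0 r) (x::real^'d)\<bar> \<le> C / r"
    by (rule partial_bump_bounded) blast
  define K where "K = 2 * C2 * CARD('d) * C * sqrt (648 * 10^6 * real CARD('d) ^ 3 * 27 ^ CARD('d)) / (c1 * flat 0 (flat 0 1))"
  have K: "K \<ge> 0" unfolding K_def using pos C by (simp add: flat_0)
  \<comment> \<open>For t \<ge> 1 one has 1 + K t^2 \<le> (1 + K) t^2, so this k makes 2 k t^(-2) (1
    + K t^2) at most 1.\<close>
  define k where "k = 1 / (2 * (1 + K))"
  have k: "k > 0" using K by (simp add: k_def)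
  have main: "\<exists>\<gamma>. k * enn2real (A2_char W) powr (-8) \<le> \<gamma> \<and> \<gamma> \<le> k * enn2real (A2_char W) powr (-8) \<and>
           (\<forall>x\<^sub>0 r R. 0 < r \<and> r \<le> R \<and> cball x\<^sub>0 R \<subseteq> \<Omega> \<longrightarrow>
              (\<integral>\<^sup>+ x \<in> ball x\<^sub>0 r. ennreal ((norm (msqrt (W x) ** G x))\<^sup>2) \<partial>lebesgue)
              \<le> ennreal (3 * real CARD('d) * (r / R) powr \<gamma>) *
                (\<integral>\<^sup>+ x \<in> ball x\<^sub>0 R. ennreal ((norm (msqrt (W x) ** G x))\<^sup>2) \<partial>lebesgue))"
    if A2: "A2_weight W" and \<Omega>: "open \<Omega>" and a: "coeffs_measurable A" and E1: "E1 c1 W \<Omega> A" and E2: "E2 C2 W \<Omega> A"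
      and H: "H12 \<Omega> W u G" and weak: "weak_solution \<Omega> A G"
    for W :: "real^'d \<Rightarrow> complex^'n^'n" and \<Omega> :: "(real^'d) set" and A :: "('d, 'n) coeffs"
      and u :: "real^'d \<Rightarrow> complex^'n" and G :: "real^'d \<Rightarrow> complex^'d^'n"
  proof -
    define t where "t = enn2real (A2_char W)"
    obtain V where V: "borel_weight V t" and eq: "AE x in lebesgue. W x = V x"
      using A2_weight_borel_version[OF A2] unfolding t_def by blast
    interpret borel_weight V t by (rule V)
    have t: "t \<ge> 1" by (rule A_ge_1)
    \<comment> \<open>\<open>W\<close> and its Borel version agree almost everywhere, so all
      energies may be computed with \<open>V\<close>, where \<open>msqrt\<close> gives way to the
      quadratic form.\<close>
    have conv: "(\<integral>\<^sup>+ x \<in> S. ennreal ((norm (msqrt (W x) ** H x))\<^sup>2) \<partial>lebesgue)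
        = (\<integral>\<^sup>+x\<in>S. (ennreal (wnorm_mat (V x) (H x)))\<^sup>2 \<partial>lebesgue)" for S and H :: "real^'d \<Rightarrow> complex^'d^'n"
      by (rule nn_integral_cong_AE, use eq in eventually_elim)
        (simp add: norm_msqrt_mat[OF W_pos_def] ennreal_power wnorm_mat_nonneg W_pos_def)
    have E1V: "E1 c1 V \<Omega> A" using E1 eq unfolding E1_def by eventually_elim auto
    have E2V: "E2 C2 V \<Omega> A" using E2 eq unfolding E2_def by eventually_elim auto
    from H obtain \<phi> where Gm: "G \<in> borel_measurable lebesgue" and \<phi>: "\<And>k. smooth_on \<Omega> (\<phi> k)"
      and fin: "(\<integral>\<^sup>+ x \<in> \<Omega>. ennreal ((norm (msqrt (W x) ** G x))\<^sup>2) \<partial>lebesgue) < \<infinity>"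
      and lim: "(\<lambda>k. (\<integral>\<^sup>+ x \<in> \<Omega>. ennreal ((norm (msqrt (W x) *v (u x - \<phi> k x)))\<^sup>2) \<partial>lebesgue)
             + (\<integral>\<^sup>+ x \<in> \<Omega>. ennreal ((norm (msqrt (W x) ** (G x - Dmat (\<phi> k) x)))\<^sup>2) \<partial>lebesgue)) \<longlonglongrightarrow> 0"
      unfolding H12_def by blast
    \<comment> \<open>Both parts of the norm are nonnegative and their sum tends to 0, so the
      gradient part does as well.\<close>
    have limD: "(\<lambda>k. (\<integral>\<^sup>+x\<in>\<Omega>. (ennreal (wnorm_mat (V x) (G x - Dmat (\<phi> k) x)))\<^sup>2 \<partial>lebesgue)) \<longlonglongrightarrow> 0"
      unfolding conv[symmetric] by (rule tendsto_sandwich[OF _ _ tendsto_const lim]) (auto intro!: always_eventually)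
    define \<gamma> where "\<gamma> = k * t powr (-8)"
    have \<gamma>: "0 \<le> \<gamma>" "2 * \<gamma> * (1 + K * t\<^sup>2) \<le> 1"
    proof -
      show "0 \<le> \<gamma>" using k by (simp add: \<gamma>_def)
      have "t powr (-8) \<le> t powr (-2)" using t by (intro powr_mono) auto
      also have "t powr (-2) = 1 / t\<^sup>2" using t by (simp add: powr_minus divide_inverse)
      finally have "2 * \<gamma> * (1 + K * t\<^sup>2) \<le> 2 * (k * (1 / t\<^sup>2)) * (1 + K * t\<^sup>2)"
        unfolding \<gamma>_def using k K by (intro mult_right_mono mult_left_mono) auto
      also have "\<dots> \<le> 2 * (k * (1 / t\<^sup>2)) * ((1 + K) * t\<^sup>2)"
        using k K t by (intro mult_left_mono) (auto simp: distrib_right)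
      also have "\<dots> = 1"
      proof -
        have "t\<^sup>2 \<noteq> 0" "1 + K \<noteq> 0" using t K by auto
        then show ?thesis by (simp add: k_def)
      qed
      finally show "2 * \<gamma> * (1 + K * t\<^sup>2) \<le> 1" .
    qed
    have "\<forall>x\<^sub>0 r R. 0 < r \<and> r \<le> R \<and> cball x\<^sub>0 R \<subseteq> \<Omega> \<longrightarrow>
              (\<integral>\<^sup>+ x \<in> ball x\<^sub>0 r. ennreal ((norm (msqrt (W x) ** G x))\<^sup>2) \<partial>lebesgue)
              \<le> ennreal (3 * real CARD('d) * (r / R) powr \<gamma>) *
                (\<integral>\<^sup>+ x \<in> ball x\<^sub>0 R. ennreal ((norm (msqrt (W x) ** G x))\<^sup>2) \<partial>lebesgue)"
      unfolding conv
      using energy_decay[OF assms \<Omega> a E1V E2V pos Gm weak \<phi> C fin[unfolded conv] limD \<gamma>(1) \<gamma>(2)[unfolded K_def]]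
      by blast
    then show ?thesis unfolding \<gamma>_def t_def by blast
  qed
  show "\<exists>K k\<^sub>1 k\<^sub>2 :: real. K > 0 \<and> k\<^sub>1 > 0 \<and> k\<^sub>2 > 0 \<and>
      (\<forall>(W :: real^'d \<Rightarrow> complex^'n^'n) (\<Omega> :: (real^'d) set) (A :: ('d, 'n) coeffs)
          (u :: real^'d \<Rightarrow> complex^'n) (G :: real^'d \<Rightarrow> complex^'d^'n).
         A2_weight W \<and> open \<Omega> \<and> coeffs_measurable A \<and> E1 c1 W \<Omega> A \<and> E2 C2 W \<Omega> A \<and>
         H12 \<Omega> W u G \<and> weak_solution \<Omega> A G \<longrightarrow>
         (\<exists>\<gamma>. k\<^sub>1 * enn2real (A2_char W) powr (-8) \<le> \<gamma> \<and> \<gamma> \<le> k\<^sub>2 * enn2real (A2_char W) powr (-8) \<and>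
           (\<forall>x\<^sub>0 r R. 0 < r \<and> r \<le> R \<and> cball x\<^sub>0 R \<subseteq> \<Omega> \<longrightarrow>
              (\<integral>\<^sup>+ x \<in> ball x\<^sub>0 r. ennreal ((norm (msqrt (W x) ** G x))\<^sup>2) \<partial>lebesgue)
              \<le> ennreal (K * (r / R) powr \<gamma>) *
                (\<integral>\<^sup>+ x \<in> ball x\<^sub>0 R. ennreal ((norm (msqrt (W x) ** G x))\<^sup>2) \<partial>lebesgue))))"
    by (rule exI[of _ "3 * real CARD('d)"], rule exI[of _ k], rule exI[of _ k], intro conjI allI impI k,
        simp, elim conjE, rule main)
qed

end
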